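(* Let $\Lambda$ be a row-finite $k$-graph with no sources, let $K$ be a field, and let $\overline{\Lambda}=\Lambda\times_d\mathbb{Z}^k$ be the skew-product $k$-graph. For $m\le n$ in $\mathbb{Z}^k$ let $\phi_{m,n}:\mathbb{N}\Lambda^0\to\mathbb{N}\Lambda^0$ be the monoid homomorphism with $\phi_{m,n}(v)=\sum_{w\in\Lambda^0}|v\Lambda^{n-m}w|\,w$ for $v\in\Lambda^0$. Then there is an isomorphism of monoids $$\mathcal{V}(\mathrm{KP}_K(\overline{\Lambda}))\cong\varinjlim_{\mathbb{Z}^k}\big(\mathbb{N}\Lambda^0,\phi_{m,n}\big)$$ that carries $[(v,n)]$, for $v\in\Lambda^0$ and $n\in\mathbb{Z}^k$, to (the class of) the copy of $v$ in the $n$th copy of $\mathbb{N}\Lambda^0$. Furthermore, the monoid $\mathcal{V}(\mathrm{KP}_K(\overline{\Lambda}))$ is cancellative.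
   Context: A $k$-graph is a countable category $\Lambda=(\Lambda^0,\Lambda,r,s)$ (objects identified with identity morphisms $\Lambda^0$; paths composed right to left, so $\lambda\mu$ is defined when $s(\lambda)=r(\mu)$) with a functor $d:\Lambda\to\mathbb{N}^k$ such that if $d(\lambda)=m+n$ there are unique $\mu,\nu\in\Lambda$ with $d(\mu)=m$, $d(\nu)=n$, $\lambda=\mu\nu$. For $v,w\in\Lambda^0$, $n\in\mathbb{N}^k$: $v\Lambda^n=r^{-1}(v)\cap d^{-1}(n)$ and $v\Lambda^nw=v\Lambda^n\cap s^{-1}(w)$. $\Lambda$ is row-finite if every $v\Lambda^n$ is finite, and has no sources if every $v\Lambda^n$ is nonempty. $\mathrm{KP}_K(\Lambda)$ is the $K$-algebra generated by $\Lambda\cup\Lambda^*$ ($\Lambda^*=\{\lambda^*\}$ formal symbols) subject to: (KP1) the elements of $\Lambda^0$ are mutually orthogonal idempotents and $v=v^*$ for $v\in\Lambda^0$; (KP2) for $r(\mu)=s(\lambda)$, the product $\lambda\mu$ equals the composite $\lambda\circ\mu$, $\mu^*\lambda^*=(\lambda\circ\mu)^*$, $r(\lambda)\lambda=\lambda=\lambda s(\lambda)$, $s(\lambda)\lambda^*=\lambda^*=\lambda^*r(\lambda)$; (KP3) $\lambda^*\mu=\delta_{\lambda,\mu}s(\lambda)$ whenever $d(\lambda)=d(\mu)$; (KP4) $v=\sum_{\lambda\in v\Lambda^n}\lambda\lambda^*$ for all $v\in\Lambda^0$, $n\in\mathbb{N}^k\setminus\{0\}$. The skew-product $k$-graph $\overline\Lambda=\Lambda\times_d\mathbb{Z}^k$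 is the set $\Lambda\times\mathbb{Z}^k$ with degree $\overline d(\lambda,n)=d(\lambda)$, $r(\lambda,n)=(r(\lambda),n)$, $s(\lambda,n)=(s(\lambda),n+d(\lambda))$, and composition $(\lambda,n)(\mu,n+d(\lambda))=(\lambda\mu,n)$; it is again row-finite with no sources, with vertices $(v,n)$. For a (possibly non-unital) ring $B$, $\mathcal{V}(B)$ is the abelian monoid of equivalence classes of idempotents in $M_\infty(B)$ (finitely supported matrices), where $e\sim f$ iff $e=xy$, $f=yx$ for some $x,y\in M_\infty(B)$, with addition given by block-diagonal sum. $\mathbb{N}\Lambda^0$ is the free abelian monoid on $\Lambda^0$. $\mathbb{Z}^k$ has the coordinatewise partial order. A monoid is cancellative if $x+z=y+z$ implies $x=y$. *)

theory Defs
  imports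
    "HOL-Analysis.Finite_Cartesian_Product"
    "HOL-Algebra.QuotRing"
    "HOL-Library.Poly_Mapping"
    "HOL-Library.Multiset"
    "HOL-Library.Countable_Set"
begin

section \<open>Higher-rank graphs\<close>

text \<open>
  The index type \<open>'k\<close> plays the role of \<open>{1, \<dots>, k}\<close>; in particular \<open>k \<ge> 1\<close>.
  Paths compose from right to left: \<open>cmp \<Lambda> \<mu> \<nu>\<close> is \<open>\<mu>\<nu>\<close>, meaningful when
  \<open>src \<Lambda> \<mu> = rng \<Lambda> \<nu>\<close>; all the maps are irrelevant outside the paths.
\<close>

record ('a, 'k::finite) kgraph =
  paths :: "'a set"
  verts :: "'a set"
  rng   :: "'a \<Rightarrow> 'a"
  src   :: "'a \<Rightarrow> 'a"
  cmp   :: "'a \<Rightarrow> 'a \<Rightarrow> 'a"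
  deg   :: "'a \<Rightarrow> nat ^ 'k"

locale is_kgraph =
  fixes \<Lambda> :: "('a, 'k::finite) kgraph"
  assumes countable_paths: "countable (paths \<Lambda>)"
    and verts_subset: "verts \<Lambda> \<subseteq> paths \<Lambda>"
    and rng_closed: "\<mu> \<in> paths \<Lambda> \<Longrightarrow> rng \<Lambda> \<mu> \<in> verts \<Lambda>"
    and src_closed: "\<mu> \<in> paths \<Lambda> \<Longrightarrow> src \<Lambda> \<mu> \<in> verts \<Lambda>"
    and rng_vert: "v \<in> verts \<Lambda> \<Longrightarrow> rng \<Lambda> v = v"
    and src_vert: "v \<in> verts \<Lambda> \<Longrightarrow> src \<Lambda> v = v"
    and cmp_closed: "\<lbrakk>\<mu> \<in> paths \<Lambda>; \<nu> \<in> paths \<Lambda>; src \<Lambda> \<mu> = rng \<Lambda> \<nu>\<rbrakk> \<Longrightarrow> cmp \<Lambda> \<mu> \<nu> \<in> paths \<Lambda>"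
    and rng_cmp: "\<lbrakk>\<mu> \<in> paths \<Lambda>; \<nu> \<in> paths \<Lambda>; src \<Lambda> \<mu> = rng \<Lambda> \<nu>\<rbrakk> \<Longrightarrow> rng \<Lambda> (cmp \<Lambda> \<mu> \<nu>) = rng \<Lambda> \<mu>"
    and src_cmp: "\<lbrakk>\<mu> \<in> paths \<Lambda>; \<nu> \<in> paths \<Lambda>; src \<Lambda> \<mu> = rng \<Lambda> \<nu>\<rbrakk> \<Longrightarrow> src \<Lambda> (cmp \<Lambda> \<mu> \<nu>) = src \<Lambda> \<nu>"
    and cmp_rng: "\<mu> \<in> paths \<Lambda> \<Longrightarrow> cmp \<Lambda> (rng \<Lambda> \<mu>) \<mu> = \<mu>"
    and cmp_src: "\<mu> \<in> paths \<Lambda> \<Longrightarrow> cmp \<Lambda> \<mu> (src \<Lambda> \<mu>) = \<mu>"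
    and cmp_assoc: "\<lbrakk>\<mu> \<in> paths \<Lambda>; \<nu> \<in> paths \<Lambda>; \<rho> \<in> paths \<Lambda>;
        src \<Lambda> \<mu> = rng \<Lambda> \<nu>; src \<Lambda> \<nu> = rng \<Lambda> \<rho>\<rbrakk> \<Longrightarrow>
        cmp \<Lambda> (cmp \<Lambda> \<mu> \<nu>) \<rho> = cmp \<Lambda> \<mu> (cmp \<Lambda> \<nu> \<rho>)"
    and deg_vert: "v \<in> verts \<Lambda> \<Longrightarrow> deg \<Lambda> v = 0"
    and deg_cmp: "\<lbrakk>\<mu> \<in> paths \<Lambda>; \<nu> \<in> paths \<Lambda>; src \<Lambda> \<mu> = rng \<Lambda> \<nu>\<rbrakk> \<Longrightarrow>
        deg \<Lambda> (cmp \<Lambda> \<mu> \<nu>) = deg \<Lambda> \<mu> + deg \<Lambda> \<nu>"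
    and factorization: "\<lbrakk>\<mu> \<in> paths \<Lambda>; deg \<Lambda> \<mu> = m + n\<rbrakk> \<Longrightarrow>
        \<exists>!(\<nu>, \<rho>). \<nu> \<in> paths \<Lambda> \<and> \<rho> \<in> paths \<Lambda> \<and> src \<Lambda> \<nu> = rng \<Lambda> \<rho> \<and>
          deg \<Lambda> \<nu> = m \<and> deg \<Lambda> \<rho> = n \<and> cmp \<Lambda> \<nu> \<rho> = \<mu>"

text \<open>\<open>paths_from \<Lambda> v n\<close> is \<open>v\<Lambda>\<^sup>n\<close> and \<open>paths_between \<Lambda> v n w\<close> is \<open>v\<Lambda>\<^sup>nw\<close>.\<close>

definition paths_from :: "('a, 'k::finite) kgraph \<Rightarrow> 'a \<Rightarrow> nat ^ 'k \<Rightarrow> 'a set" where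
  "paths_from \<Lambda> v n = {\<mu> \<in> paths \<Lambda>. rng \<Lambda> \<mu> = v \<and> deg \<Lambda> \<mu> = n}"

definition paths_between :: "('a, 'k::finite) kgraph \<Rightarrow> 'a \<Rightarrow> nat ^ 'k \<Rightarrow> 'a \<Rightarrow> 'a set" where
  "paths_between \<Lambda> v n w = {\<mu> \<in> paths_from \<Lambda> v n. src \<Lambda> \<mu> = w}"

definition row_finite :: "('a, 'k::finite) kgraph \<Rightarrow> bool" where
  "row_finite \<Lambda> \<longleftrightarrow> (\<forall>v \<in> verts \<Lambda>. \<forall>n. finite (paths_from \<Lambda> v n))"

definition no_sources :: "('a, 'k::finite) kgraph \<Rightarrow> bool" where
  "no_sources \<Lambda> \<longleftrightarrow> (\<forall>v \<in> verts \<Lambda>. \<forall>n. paths_from \<Lambda> v n \<noteq> {})"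

definition skew_product :: "('a, 'k::finite) kgraph \<Rightarrow> ('a \<times> (int ^ 'k), 'k) kgraph" where
  "skew_product \<Lambda> =
    \<lparr>paths = paths \<Lambda> \<times> UNIV,
     verts = verts \<Lambda> \<times> UNIV,
     rng = (\<lambda>(\<mu>, n). (rng \<Lambda> \<mu>, n)),
     src = (\<lambda>(\<mu>, n). (src \<Lambda> \<mu>, n + (\<chi> i. int (deg \<Lambda> \<mu> $ i)))),
     cmp = (\<lambda>(\<mu>, n) (\<nu>, _). (cmp \<Lambda> \<mu> \<nu>, n)),
     deg = (\<lambda>(\<mu>, n). deg \<Lambda> \<mu>)\<rparr>"


section \<open>Free algebras\<close>

text \<open>Words form a monoid under concatenation, written additively because this is what the
  convolution product of \<^type>\<open>poly_mapping\<close> requires.\<close>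

datatype 'g word = Word (letters: "'g list")

instantiation word :: (type) monoid_add
begin

definition zero_word :: "'a word" where
  "0 = Word []"

definition plus_word :: "'a word \<Rightarrow> 'a word \<Rightarrow> 'a word" where
  "u + w = Word (letters u @ letters w)"

instance
  by standard (simp_all add: zero_word_def plus_word_def)

end

text \<open>The free associative unital algebra over the field \<open>'f\<close> on the set \<open>X\<close>.\<close>

definition free_algebra :: "'g set \<Rightarrow> ('g word \<Rightarrow>\<^sub>0 'f::field) ring" where
  "free_algebra X =
    \<lparr>carrier = {p. \<forall>w \<in> Poly_Mapping.keys p. set (letters w) \<subseteq> X},
     monoid.mult = (*), one = 1, zero = 0, add = (+)\<rparr>"


section \<open>Kumjian--Pask algebras\<close>

datatype 'a kp_gen = Path 'a | Ghost 'a

abbreviation path :: "'a \<Rightarrow> ('a kp_gen word \<Rightarrow>\<^sub>0 'f::field)" where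
  "path \<mu> \<equiv> Poly_Mapping.single (Word [Path \<mu>]) 1"

abbreviation ghost :: "'a \<Rightarrow> ('a kp_gen word \<Rightarrow>\<^sub>0 'f::field)" where
  "ghost \<mu> \<equiv> Poly_Mapping.single (Word [Ghost \<mu>]) 1"

definition kp_free :: "('a, 'k::finite) kgraph \<Rightarrow> ('a kp_gen word \<Rightarrow>\<^sub>0 'f::field) ring" where
  "kp_free \<Lambda> = free_algebra (Path ` paths \<Lambda> \<union> Ghost ` paths \<Lambda>)"

text \<open>Each relation \<open>a = b\<close> is recorded as the element \<open>a - b\<close>.\<close>

definition kp1_relators :: "('a, 'k::finite) kgraph \<Rightarrow> ('a kp_gen word \<Rightarrow>\<^sub>0 'f::field) set" where
  "kp1_relators \<Lambda> =
     {path v * path w - (if v = w then path v else 0) | v w. v \<in> verts \<Lambda> \<and> w \<in> verts \<Lambda>}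
   \<union> {path v - ghost v | v. v \<in> verts \<Lambda>}"

definition kp2_relators :: "('a, 'k::finite) kgraph \<Rightarrow> ('a kp_gen word \<Rightarrow>\<^sub>0 'f::field) set" where
  "kp2_relators \<Lambda> =
     {path \<mu> * path \<nu> - path (cmp \<Lambda> \<mu> \<nu>) | \<mu> \<nu>.
        \<mu> \<in> paths \<Lambda> \<and> \<nu> \<in> paths \<Lambda> \<and> rng \<Lambda> \<nu> = src \<Lambda> \<mu>}
   \<union> {ghost \<nu> * ghost \<mu> - ghost (cmp \<Lambda> \<mu> \<nu>) | \<mu> \<nu>.
        \<mu> \<in> paths \<Lambda> \<and> \<nu> \<in> paths \<Lambda> \<and> rng \<Lambda> \<nu> = src \<Lambda> \<mu>}
   \<union> {path (rng \<Lambda> \<mu>) * path \<mu> - path \<mu> | \<mu>. \<mu> \<in> paths \<Lambda>}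
   \<union> {path \<mu> * path (src \<Lambda> \<mu>) - path \<mu> | \<mu>. \<mu> \<in> paths \<Lambda>}
   \<union> {path (src \<Lambda> \<mu>) * ghost \<mu> - ghost \<mu> | \<mu>. \<mu> \<in> paths \<Lambda>}
   \<union> {ghost \<mu> * path (rng \<Lambda> \<mu>) - ghost \<mu> | \<mu>. \<mu> \<in> paths \<Lambda>}"

definition kp3_relators :: "('a, 'k::finite) kgraph \<Rightarrow> ('a kp_gen word \<Rightarrow>\<^sub>0 'f::field) set" where
  "kp3_relators \<Lambda> =
     {ghost \<mu> * path \<nu> - (if \<mu> = \<nu> then path (src \<Lambda> \<mu>) else 0) | \<mu> \<nu>.
        \<mu> \<in> paths \<Lambda> \<and> \<nu> \<in> paths \<Lambda> \<and> deg \<Lambda> \<mu> = deg \<Lambda> \<nu>}"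

definition kp4_relators :: "('a, 'k::finite) kgraph \<Rightarrow> ('a kp_gen word \<Rightarrow>\<^sub>0 'f::field) set" where
  "kp4_relators \<Lambda> =
     {path v - (\<Sum>\<mu> \<in> paths_from \<Lambda> v n. path \<mu> * ghost \<mu>) | v n. v \<in> verts \<Lambda> \<and> n \<noteq> 0}"

definition kp_ideal :: "('a, 'k::finite) kgraph \<Rightarrow> ('a kp_gen word \<Rightarrow>\<^sub>0 'f::field) set" where
  "kp_ideal \<Lambda> =
     Idl\<^bsub>kp_free \<Lambda>\<^esub> (kp1_relators \<Lambda> \<union> kp2_relators \<Lambda> \<union> kp3_relators \<Lambda> \<union> kp4_relators \<Lambda>)"

definition kp_class :: "('a, 'k::finite) kgraph \<Rightarrow> ('a kp_gen word \<Rightarrow>\<^sub>0 'f::field)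
    \<Rightarrow> ('a kp_gen word \<Rightarrow>\<^sub>0 'f) set" where
  "kp_class \<Lambda> p = a_r_coset (kp_free \<Lambda>) (kp_ideal \<Lambda>) p"

text \<open>
  Kumjian--Pask algebras are in general not unital, so the presentation has to be read among
  non-unital algebras: the free non-unital algebra consists of the polynomials without constant
  term. All relators lie in it, and the ideal that they generate is the same in the unital as in the
  non-unital free algebra, so the Kumjian--Pask algebra is the set of cosets of such polynomials.
  The field \<^const>\<open>one\<close> of this record is a leftover of the unital quotient; it need not
  belong to the carrier and is never used.
\<close>

definition kumjian_pask :: "'f::field itself \<Rightarrow> ('a, 'k::finite) kgraph
    \<Rightarrow> ('a kp_gen word \<Rightarrow>\<^sub>0 'f) set ring" where
  "kumjian_pask K \<Lambda> =
     (kp_free \<Lambda> Quot kp_ideal \<Lambda>)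
       \<lparr>carrier := {kp_class \<Lambda> p | p. p \<in> carrier (kp_free \<Lambda>) \<and> Poly_Mapping.lookup p 0 = 0}\<rparr>"

definition kp_vertex :: "'f::field itself \<Rightarrow> ('a, 'k::finite) kgraph \<Rightarrow> 'a
    \<Rightarrow> ('a kp_gen word \<Rightarrow>\<^sub>0 'f) set" where
  "kp_vertex K \<Lambda> v = kp_class \<Lambda> (path v)"


section \<open>The monoid of idempotent matrices\<close>

text \<open>For a ring \<open>B\<close>, possibly without unit: \<^const>\<open>one\<close> of \<open>B\<close> is not used.
  Matrices are indexed by \<open>\<nat> \<times> \<nat>\<close>, starting from \<open>0\<close>.\<close>

definition Minf :: "('b, 'm) ring_scheme \<Rightarrow> (nat \<Rightarrow> nat \<Rightarrow> 'b) set" where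
  "Minf B = {x. (\<forall>i j. x i j \<in> carrier B) \<and> finite {(i, j). x i j \<noteq> \<zero>\<^bsub>B\<^esub>}}"

text \<open>The sum over \<open>l\<close> is restricted to the finitely many \<open>l\<close> with \<open>x i l \<noteq> 0\<close>.\<close>

definition Minf_mult :: "('b, 'm) ring_scheme
    \<Rightarrow> (nat \<Rightarrow> nat \<Rightarrow> 'b) \<Rightarrow> (nat \<Rightarrow> nat \<Rightarrow> 'b) \<Rightarrow> (nat \<Rightarrow> nat \<Rightarrow> 'b)" where
  "Minf_mult B x y = (\<lambda>i j. \<Oplus>\<^bsub>B\<^esub> l \<in> {l. x i l \<noteq> \<zero>\<^bsub>B\<^esub>}. x i l \<otimes>\<^bsub>B\<^esub> y l j)"

definition Minf_idem :: "('b, 'm) ring_scheme \<Rightarrow> (nat \<Rightarrow> nat \<Rightarrow> 'b) set" where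
  "Minf_idem B = {e \<in> Minf B. Minf_mult B e e = e}"

definition idem_rel :: "('b, 'm) ring_scheme \<Rightarrow> ((nat \<Rightarrow> nat \<Rightarrow> 'b) \<times> (nat \<Rightarrow> nat \<Rightarrow> 'b)) set" where
  "idem_rel B = {(e, f). e \<in> Minf_idem B \<and> f \<in> Minf_idem B \<and>
     (\<exists>x \<in> Minf B. \<exists>y \<in> Minf B. e = Minf_mult B x y \<and> f = Minf_mult B y x)}"

definition supported_below :: "('b, 'm) ring_scheme \<Rightarrow> nat \<Rightarrow> (nat \<Rightarrow> nat \<Rightarrow> 'b) \<Rightarrow> bool" where
  "supported_below B n x \<longleftrightarrow> (\<forall>i j. x i j \<noteq> \<zero>\<^bsub>B\<^esub> \<longrightarrow> i < n \<and> j < n)"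

text \<open>The block-diagonal sum of \<open>x\<close>, regarded as an \<open>n \<times> n\<close> matrix, and \<open>y\<close>.\<close>

definition block_diag :: "('b, 'm) ring_scheme \<Rightarrow> nat
    \<Rightarrow> (nat \<Rightarrow> nat \<Rightarrow> 'b) \<Rightarrow> (nat \<Rightarrow> nat \<Rightarrow> 'b) \<Rightarrow> (nat \<Rightarrow> nat \<Rightarrow> 'b)" where
  "block_diag B n x y = (\<lambda>i j.
     if i < n \<and> j < n then x i j
     else if n \<le> i \<and> n \<le> j then y (i - n) (j - n)
     else \<zero>\<^bsub>B\<^esub>)"

text \<open>
  The monoid \<open>\<V>(B)\<close>, as a multiplicatively written record. The sum of two classes is the
  union of the classes of all \<open>e \<oplus> f\<close> with \<open>e\<close> and \<open>f\<close> in the two classes and all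
  admissible sizes of \<open>e\<close>; they are one and the same class (compare \<^const>\<open>rcoset_mult\<close>).
\<close>

definition Vmonoid :: "('b, 'm) ring_scheme \<Rightarrow> (nat \<Rightarrow> nat \<Rightarrow> 'b) set monoid" where
  "Vmonoid B =
    \<lparr>carrier = Minf_idem B // idem_rel B,
     monoid.mult = (\<lambda>P Q. \<Union>{idem_rel B `` {block_diag B n e f} | n e f.
               e \<in> P \<and> f \<in> Q \<and> supported_below B n e}),
     one = idem_rel B `` {\<lambda>i j. \<zero>\<^bsub>B\<^esub>}\<rparr>"

text \<open>The class \<open>[b]\<close> of an idempotent \<open>b\<close> of \<open>B\<close>, viewed as a \<open>1 \<times> 1\<close> matrix.\<close>

definition Vclass :: "('b, 'm) ring_scheme \<Rightarrow> 'b \<Rightarrow> (nat \<Rightarrow> nat \<Rightarrow> 'b) set" where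
  "Vclass B b = idem_rel B `` {\<lambda>i j. if i = 0 \<and> j = 0 then b else \<zero>\<^bsub>B\<^esub>}"


section \<open>Direct limits of monoids\<close>

text \<open>
  The direct limit of monoids \<open>M n\<close>, with connecting maps \<open>\<phi> m n\<close> for \<open>m \<le> n\<close>,
  indexed by the directed partial order \<open>'i\<close>. An element \<open>x\<close> of the copy of index \<open>n\<close>
  is represented by the pair \<open>(n, x)\<close>. As before, products are unions of coinciding classes.
\<close>

definition dirlim_rel :: "('i::order \<Rightarrow> ('b, 'm) monoid_scheme) \<Rightarrow> ('i \<Rightarrow> 'i \<Rightarrow> 'b \<Rightarrow> 'b)
    \<Rightarrow> (('i \<times> 'b) \<times> ('i \<times> 'b)) set" where
  "dirlim_rel M \<phi> = {((m, x), (n, y)). x \<in> carrier (M m) \<and> y \<in> carrier (M n) \<and>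
     (\<exists>p. m \<le> p \<and> n \<le> p \<and> \<phi> m p x = \<phi> n p y)}"

definition dirlim_class :: "('i::order \<Rightarrow> ('b, 'm) monoid_scheme) \<Rightarrow> ('i \<Rightarrow> 'i \<Rightarrow> 'b \<Rightarrow> 'b)
    \<Rightarrow> 'i \<Rightarrow> 'b \<Rightarrow> ('i \<times> 'b) set" where
  "dirlim_class M \<phi> n x = dirlim_rel M \<phi> `` {(n, x)}"

definition dirlim :: "('i::order \<Rightarrow> ('b, 'm) monoid_scheme) \<Rightarrow> ('i \<Rightarrow> 'i \<Rightarrow> 'b \<Rightarrow> 'b)
    \<Rightarrow> ('i \<times> 'b) set monoid" where
  "dirlim M \<phi> =
    \<lparr>carrier = {dirlim_class M \<phi> n x | n x. x \<in> carrier (M n)},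
     monoid.mult = (\<lambda>P Q. \<Union>{dirlim_class M \<phi> p (\<phi> m p x \<otimes>\<^bsub>M p\<^esub> \<phi> n p y) | m x n y p.
               (m, x) \<in> P \<and> (n, y) \<in> Q \<and> m \<le> p \<and> n \<le> p}),
     one = \<Union>{dirlim_class M \<phi> n \<one>\<^bsub>M n\<^esub> | n. True}\<rparr>"


section \<open>The direct system of a higher-rank graph\<close>

text \<open>\<open>\<nat>\<Lambda>\<^sup>0\<close>, realised as finite multisets.\<close>

definition free_comm_monoid :: "'a set \<Rightarrow> 'a multiset monoid" where
  "free_comm_monoid X = \<lparr>carrier = {A. set_mset A \<subseteq> X}, monoid.mult = (+), one = {#}\<rparr>"

text \<open>\<open>\<Sum>\<^sub>w |v\<Lambda>\<^sup>nw| w\<close>, the sum being restricted to its nonzero terms.\<close>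

definition vertex_image :: "('a, 'k::finite) kgraph \<Rightarrow> nat ^ 'k \<Rightarrow> 'a \<Rightarrow> 'a multiset" where
  "vertex_image \<Lambda> n v =
     (\<Sum>w \<in> {w \<in> verts \<Lambda>. paths_between \<Lambda> v n w \<noteq> {}}.
        replicate_mset (card (paths_between \<Lambda> v n w)) w)"

text \<open>The additive extension of \<^const>\<open>vertex_image\<close> for \<open>n - m\<close>; only used for \<open>m \<le> n\<close>.\<close>

definition connecting_map :: "('a, 'k::finite) kgraph \<Rightarrow> int ^ 'k \<Rightarrow> int ^ 'k
    \<Rightarrow> 'a multiset \<Rightarrow> 'a multiset" where
  "connecting_map \<Lambda> m n A = (\<Sum>v \<in># A. vertex_image \<Lambda> (\<chi> i. nat ((n - m) $ i)) v)"

abbreviation vertex_limit :: "('a, 'k::finite) kgraph \<Rightarrow> ((int ^ 'k) \<times> 'a multiset) set monoid" where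
  "vertex_limit \<Lambda> \<equiv> dirlim (\<lambda>_. free_comm_monoid (verts \<Lambda>)) (connecting_map \<Lambda>)"

abbreviation vertex_limit_class :: "('a, 'k::finite) kgraph \<Rightarrow> int ^ 'k \<Rightarrow> 'a multiset
    \<Rightarrow> ((int ^ 'k) \<times> 'a multiset) set" where
  "vertex_limit_class \<Lambda> \<equiv> dirlim_class (\<lambda>_. free_comm_monoid (verts \<Lambda>)) (connecting_map \<Lambda>)"

definition cancellative :: "('b, 'm) monoid_scheme \<Rightarrow> bool" where
  "cancellative M \<longleftrightarrow> (\<forall>x \<in> carrier M. \<forall>y \<in> carrier M. \<forall>z \<in> carrier M.
     x \<otimes>\<^bsub>M\<^esub> z = y \<otimes>\<^bsub>M\<^esub> z \<longrightarrow> x = y)"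

end

theory Submission
  imports Defs
begin

text \<open>
  Every path of \<open>\<Lambda> \<times>\<^sub>d \<int>\<^sup>k\<close> from \<open>(v, m)\<close> to \<open>(w, n)\<close> has degree \<open>n - m\<close>. Hence the products
  \<open>\<alpha>\<beta>\<^sup>*\<close> of paths with a common source at level \<open>n\<close> behave like matrix units, and by (KP4) every
  element of the algebra is a combination of them once \<open>n\<close> is large. Conversely, letting paths act on
  paths by composition and ghosts by deletion of a prefix gives a representation in which (KP4) holds
  on all paths ending at a sufficiently large level; so two congruent polynomials have the same matrix at all
  large levels. An idempotent matrix is therefore, at a large level, an idempotent matrix over the
  field that is block diagonal with respect to the source. Splitting it into rank-one pieces shows that it is
  equivalent to a diagonal matrix of vertices \<open>(w, n)\<close>, and the ranks of the blocks show that the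
  multiset of these vertices is unique up to the maps \<open>\<phi>\<^sub>m\<^sub>,\<^sub>n\<close>.
\<close>

section \<open>Levels and skew products\<close>

text \<open>The span of all finite paths carries no representation of the algebra: a path whose
  degree is not at least d has no prefix of degree d, so every ghost of degree d kills it while its
  range vertex fixes it, against (KP4). The failure concerns only low levels, and how low depends on
  the relation. Hence all comparisons are made along the filter \<open>at_top\<close> on the
  directed set of levels: the polynomials that act as zero at all sufficiently large levels form an
  ideal containing the relators. Each argument combines only finitely many such statements, so a
  common level always exists. This takes the place of a faithful model of the algebra and of a
  continuity theorem for the monoid of idempotents. The price is some care with finiteness:
  infinitely many paths may end at a given level, but a nonempty word acts on only finitely many of
  them, so a polynomial without constant term is a finite matrix there.\<close>

definition vec_int :: "nat ^ 'k::finite \<Rightarrow> int ^ 'k" where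
  "vec_int n = (\<chi> i. int (n $ i))"

definition vec_nat :: "int ^ 'k::finite \<Rightarrow> nat ^ 'k" where
  "vec_nat n = (\<chi> i. nat (n $ i))"

lemma vec_int_add: "vec_int (m + n) = vec_int m + vec_int n"
  by (simp add: vec_int_def vec_eq_iff)

lemma vec_int_0 [simp]: "vec_int 0 = 0"
  by (simp add: vec_int_def vec_eq_iff)

lemma vec_int_inject [simp]: "vec_int m = vec_int n \<longleftrightarrow> m = n"
  by (simp add: vec_int_def vec_eq_iff)

lemma vec_int_nat: "m \<le> n \<Longrightarrow> m + vec_int (vec_nat (n - m)) = n"
  by (simp add: vec_int_def vec_nat_def vec_eq_iff less_eq_vec_def)

lemma vec_nat_vec_int: "vec_nat (vec_int d) = d"
  by (simp add: vec_int_def vec_nat_def vec_eq_iff)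

lemma vec_int_nonneg: "m \<le> m + vec_int d"
  by (simp add: vec_int_def less_eq_vec_def)

lemma le_imp_add_vec: "m \<le> n \<Longrightarrow> \<exists>d. n = m + (d :: nat ^ 'k::finite)"
  by (rule exI[of _ "\<chi> i. n $ i - m $ i"]) (simp add: vec_eq_iff less_eq_vec_def)

text \<open>The order on levels is only partial, so a base of \<open>at_top\<close> comes from
  directedness: the coordinatewise maximum lies above both bounds.\<close>

lemma eventually_at_top_vec:
  "eventually P (at_top :: (int ^ 'k::finite) filter) \<longleftrightarrow> (\<exists>N. \<forall>n\<ge>N. P n)"
proof -
  have "eventually P (INF N. principal {N :: int ^ 'k..}) \<longleftrightarrow>
      (\<exists>N\<in>UNIV. eventually P (principal {N..}))"
  proof (rule eventually_INF_base)
    fix a b :: "int ^ 'k"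
    have "(\<chi> i. max (a $ i) (b $ i)) \<ge> a" "(\<chi> i. max (a $ i) (b $ i)) \<ge> b"
      by (auto simp: less_eq_vec_def)
    then show "\<exists>x\<in>UNIV. principal {x..} \<le> inf (principal {a..}) (principal {b..})"
      by (metis UNIV_I atLeast_subset_iff inf.bounded_iff inf_principal le_inf_iff principal_le_iff)
  qed simp
  then show ?thesis
    unfolding at_top_def eventually_principal by (simp add: Ball_def)
qed

lemma eventually_ge_at_top_vec: "eventually (\<lambda>n. N \<le> n) (at_top :: (int ^ 'k::finite) filter)"
  by (auto simp: eventually_at_top_vec)

text \<open>This turns a statement about all large levels into the existence of one level.\<close>

lemma at_top_vec_neq_bot: "(at_top :: (int ^ 'k::finite) filter) \<noteq> bot"
  by (simp add: trivial_limit_def eventually_at_top_vec) blast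

section \<open>Unique factorisation in a higher-rank graph\<close>

context is_kgraph
begin

abbreviation "composable \<mu> \<nu> \<equiv> \<mu> \<in> paths \<Lambda> \<and> \<nu> \<in> paths \<Lambda> \<and> src \<Lambda> \<mu> = rng \<Lambda> \<nu>"

text \<open>The degrees of the second factors agree too, because addition of degrees is
  cancellative, so both pairs are the unique factorisation of one path.\<close>

lemma cmp_inject:
  assumes "composable \<mu> \<nu>" "composable \<mu>' \<nu>'" "cmp \<Lambda> \<mu> \<nu> = cmp \<Lambda> \<mu>' \<nu>'" "deg \<Lambda> \<mu> = deg \<Lambda> \<mu>'"
  shows "\<mu> = \<mu>'" "\<nu> = \<nu>'"
proof -
  have d: "deg \<Lambda> \<nu> = deg \<Lambda> \<nu>'"
    using deg_cmp[of \<mu> \<nu>] deg_cmp[of \<mu>' \<nu>'] assms by simp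
  have "\<exists>!(\<alpha>, \<beta>). \<alpha> \<in> paths \<Lambda> \<and> \<beta> \<in> paths \<Lambda> \<and> src \<Lambda> \<alpha> = rng \<Lambda> \<beta> \<and>
          deg \<Lambda> \<alpha> = deg \<Lambda> \<mu> \<and> deg \<Lambda> \<beta> = deg \<Lambda> \<nu> \<and> cmp \<Lambda> \<alpha> \<beta> = cmp \<Lambda> \<mu> \<nu>"
    using assms by (intro factorization cmp_closed deg_cmp) auto
  then obtain p where p: "\<And>x. (case x of (\<alpha>, \<beta>) \<Rightarrow> \<alpha> \<in> paths \<Lambda> \<and> \<beta> \<in> paths \<Lambda> \<and> src \<Lambda> \<alpha> = rng \<Lambda> \<beta> \<and>
          deg \<Lambda> \<alpha> = deg \<Lambda> \<mu> \<and> deg \<Lambda> \<beta> = deg \<Lambda> \<nu> \<and> cmp \<Lambda> \<alpha> \<beta> = cmp \<Lambda> \<mu> \<nu>) \<Longrightarrow> x = p"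
    by (auto elim!: ex1E)
  have "(\<mu>, \<nu>) = p" "(\<mu>', \<nu>') = p"
    by (rule p; use assms d in simp)+
  then show "\<mu> = \<mu>'" "\<nu> = \<nu>'" by auto
qed

lemma cmp_left_cancel:
  assumes "composable \<mu> \<nu>" "composable \<mu> \<nu>'" "cmp \<Lambda> \<mu> \<nu> = cmp \<Lambda> \<mu> \<nu>'"
  shows "\<nu> = \<nu>'"
  using cmp_inject(2)[OF assms] by simp

lemma factor:
  assumes "\<mu> \<in> paths \<Lambda>" "m \<le> deg \<Lambda> \<mu>"
  obtains \<alpha> \<beta> where "composable \<alpha> \<beta>" "deg \<Lambda> \<alpha> = m" "cmp \<Lambda> \<alpha> \<beta> = \<mu>"
proof -
  obtain n where "deg \<Lambda> \<mu> = m + n" using le_imp_add_vec[OF assms(2)] by blast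
  from factorization[OF assms(1) this] show thesis
    by (auto intro: that elim!: ex1E)
qed

text \<open>\<open>\<mu>\<close> is both \<open>r(\<mu>)\<mu>\<close> and
  \<open>\<mu>s(\<mu>)\<close>; in both the first factor has degree 0, so unique factorisation
  identifies \<open>\<mu>\<close> with its range.\<close>

lemma deg_0_vert:
  assumes "\<mu> \<in> paths \<Lambda>" "deg \<Lambda> \<mu> = 0"
  shows "\<mu> = rng \<Lambda> \<mu>" "src \<Lambda> \<mu> = rng \<Lambda> \<mu>"
proof -
  have "rng \<Lambda> \<mu> \<in> verts \<Lambda>" "src \<Lambda> \<mu> \<in> verts \<Lambda>" using assms rng_closed src_closed by auto
  then have "composable (rng \<Lambda> \<mu>) \<mu>" "composable \<mu> (src \<Lambda> \<mu>)" "deg \<Lambda> (rng \<Lambda> \<mu>) = 0"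
    using assms verts_subset src_vert rng_vert deg_vert by auto
  moreover have "cmp \<Lambda> (rng \<Lambda> \<mu>) \<mu> = cmp \<Lambda> \<mu> (src \<Lambda> \<mu>)" using assms cmp_rng cmp_src by simp
  ultimately show "\<mu> = rng \<Lambda> \<mu>" using cmp_inject(1) assms(2) by metis
  then show "src \<Lambda> \<mu> = rng \<Lambda> \<mu>"
    using \<open>rng \<Lambda> \<mu> \<in> verts \<Lambda>\<close> src_vert by metis
qed

lemma paths_from_0: "v \<in> verts \<Lambda> \<Longrightarrow> paths_from \<Lambda> v 0 = {v}"
  using deg_0_vert verts_subset by (auto simp: paths_from_def rng_vert deg_vert)

end

section \<open>The skew product is again a higher-rank graph\<close>

lemma skew_product_simps [simp]:
  "paths (skew_product \<Lambda>) = paths \<Lambda> \<times> UNIV"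
  "verts (skew_product \<Lambda>) = verts \<Lambda> \<times> UNIV"
  "rng (skew_product \<Lambda>) (\<mu>, n) = (rng \<Lambda> \<mu>, n)"
  "src (skew_product \<Lambda>) (\<mu>, n) = (src \<Lambda> \<mu>, n + vec_int (deg \<Lambda> \<mu>))"
  "cmp (skew_product \<Lambda>) (\<mu>, n) (\<nu>, m) = (cmp \<Lambda> \<mu> \<nu>, n)"
  "deg (skew_product \<Lambda>) (\<mu>, n) = deg \<Lambda> \<mu>"
  by (simp_all add: skew_product_def vec_int_def)

lemma is_kgraph_skew_product:
  fixes \<Lambda> :: "('a, 'k::finite) kgraph"
  assumes "is_kgraph \<Lambda>"
  shows "is_kgraph (skew_product \<Lambda>)"
proof -
  interpret is_kgraph \<Lambda> by fact
  show ?thesis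
  proof
    \<comment> \<open>A vector of integers is determined by its coordinate function, and there are
      countably many of those.\<close>
    have "inj (($) :: int ^ 'k \<Rightarrow> _)" by (simp add: inj_def vec_nth_inject)
    moreover have "countable (UNIV :: ('k \<Rightarrow> int) set)" by simp
    ultimately have "countable (UNIV :: (int ^ 'k) set)"
      by (meson countable_image_inj_on countable_subset subset_UNIV)
    then show "countable (paths (skew_product \<Lambda>))" using countable_paths by simp
  next
    fix \<mu> m n
    assume a: "\<mu> \<in> paths (skew_product \<Lambda>)" "deg (skew_product \<Lambda>) \<mu> = m + n"
    obtain \<mu>' k where [simp]: "\<mu> = (\<mu>', k)" by fastforce
    have \<mu>': "\<mu>' \<in> paths \<Lambda>" "deg \<Lambda> \<mu>' = m + n" using a by auto
    have "m \<le> deg \<Lambda> \<mu>'" using \<mu>' by (simp add: less_eq_vec_def)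
    then obtain \<alpha> \<beta> where ab: "composable \<alpha> \<beta>" "deg \<Lambda> \<alpha> = m" "cmp \<Lambda> \<alpha> \<beta> = \<mu>'"
      using factor[OF \<mu>'(1)] by metis
    then have "deg \<Lambda> \<beta> = n" using \<mu>' deg_cmp[of \<alpha> \<beta>] by auto
    show "\<exists>!(\<nu>, \<rho>). \<nu> \<in> paths (skew_product \<Lambda>) \<and> \<rho> \<in> paths (skew_product \<Lambda>) \<and>
        src (skew_product \<Lambda>) \<nu> = rng (skew_product \<Lambda>) \<rho> \<and> deg (skew_product \<Lambda>) \<nu> = m \<and>
        deg (skew_product \<Lambda>) \<rho> = n \<and> cmp (skew_product \<Lambda>) \<nu> \<rho> = \<mu>"
    \<comment> \<open>The first factor inherits the level of the whole path and composability
      dictates that of the second, so uniqueness reduces to uniqueness in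
      \<open>\<Lambda>\<close>.\<close>
    proof (rule ex1I[of _ "((\<alpha>, k), (\<beta>, k + vec_int m))"])
      fix x
      assume a: "case x of (\<nu>, \<rho>) \<Rightarrow> \<nu> \<in> paths (skew_product \<Lambda>) \<and> \<rho> \<in> paths (skew_product \<Lambda>) \<and>
        src (skew_product \<Lambda>) \<nu> = rng (skew_product \<Lambda>) \<rho> \<and> deg (skew_product \<Lambda>) \<nu> = m \<and>
        deg (skew_product \<Lambda>) \<rho> = n \<and> cmp (skew_product \<Lambda>) \<nu> \<rho> = \<mu>"
      obtain \<nu> i \<rho> j where x: "x = ((\<nu>, i), (\<rho>, j))" by (metis surj_pair)
      have b: "composable \<nu> \<rho>" "cmp \<Lambda> \<nu> \<rho> = cmp \<Lambda> \<alpha> \<beta>" "deg \<Lambda> \<nu> = deg \<Lambda> \<alpha>"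
        using a ab unfolding x by auto
      show "x = ((\<alpha>, k), (\<beta>, k + vec_int m))"
        using cmp_inject[OF b(1) ab(1) b(2,3)] a unfolding x by auto
    qed (use ab \<open>deg \<Lambda> \<beta> = n\<close> in auto)
  next
    fix \<mu> \<nu> \<rho>
    assume "\<mu> \<in> paths (skew_product \<Lambda>)" "\<nu> \<in> paths (skew_product \<Lambda>)" "\<rho> \<in> paths (skew_product \<Lambda>)"
      "src (skew_product \<Lambda>) \<mu> = rng (skew_product \<Lambda>) \<nu>"
      "src (skew_product \<Lambda>) \<nu> = rng (skew_product \<Lambda>) \<rho>"
    then show "cmp (skew_product \<Lambda>) (cmp (skew_product \<Lambda>) \<mu> \<nu>) \<rho> =
        cmp (skew_product \<Lambda>) \<mu> (cmp (skew_product \<Lambda>) \<nu> \<rho>)"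
      by (cases \<mu>; cases \<nu>; cases \<rho>) (auto intro: cmp_assoc)
  qed (use verts_subset in \<open>auto simp: rng_closed src_closed rng_vert src_vert cmp_closed rng_cmp
        src_cmp cmp_rng cmp_src deg_vert deg_cmp vec_int_add add.assoc\<close>)
qed

lemma paths_from_skew_product:
  "paths_from (skew_product \<Lambda>) (v, n) d = (\<lambda>\<mu>. (\<mu>, n)) ` paths_from \<Lambda> v d"
  by (auto simp: paths_from_def)

lemma row_finite_skew_product: "row_finite \<Lambda> \<Longrightarrow> row_finite (skew_product \<Lambda>)"
  by (auto simp: row_finite_def paths_from_skew_product)

text \<open>The skew product enters the main argument only through a level on vertices that a path
  raises by its degree; abstracting this avoids carrying pairs through every calculation.\<close>

locale level_kgraph = is_kgraph \<Gamma> for \<Gamma> :: "('a, 'k::finite) kgraph" +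
  fixes level :: "'a \<Rightarrow> int ^ 'k"
  assumes row_finite: "row_finite \<Gamma>"
    and level_src: "\<mu> \<in> paths \<Gamma> \<Longrightarrow> level (src \<Gamma> \<mu>) = level (rng \<Gamma> \<mu>) + vec_int (deg \<Gamma> \<mu>)"
begin

text \<open>The paths that end at level \<open>n\<close> index the rows and columns of the matrix units of level \<open>n\<close>.\<close>

definition paths_to :: "int ^ 'k \<Rightarrow> 'a set" where
  "paths_to n = {\<mu> \<in> paths \<Gamma>. level (src \<Gamma> \<mu>) = n}"

lemma finite_paths_from: "v \<in> verts \<Gamma> \<Longrightarrow> finite (paths_from \<Gamma> v n)"
  using row_finite by (simp add: row_finite_def)

text \<open>Fixing the range and the level of the source fixes the degree, so row finiteness and
  (KP4), which concern one degree at a time, can be applied to a whole level.\<close>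

lemma paths_to_from:
  "{\<mu> \<in> paths_to n. rng \<Gamma> \<mu> = v} =
    (if level v \<le> n then paths_from \<Gamma> v (vec_nat (n - level v)) else {})"
  by (auto simp: paths_to_def paths_from_def level_src vec_nat_vec_int vec_int_nonneg vec_int_nat)

lemma finite_paths_to_from: "v \<in> verts \<Gamma> \<Longrightarrow> finite {\<mu> \<in> paths_to n. rng \<Gamma> \<mu> = v}"
  by (simp add: paths_to_from finite_paths_from)

end

lemma level_kgraph_skew_product:
  "is_kgraph \<Lambda> \<Longrightarrow> row_finite \<Lambda> \<Longrightarrow> level_kgraph (skew_product \<Lambda>) snd"
  by (auto simp: level_kgraph_def level_kgraph_axioms_def is_kgraph_skew_product row_finite_skew_product)

section \<open>Congruence modulo the Kumjian--Pask relations\<close>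

lemma sum_single_keys: "(\<Sum>w \<in> Poly_Mapping.keys p. Poly_Mapping.single w (Poly_Mapping.lookup p w)) = p"
proof (rule poly_mapping_eqI)
  fix k
  have "Poly_Mapping.lookup (\<Sum>w \<in> Poly_Mapping.keys p. Poly_Mapping.single w (Poly_Mapping.lookup p w)) k =
      (\<Sum>w \<in> Poly_Mapping.keys p. if w = k then Poly_Mapping.lookup p w else 0)"
    by (simp only: lookup_sum lookup_single when_def)
  also have "\<dots> = Poly_Mapping.lookup p k"
    by (subst sum.delta) (auto simp only: finite_keys not_in_keys_iff_lookup_eq_zero split: if_split)
  finally show "Poly_Mapping.lookup (\<Sum>w \<in> Poly_Mapping.keys p.
      Poly_Mapping.single w (Poly_Mapping.lookup p w)) k = Poly_Mapping.lookup p k" .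
qed

lemma plus_Word: "Word u + Word w = Word (u @ w)"
  by (simp add: plus_word_def)

lemma letters_plus [simp]: "letters (u + w) = letters u @ letters w"
  by (simp add: plus_word_def)

lemma letters_zero [simp]: "letters 0 = []"
  by (simp add: zero_word_def)

lemma word_eq_0_iff: "w = 0 \<longleftrightarrow> letters w = []"
  by (cases w) (simp add: zero_word_def)

definition poly_over :: "'g set \<Rightarrow> ('g word \<Rightarrow>\<^sub>0 'f::field) set" where
  "poly_over X = {p. \<forall>w \<in> Poly_Mapping.keys p. set (letters w) \<subseteq> X}"

definition poly_over_nonconst :: "'g set \<Rightarrow> ('g word \<Rightarrow>\<^sub>0 'f::field) set" where
  "poly_over_nonconst X = {p \<in> poly_over X. Poly_Mapping.lookup p 0 = 0}"

lemma poly_over_0 [simp]: "0 \<in> poly_over X" by (simp add: poly_over_def)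
lemma poly_over_1 [simp]: "1 \<in> poly_over X" by (simp add: poly_over_def)

lemma poly_over_single: "set (letters w) \<subseteq> X \<Longrightarrow> Poly_Mapping.single w c \<in> poly_over X"
  by (simp add: poly_over_def)

lemma poly_over_add: "p \<in> poly_over X \<Longrightarrow> q \<in> poly_over X \<Longrightarrow> p + q \<in> poly_over X"
  using keys_add[of p q] by (auto simp: poly_over_def)

lemma poly_over_uminus: "p \<in> poly_over X \<Longrightarrow> - p \<in> poly_over X"
  by (auto simp: poly_over_def in_keys_iff)

lemma poly_over_diff: "p \<in> poly_over X \<Longrightarrow> q \<in> poly_over X \<Longrightarrow> p - q \<in> poly_over X"
  using poly_over_add[of p X "- q"] poly_over_uminus[of q X] by simp

lemma poly_over_mult: "p \<in> poly_over X \<Longrightarrow> q \<in> poly_over X \<Longrightarrow> p * q \<in> poly_over X"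
  using keys_mult[of p q] by (force simp: poly_over_def)

lemma poly_over_sum: "(\<And>i. i \<in> S \<Longrightarrow> f i \<in> poly_over X) \<Longrightarrow> sum f S \<in> poly_over X"
  by (induction S rule: infinite_finite_induct) (auto intro: poly_over_add)

text \<open>A concatenation of words is empty only if both words are, so a constant term of the
  product needs one in each factor.\<close>

lemma lookup_mult_0:
  fixes p q :: "'g word \<Rightarrow>\<^sub>0 'f::field"
  assumes "Poly_Mapping.lookup p 0 = 0"
  shows "Poly_Mapping.lookup (p * q) 0 = 0"
proof (rule ccontr)
  assume "Poly_Mapping.lookup (p * q) 0 \<noteq> 0"
  then obtain a b where "a \<in> Poly_Mapping.keys p" "0 = a + b"
    using keys_mult[of p q] unfolding lookup_not_eq_zero_eq_in_keys by blast
  moreover from this have "a = 0"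
    by (metis append_is_Nil_conv letters_plus letters_zero word_eq_0_iff)
  ultimately show False using assms by (simp add: in_keys_iff)
qed

lemma poly_over_nonconstD: "p \<in> poly_over_nonconst X \<Longrightarrow> p \<in> poly_over X"
  by (simp add: poly_over_nonconst_def)

lemma nonconst_0 [simp]: "0 \<in> poly_over_nonconst X"
  by (simp add: poly_over_nonconst_def)

lemma nonconst_single:
  "set (letters w) \<subseteq> X \<Longrightarrow> letters w \<noteq> [] \<Longrightarrow> Poly_Mapping.single w c \<in> poly_over_nonconst X"
  by (auto simp: poly_over_nonconst_def poly_over_single lookup_single when_def)

lemma nonconst_add:
  "p \<in> poly_over_nonconst X \<Longrightarrow> q \<in> poly_over_nonconst X \<Longrightarrow> p + q \<in> poly_over_nonconst X"
  by (simp add: poly_over_nonconst_def poly_over_add lookup_add)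

lemma nonconst_mult:
  "p \<in> poly_over_nonconst X \<Longrightarrow> q \<in> poly_over X \<Longrightarrow> p * q \<in> poly_over_nonconst X"
  by (simp add: poly_over_nonconst_def poly_over_mult lookup_mult_0)

lemma nonconst_sum:
  "(\<And>i. i \<in> S \<Longrightarrow> f i \<in> poly_over_nonconst X) \<Longrightarrow> sum f S \<in> poly_over_nonconst X"
  by (induction S rule: infinite_finite_induct) (auto intro: nonconst_add)

lemma free_algebra_simps [simp]:
  "carrier (free_algebra X) = poly_over X"
  "p \<otimes>\<^bsub>free_algebra X\<^esub> q = p * q"
  "p \<oplus>\<^bsub>free_algebra X\<^esub> q = p + q"
  "\<one>\<^bsub>free_algebra X\<^esub> = 1"
  "\<zero>\<^bsub>free_algebra X\<^esub> = 0"
  by (simp_all add: free_algebra_def poly_over_def)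

lemma ring_free_algebra: "ring (free_algebra X)"
proof (rule ringI)
  show "abelian_group (free_algebra X)"
    by (rule abelian_groupI)
      (auto simp: poly_over_add add_ac intro!: bexI[of _ "- x" for x] poly_over_uminus)
  show "monoid (free_algebra X)"
    by unfold_locales (auto simp: poly_over_mult mult.assoc)
qed (auto simp: algebra_simps)

lemma minus_free_algebra:
  assumes "p \<in> poly_over X" "q \<in> poly_over X"
  shows "p \<ominus>\<^bsub>free_algebra X\<^esub> q = p - q"
proof -
  interpret ring "free_algebra X" by (rule ring_free_algebra)
  have "\<ominus>\<^bsub>free_algebra X\<^esub> q = - q"
    using assms by (intro minus_equality) (auto intro: poly_over_uminus)
  then show ?thesis by (simp add: a_minus_def)
qed

section \<open>The ideal of relations and its congruence\<close>

definition kp_gens :: "('a, 'k::finite) kgraph \<Rightarrow> 'a kp_gen set" where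
  "kp_gens \<Lambda> = Path ` paths \<Lambda> \<union> Ghost ` paths \<Lambda>"

abbreviation "kp_polys \<Lambda> \<equiv> poly_over (kp_gens \<Lambda>)"
abbreviation "kp_polys_nonconst \<Lambda> \<equiv> poly_over_nonconst (kp_gens \<Lambda>)"

lemma kp_free_eq: "kp_free \<Lambda> = free_algebra (kp_gens \<Lambda>)"
  by (simp add: kp_free_def kp_gens_def)

lemma kp_gens_iff [simp]:
  "Path \<mu> \<in> kp_gens \<Lambda> \<longleftrightarrow> \<mu> \<in> paths \<Lambda>" "Ghost \<mu> \<in> kp_gens \<Lambda> \<longleftrightarrow> \<mu> \<in> paths \<Lambda>"
  by (auto simp: kp_gens_def)

text \<open>Membership of both sides is part of the relation, so that closure conditions need not be
  carried through chains of congruences.\<close>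

definition kp_cong :: "('a, 'k::finite) kgraph \<Rightarrow> ('a kp_gen word \<Rightarrow>\<^sub>0 'f::field) \<Rightarrow>
    ('a kp_gen word \<Rightarrow>\<^sub>0 'f) \<Rightarrow> bool" where
  "kp_cong \<Lambda> p q \<longleftrightarrow> p \<in> kp_polys \<Lambda> \<and> q \<in> kp_polys \<Lambda> \<and> p - q \<in> kp_ideal \<Lambda>"

definition kp_relators :: "('a, 'k::finite) kgraph \<Rightarrow> ('a kp_gen word \<Rightarrow>\<^sub>0 'f::field) set" where
  "kp_relators \<Lambda> = kp1_relators \<Lambda> \<union> kp2_relators \<Lambda> \<union> kp3_relators \<Lambda> \<union> kp4_relators \<Lambda>"

context is_kgraph
begin

lemma vert_path: "v \<in> verts \<Lambda> \<Longrightarrow> v \<in> paths \<Lambda>"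
  using verts_subset by auto

lemma src_path: "\<mu> \<in> paths \<Lambda> \<Longrightarrow> src \<Lambda> \<mu> \<in> paths \<Lambda>"
  and rng_path: "\<mu> \<in> paths \<Lambda> \<Longrightarrow> rng \<Lambda> \<mu> \<in> paths \<Lambda>"
  using verts_subset src_closed rng_closed by auto

lemma kp_relators_subset: "kp_relators \<Lambda> \<subseteq> kp_polys \<Lambda>"
proof -
  have path: "path \<mu> \<in> kp_polys \<Lambda>" and ghost: "ghost \<mu> \<in> kp_polys \<Lambda>" if "\<mu> \<in> paths \<Lambda>" for \<mu>
    using that by (auto intro: poly_over_single)
  have if0: "(if P then path \<mu> else 0) \<in> kp_polys \<Lambda>" if "\<mu> \<in> paths \<Lambda>" for \<mu> P
    using path[OF that] by (cases P) auto
  note rules = poly_over_diff poly_over_mult path ghost if0 poly_over_sum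
  have "kp1_relators \<Lambda> \<subseteq> kp_polys \<Lambda>"
    unfolding kp1_relators_def by (safe; intro rules vert_path)
  moreover have "kp2_relators \<Lambda> \<subseteq> kp_polys \<Lambda>"
    unfolding kp2_relators_def by (safe; intro rules cmp_closed src_path rng_path; simp)
  moreover have "kp3_relators \<Lambda> \<subseteq> kp_polys \<Lambda>"
    unfolding kp3_relators_def by (safe; intro rules src_path)
  moreover have "kp4_relators \<Lambda> \<subseteq> kp_polys \<Lambda>"
    unfolding kp4_relators_def by (safe; intro rules; simp add: paths_from_def vert_path)
  ultimately show ?thesis by (simp add: kp_relators_def)
qed

lemma ideal_kp_ideal: "ideal (kp_ideal \<Lambda>) (kp_free \<Lambda>)"
  unfolding kp_ideal_def
  using ring.genideal_ideal[OF ring_free_algebra, of "kp_relators \<Lambda>" "kp_gens \<Lambda>"] kp_relators_subset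
  by (simp only: kp_free_eq kp_relators_def free_algebra_simps)

lemma relator_in_kp_ideal: "p \<in> kp_relators \<Lambda> \<Longrightarrow> p \<in> kp_ideal \<Lambda>"
  using kp_relators_subset ring.genideal_self[OF ring_free_algebra, of "kp_relators \<Lambda>" "kp_gens \<Lambda>"]
  unfolding kp_ideal_def kp_free_eq kp_relators_def[symmetric] free_algebra_simps by blast

lemma kp_class_eq_iff:
  assumes "p \<in> kp_polys \<Lambda>" "q \<in> kp_polys \<Lambda>"
  shows "kp_class \<Lambda> p = kp_class \<Lambda> q \<longleftrightarrow> kp_cong \<Lambda> p q"
  using ring.quotient_eq_iff_same_a_r_cos[OF ring_free_algebra ideal_kp_ideal[unfolded kp_free_eq], of p q]
    assms minus_free_algebra[OF assms]
  by (simp add: kp_class_def kp_cong_def kp_free_eq)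

lemma kp_class_add:
  "p \<in> kp_polys \<Lambda> \<Longrightarrow> q \<in> kp_polys \<Lambda> \<Longrightarrow>
    kp_class \<Lambda> p <+>\<^bsub>kp_free \<Lambda>\<^esub> kp_class \<Lambda> q = kp_class \<Lambda> (p + q)"
  using ideal.a_rcos_sum[OF ideal_kp_ideal, of p q] by (simp add: kp_class_def kp_free_eq)

lemma kp_class_mult:
  "p \<in> kp_polys \<Lambda> \<Longrightarrow> q \<in> kp_polys \<Lambda> \<Longrightarrow>
    rcoset_mult (kp_free \<Lambda>) (kp_ideal \<Lambda>) (kp_class \<Lambda> p) (kp_class \<Lambda> q) = kp_class \<Lambda> (p * q)"
  using ideal.rcoset_mult_add[OF ideal_kp_ideal, of p q] by (simp add: kp_class_def kp_free_eq)

lemma kp_ideal_zero: "0 \<in> kp_ideal \<Lambda>"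
  using additive_subgroup.zero_closed[OF ideal.axioms(1)[OF ideal_kp_ideal]] by (simp add: kp_free_eq)

lemma kp_ideal_add: "p \<in> kp_ideal \<Lambda> \<Longrightarrow> q \<in> kp_ideal \<Lambda> \<Longrightarrow> p + q \<in> kp_ideal \<Lambda>"
  using additive_subgroup.a_closed[OF ideal.axioms(1)[OF ideal_kp_ideal]] by (simp add: kp_free_eq)

lemma kp_ideal_mult_left: "p \<in> kp_polys \<Lambda> \<Longrightarrow> q \<in> kp_ideal \<Lambda> \<Longrightarrow> p * q \<in> kp_ideal \<Lambda>"
  using ideal.I_l_closed[OF ideal_kp_ideal] by (simp add: kp_free_eq)

lemma kp_ideal_mult_right: "p \<in> kp_polys \<Lambda> \<Longrightarrow> q \<in> kp_ideal \<Lambda> \<Longrightarrow> q * p \<in> kp_ideal \<Lambda>"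
  using ideal.I_r_closed[OF ideal_kp_ideal] by (simp add: kp_free_eq)

lemma kp_cong_refl: "p \<in> kp_polys \<Lambda> \<Longrightarrow> kp_cong \<Lambda> p p"
  by (simp add: kp_cong_def kp_ideal_zero)

lemma kp_cong_sym: "kp_cong \<Lambda> p q \<Longrightarrow> kp_cong \<Lambda> q p"
  using kp_class_eq_iff[of p q] kp_class_eq_iff[of q p] by (auto simp: kp_cong_def)

lemma kp_cong_trans [trans]: "kp_cong \<Lambda> p q \<Longrightarrow> kp_cong \<Lambda> q r \<Longrightarrow> kp_cong \<Lambda> p r"
  using kp_class_eq_iff[of p q] kp_class_eq_iff[of q r] kp_class_eq_iff[of p r]
  by (auto simp: kp_cong_def)

lemma kp_cong_add: "kp_cong \<Lambda> p p' \<Longrightarrow> kp_cong \<Lambda> q q' \<Longrightarrow> kp_cong \<Lambda> (p + q) (p' + q')"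
  using kp_ideal_add[of "p - p'" "q - q'"] by (simp add: kp_cong_def poly_over_add add_diff_add)

lemma kp_cong_mult:
  assumes "kp_cong \<Lambda> p p'" "kp_cong \<Lambda> q q'"
  shows "kp_cong \<Lambda> (p * q) (p' * q')"
proof -
  have "p * (q - q') + (p - p') * q' \<in> kp_ideal \<Lambda>"
    using assms by (auto simp: kp_cong_def intro: kp_ideal_add kp_ideal_mult_left kp_ideal_mult_right)
  moreover have "p * (q - q') + (p - p') * q' = p * q - p' * q'"
    by (simp add: algebra_simps)
  ultimately show ?thesis using assms by (simp add: kp_cong_def poly_over_mult)
qed

lemma kp_cong_sum:
  "(\<And>i. i \<in> S \<Longrightarrow> kp_cong \<Lambda> (f i) (g i)) \<Longrightarrow> kp_cong \<Lambda> (sum f S) (sum g S)"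
  by (induction S rule: infinite_finite_induct) (auto intro: kp_cong_add kp_cong_refl)

lemma kp_cong_relator:
  "p - q \<in> kp_relators \<Lambda> \<Longrightarrow> p \<in> kp_polys \<Lambda> \<Longrightarrow> q \<in> kp_polys \<Lambda> \<Longrightarrow> kp_cong \<Lambda> p q"
  by (simp add: kp_cong_def relator_in_kp_ideal)

lemma kp_cong_path_src: "\<mu> \<in> paths \<Lambda> \<Longrightarrow> kp_cong \<Lambda> (path \<mu> * path (src \<Lambda> \<mu>)) (path \<mu>)"
  by (rule kp_cong_relator, unfold kp_relators_def kp2_relators_def, blast)
    (auto intro!: poly_over_mult poly_over_single src_path)

lemma kp_cong_path_rng: "\<mu> \<in> paths \<Lambda> \<Longrightarrow> kp_cong \<Lambda> (path (rng \<Lambda> \<mu>) * path \<mu>) (path \<mu>)"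
  by (rule kp_cong_relator, unfold kp_relators_def kp2_relators_def, blast)
    (auto intro!: poly_over_mult poly_over_single rng_path)

lemma kp_cong_ghost_src: "\<mu> \<in> paths \<Lambda> \<Longrightarrow> kp_cong \<Lambda> (path (src \<Lambda> \<mu>) * ghost \<mu>) (ghost \<mu>)"
  by (rule kp_cong_relator, unfold kp_relators_def kp2_relators_def, blast)
    (auto intro!: poly_over_mult poly_over_single src_path)

lemma kp_cong_ghost_rng: "\<mu> \<in> paths \<Lambda> \<Longrightarrow> kp_cong \<Lambda> (ghost \<mu> * path (rng \<Lambda> \<mu>)) (ghost \<mu>)"
  by (rule kp_cong_relator, unfold kp_relators_def kp2_relators_def, blast)
    (auto intro!: poly_over_mult poly_over_single rng_path)

lemma kp_cong_path_cmp:
  assumes "composable \<mu> \<nu>"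
  shows "kp_cong \<Lambda> (path \<mu> * path \<nu>) (path (cmp \<Lambda> \<mu> \<nu>))"
proof -
  have "\<mu> \<in> paths \<Lambda>" "\<nu> \<in> paths \<Lambda>" "rng \<Lambda> \<nu> = src \<Lambda> \<mu>" using assms by auto
  then have "path \<mu> * path \<nu> - path (cmp \<Lambda> \<mu> \<nu>) \<in> kp_relators \<Lambda>"
    unfolding kp_relators_def kp2_relators_def by blast
  then show ?thesis using assms
    by (intro kp_cong_relator poly_over_mult poly_over_single) (auto intro: cmp_closed)
qed

lemma kp_cong_ghost_cmp:
  assumes "composable \<mu> \<nu>"
  shows "kp_cong \<Lambda> (ghost \<nu> * ghost \<mu>) (ghost (cmp \<Lambda> \<mu> \<nu>))"
proof -
  have "\<mu> \<in> paths \<Lambda>" "\<nu> \<in> paths \<Lambda>" "rng \<Lambda> \<nu> = src \<Lambda> \<mu>" using assms by auto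
  then have "ghost \<nu> * ghost \<mu> - ghost (cmp \<Lambda> \<mu> \<nu>) \<in> kp_relators \<Lambda>"
    unfolding kp_relators_def kp2_relators_def by blast
  then show ?thesis using assms
    by (intro kp_cong_relator poly_over_mult poly_over_single) (auto intro: cmp_closed)
qed

lemma kp_cong_verts:
  "v \<in> verts \<Lambda> \<Longrightarrow> w \<in> verts \<Lambda> \<Longrightarrow> kp_cong \<Lambda> (path v * path w) (if v = w then path v else 0)"
  by (rule kp_cong_relator, unfold kp_relators_def kp1_relators_def, blast)
    (auto intro!: poly_over_mult poly_over_single vert_path)

lemma kp_cong_vert_ghost: "v \<in> verts \<Lambda> \<Longrightarrow> kp_cong \<Lambda> (path v) (ghost v)"
  by (rule kp_cong_relator, unfold kp_relators_def kp1_relators_def, blast)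
    (auto intro!: poly_over_mult poly_over_single vert_path)

lemma kp_cong_ghost_path_same_deg:
  "\<mu> \<in> paths \<Lambda> \<Longrightarrow> \<nu> \<in> paths \<Lambda> \<Longrightarrow> deg \<Lambda> \<mu> = deg \<Lambda> \<nu> \<Longrightarrow>
    kp_cong \<Lambda> (ghost \<mu> * path \<nu>) (if \<mu> = \<nu> then path (src \<Lambda> \<mu>) else 0)"
  by (rule kp_cong_relator, unfold kp_relators_def kp3_relators_def, blast)
    (auto intro!: poly_over_mult poly_over_single src_path)

text \<open>(KP4) is imposed only in nonzero degree. In degree 0 the sum is \<open>v v*\<close>, and
  (KP1) gives \<open>v = v v = v v*\<close>.\<close>

lemma kp_cong_ck:
  assumes "v \<in> verts \<Lambda>"
  shows "kp_cong \<Lambda> (path v) (\<Sum>\<mu> \<in> paths_from \<Lambda> v n. path \<mu> * ghost \<mu>)"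
proof (cases "n = 0")
  case True
  have "kp_cong \<Lambda> (path v * path v) (path v * ghost v)"
    using assms by (intro kp_cong_mult kp_cong_vert_ghost kp_cong_refl poly_over_single) (auto simp: vert_path)
  moreover have "kp_cong \<Lambda> (path v * path v) (path v)"
    using kp_cong_verts[OF assms assms] by simp
  ultimately show ?thesis
    using assms True by (auto simp: paths_from_0 intro: kp_cong_trans[OF kp_cong_sym])
next
  case False
  then have "path v - (\<Sum>\<mu> \<in> paths_from \<Lambda> v n. path \<mu> * ghost \<mu>) \<in> kp_relators \<Lambda>"
    unfolding kp_relators_def kp4_relators_def using assms by blast
  then show ?thesis using assms
    by (intro kp_cong_relator poly_over_mult poly_over_single poly_over_sum)
      (auto simp: paths_from_def vert_path)
qed

end

section \<open>The action on paths\<close>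

context is_kgraph
begin

text \<open>\<open>None\<close> stands for the zero vector. What remains after deleting a prefix is
  unambiguous because paths cancel on the left.\<close>

primrec act_gen :: "'a kp_gen \<Rightarrow> 'a \<Rightarrow> 'a option" where
  "act_gen (Path \<mu>) \<beta> = (if composable \<mu> \<beta> then Some (cmp \<Lambda> \<mu> \<beta>) else None)"
| "act_gen (Ghost \<mu>) \<alpha> = (if \<exists>\<beta>. composable \<mu> \<beta> \<and> cmp \<Lambda> \<mu> \<beta> = \<alpha>
      then Some (THE \<beta>. composable \<mu> \<beta> \<and> cmp \<Lambda> \<mu> \<beta> = \<alpha>) else None)"

text \<open>The last letter acts first, so that concatenating words composes operators in the order
  of a product.\<close>

primrec act_list :: "'a kp_gen list \<Rightarrow> 'a \<Rightarrow> 'a option" where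
  "act_list [] \<beta> = Some \<beta>"
| "act_list (g # gs) \<beta> = Option.bind (act_list gs \<beta>) (act_gen g)"

abbreviation act :: "'a kp_gen word \<Rightarrow> 'a \<Rightarrow> 'a option" where
  "act w \<equiv> act_list (letters w)"

lemma act_gen_Path_iff: "act_gen (Path \<mu>) \<beta> = Some \<alpha> \<longleftrightarrow> composable \<mu> \<beta> \<and> cmp \<Lambda> \<mu> \<beta> = \<alpha>"
  by auto

text \<open>As relations on paths, a ghost is the converse of the path: the condition is that of
  \<open>act_gen_Path_iff\<close>, with argument and value exchanged.\<close>

lemma act_gen_Ghost_iff: "act_gen (Ghost \<mu>) \<alpha> = Some \<beta> \<longleftrightarrow> composable \<mu> \<beta> \<and> cmp \<Lambda> \<mu> \<beta> = \<alpha>"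
proof -
  have "(THE \<gamma>. composable \<mu> \<gamma> \<and> cmp \<Lambda> \<mu> \<gamma> = \<alpha>) = \<beta>" if "composable \<mu> \<beta>" "cmp \<Lambda> \<mu> \<beta> = \<alpha>" for \<beta>
    using that cmp_left_cancel by (intro the_equality) blast+
  then show ?thesis by (auto intro: cmp_left_cancel)
qed

declare act_gen.simps [simp del]

lemmas act_gen_iff = act_gen_Path_iff act_gen_Ghost_iff

lemma act_list_append: "act_list (u @ w) \<beta> = Option.bind (act_list w \<beta>) (act_list u)"
  by (induction u) (auto simp: Option.bind_assoc split: bind_splits)

lemma option_eqI: "(\<And>x. a = Some x \<longleftrightarrow> b = Some x) \<Longrightarrow> a = b"
  by (metis not_None_eq)

text \<open>The equivalence serves both product relations in (KP2): read from \<open>\<beta>\<close>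
  to \<open>\<alpha>\<close> it concerns paths, read backwards it concerns ghosts.\<close>

lemma composable_cmp_iff:
  assumes "composable \<mu> \<nu>"
  shows "composable \<nu> \<beta> \<and> composable \<mu> (cmp \<Lambda> \<nu> \<beta>) \<and> cmp \<Lambda> \<mu> (cmp \<Lambda> \<nu> \<beta>) = \<alpha> \<longleftrightarrow>
    composable (cmp \<Lambda> \<mu> \<nu>) \<beta> \<and> cmp \<Lambda> (cmp \<Lambda> \<mu> \<nu>) \<beta> = \<alpha>"
proof (cases "composable \<nu> \<beta>")
  case True
  then show ?thesis
    using assms cmp_assoc[of \<mu> \<nu> \<beta>] rng_cmp[of \<nu> \<beta>] src_cmp[of \<mu> \<nu>] cmp_closed[of \<mu> \<nu>] cmp_closed[of \<nu> \<beta>]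
    by simp
next
  case False
  then show ?thesis using assms src_cmp[of \<mu> \<nu>] by auto
qed

lemma act_list_Path_Path:
  assumes "composable \<mu> \<nu>"
  shows "act_list [Path \<mu>, Path \<nu>] \<beta> = act_list [Path (cmp \<Lambda> \<mu> \<nu>)] \<beta>"
proof (rule option_eqI)
  fix \<alpha>
  have "act_list [Path \<mu>, Path \<nu>] \<beta> = Some \<alpha> \<longleftrightarrow>
      composable \<nu> \<beta> \<and> composable \<mu> (cmp \<Lambda> \<nu> \<beta>) \<and> cmp \<Lambda> \<mu> (cmp \<Lambda> \<nu> \<beta>) = \<alpha>"
    by (auto simp: bind_eq_Some_conv act_gen_iff)
  then show "act_list [Path \<mu>, Path \<nu>] \<beta> = Some \<alpha> \<longleftrightarrow> act_list [Path (cmp \<Lambda> \<mu> \<nu>)] \<beta> = Some \<alpha>"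
    using composable_cmp_iff[OF assms] by (simp add: act_gen_iff)
qed

lemma act_list_Ghost_Ghost:
  assumes "composable \<mu> \<nu>"
  shows "act_list [Ghost \<nu>, Ghost \<mu>] \<alpha> = act_list [Ghost (cmp \<Lambda> \<mu> \<nu>)] \<alpha>"
proof (rule option_eqI)
  fix \<beta>
  have "act_list [Ghost \<nu>, Ghost \<mu>] \<alpha> = Some \<beta> \<longleftrightarrow>
      composable \<nu> \<beta> \<and> composable \<mu> (cmp \<Lambda> \<nu> \<beta>) \<and> cmp \<Lambda> \<mu> (cmp \<Lambda> \<nu> \<beta>) = \<alpha>"
    by (auto simp: bind_eq_Some_conv act_gen_iff)
  then show "act_list [Ghost \<nu>, Ghost \<mu>] \<alpha> = Some \<beta> \<longleftrightarrow> act_list [Ghost (cmp \<Lambda> \<mu> \<nu>)] \<alpha> = Some \<beta>"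
    using composable_cmp_iff[OF assms] by (simp add: act_gen_iff)
qed

lemma act_gen_vert: "v \<in> verts \<Lambda> \<Longrightarrow>
    act_gen (Path v) \<beta> = (if \<beta> \<in> paths \<Lambda> \<and> rng \<Lambda> \<beta> = v then Some \<beta> else None)"
  by (rule option_eqI) (auto simp: act_gen_iff vert_path src_vert cmp_rng)

lemma act_gen_vert_ghost:
  assumes "v \<in> verts \<Lambda>"
  shows "act_gen (Ghost v) = act_gen (Path v)"
proof (intro ext option_eqI)
  fix \<alpha> \<beta>
  have "cmp \<Lambda> v \<gamma> = \<gamma>" if "composable v \<gamma>" for \<gamma>
    using that assms cmp_rng[of \<gamma>] src_vert by simp
  then show "act_gen (Ghost v) \<alpha> = Some \<beta> \<longleftrightarrow> act_gen (Path v) \<alpha> = Some \<beta>"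
    by (auto simp: act_gen_iff)
qed

text \<open>A value \<open>\<alpha>\<close> means \<open>\<mu>\<alpha> = \<nu>\<beta>\<close>; as
  the first factors have equal degree, unique factorisation forces \<open>\<mu> = \<nu>\<close> and
  \<open>\<alpha> = \<beta>\<close>.\<close>

lemma act_list_Ghost_Path:
  assumes "\<mu> \<in> paths \<Lambda>" "\<nu> \<in> paths \<Lambda>" "deg \<Lambda> \<mu> = deg \<Lambda> \<nu>"
  shows "act_list [Ghost \<mu>, Path \<nu>] \<beta> = (if \<mu> = \<nu> then act_list [Path (src \<Lambda> \<mu>)] \<beta> else None)"
proof (rule option_eqI)
  fix \<alpha>
  have 1: "act_list [Path (src \<Lambda> \<mu>)] \<beta> = Some \<alpha> \<longleftrightarrow> composable \<mu> \<beta> \<and> \<alpha> = \<beta>"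
    using assms src_closed[OF assms(1)] by (auto simp: act_gen_vert)
  have 2: "act_list [Ghost \<mu>, Path \<nu>] \<beta> = Some \<alpha> \<longleftrightarrow>
      composable \<nu> \<beta> \<and> composable \<mu> \<alpha> \<and> cmp \<Lambda> \<mu> \<alpha> = cmp \<Lambda> \<nu> \<beta>"
    by (auto simp: bind_eq_Some_conv act_gen_iff)
  show "act_list [Ghost \<mu>, Path \<nu>] \<beta> = Some \<alpha> \<longleftrightarrow>
      (if \<mu> = \<nu> then act_list [Path (src \<Lambda> \<mu>)] \<beta> else None) = Some \<alpha>"
    unfolding 2 using 1 cmp_inject[of \<mu> \<alpha> \<nu> \<beta>] assms(3) by (cases "\<mu> = \<nu>") auto
qed

lemma act_gen_src:
  "act_gen g \<beta> = Some \<alpha> \<Longrightarrow> \<alpha> \<in> paths \<Lambda> \<and> \<beta> \<in> paths \<Lambda> \<and> src \<Lambda> \<alpha> = src \<Lambda> \<beta>"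
  by (cases g) (auto simp: act_gen_iff src_cmp cmp_closed)

lemma act_list_src:
  "act_list gs \<beta> = Some \<alpha> \<Longrightarrow> \<beta> \<in> paths \<Lambda> \<Longrightarrow> \<alpha> \<in> paths \<Lambda> \<and> src \<Lambda> \<alpha> = src \<Lambda> \<beta>"
  by (induction gs arbitrary: \<alpha>) (auto simp: bind_eq_Some_conv dest: act_gen_src)

text \<open>The matrix of the operator by which a polynomial acts on the span of all paths.\<close>

definition entry :: "('a kp_gen word \<Rightarrow>\<^sub>0 'f::field) \<Rightarrow> 'a \<Rightarrow> 'a \<Rightarrow> 'f" where
  "entry p \<alpha> \<beta> = (\<Sum>w \<in> Poly_Mapping.keys p. if act w \<beta> = Some \<alpha> then Poly_Mapping.lookup p w else 0)"

lemma entry_superset: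
  assumes "finite S" "Poly_Mapping.keys p \<subseteq> S"
  shows "entry p \<alpha> \<beta> = (\<Sum>w \<in> S. if act w \<beta> = Some \<alpha> then Poly_Mapping.lookup p w else 0)"
  unfolding entry_def using assms
  by (intro sum.mono_neutral_left) (auto simp: in_keys_iff)

lemma entry_0 [simp]: "entry 0 \<alpha> \<beta> = 0"
  by (simp add: entry_def)

lemma entry_add: "entry (p + q) \<alpha> \<beta> = entry p \<alpha> \<beta> + entry q \<alpha> \<beta>"
proof -
  let ?S = "Poly_Mapping.keys p \<union> Poly_Mapping.keys q"
  have S: "finite ?S" by simp
  show ?thesis
    using keys_add[of p q]
    by (simp add: entry_superset[OF S, of "p + q"] entry_superset[OF S, of p] entry_superset[OF S, of q]
        sum.distrib[symmetric] lookup_add if_distrib cong: if_cong)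
qed

lemma entry_single: "entry (Poly_Mapping.single w c) \<alpha> \<beta> = (if act w \<beta> = Some \<alpha> then c else 0)"
  by (simp add: entry_superset[of "{w}"])

lemma entry_diff: "entry (p - q) \<alpha> \<beta> = entry p \<alpha> \<beta> - entry q \<alpha> \<beta>"
  using entry_add[of "p - q" q] by simp

lemma entry_sum: "entry (sum f S) \<alpha> \<beta> = (\<Sum>i \<in> S. entry (f i) \<alpha> \<beta>)"
  by (induction S rule: infinite_finite_induct) (auto simp: entry_add)

lemma entry_neq_0E:
  assumes "entry p \<alpha> \<beta> \<noteq> 0"
  obtains w where "w \<in> Poly_Mapping.keys p" "act w \<beta> = Some \<alpha>"
proof -
  obtain w where "w \<in> Poly_Mapping.keys p" "(if act w \<beta> = Some \<alpha> then Poly_Mapping.lookup p w else 0) \<noteq> 0"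
    using assms unfolding entry_def by (rule sum.not_neutral_contains_not_neutral)
  then show thesis by (intro that) (auto split: if_splits)
qed

text \<open>Each word moves \<open>\<gamma>\<close> to at most one path, so a column has no more
  nonzero entries than the polynomial has words. Matrix products are therefore finite sums.\<close>

lemma finite_entry_column: "finite {\<beta>. entry q \<beta> \<gamma> \<noteq> 0}"
proof (rule finite_subset)
  show "{\<beta>. entry q \<beta> \<gamma> \<noteq> 0} \<subseteq> (\<lambda>w. the (act w \<gamma>)) ` Poly_Mapping.keys q"
  proof
    fix \<beta> assume "\<beta> \<in> {\<beta>. entry q \<beta> \<gamma> \<noteq> 0}"
    then obtain w where "w \<in> Poly_Mapping.keys q" "act w \<gamma> = Some \<beta>"
      by (auto elim: entry_neq_0E)
    then show "\<beta> \<in> (\<lambda>w. the (act w \<gamma>)) ` Poly_Mapping.keys q" by force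
  qed
qed simp

text \<open>By bilinearity it is enough to treat two words, and these act by composed partial
  functions: among the intermediate paths only \<open>act w \<gamma>\<close> can contribute. The set
  \<open>S\<close> has to contain all of these, even where several words cancel.\<close>

lemma entry_mult_superset:
  assumes S: "finite S" "\<And>w \<beta>. w \<in> Poly_Mapping.keys q \<Longrightarrow> act w \<gamma> = Some \<beta> \<Longrightarrow> \<beta> \<in> S"
  shows "entry (p * q) \<alpha> \<gamma> = (\<Sum>\<beta> \<in> S. entry p \<alpha> \<beta> * entry q \<beta> \<gamma>)"
proof -
  let ?p = "Poly_Mapping.lookup p" and ?q = "Poly_Mapping.lookup q"
  have "p * q = (\<Sum>u \<in> Poly_Mapping.keys p. Poly_Mapping.single u (?p u)) *
      (\<Sum>w \<in> Poly_Mapping.keys q. Poly_Mapping.single w (?q w))"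
    by (simp only: sum_single_keys)
  also have "\<dots> = (\<Sum>u \<in> Poly_Mapping.keys p. \<Sum>w \<in> Poly_Mapping.keys q. Poly_Mapping.single (u + w) (?p u * ?q w))"
    by (simp add: sum_product mult_single)
  finally have "entry (p * q) \<alpha> \<gamma> = (\<Sum>u \<in> Poly_Mapping.keys p. \<Sum>w \<in> Poly_Mapping.keys q.
      if act (u + w) \<gamma> = Some \<alpha> then ?p u * ?q w else 0)"
    by (simp only: entry_sum entry_single)
  also have "\<dots> = (\<Sum>u \<in> Poly_Mapping.keys p. \<Sum>w \<in> Poly_Mapping.keys q. \<Sum>\<beta> \<in> S.
      (if act u \<beta> = Some \<alpha> then ?p u else 0) * (if act w \<gamma> = Some \<beta> then ?q w else 0))"
  proof (intro sum.cong refl)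
    fix u w assume w: "w \<in> Poly_Mapping.keys q"
    show "(if act (u + w) \<gamma> = Some \<alpha> then ?p u * ?q w else 0) = (\<Sum>\<beta> \<in> S.
      (if act u \<beta> = Some \<alpha> then ?p u else 0) * (if act w \<gamma> = Some \<beta> then ?q w else 0))"
    proof (cases "act w \<gamma>")
      case None
      then show ?thesis by (simp add: act_list_append)
    next
      case (Some \<delta>)
      then have "\<delta> \<in> S" using S(2) w by auto
      have "(\<Sum>\<beta> \<in> S. (if act u \<beta> = Some \<alpha> then ?p u else 0) * (if act w \<gamma> = Some \<beta> then ?q w else 0)) =
          (\<Sum>\<beta> \<in> S. if \<beta> = \<delta> then (if act u \<delta> = Some \<alpha> then ?p u else 0) * ?q w else 0)"
        using Some by (intro sum.cong) auto
      then show ?thesis using Some S(1) \<open>\<delta> \<in> S\<close> by (simp add: act_list_append)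
    qed
  qed
  also have "\<dots> = (\<Sum>\<beta> \<in> S. \<Sum>u \<in> Poly_Mapping.keys p. \<Sum>w \<in> Poly_Mapping.keys q.
      (if act u \<beta> = Some \<alpha> then ?p u else 0) * (if act w \<gamma> = Some \<beta> then ?q w else 0))"
    by (simp only: sum.swap[where A = S and B = "Poly_Mapping.keys p"]
        sum.swap[where A = S and B = "Poly_Mapping.keys q"])
  also have "\<dots> = (\<Sum>\<beta> \<in> S. entry p \<alpha> \<beta> * entry q \<beta> \<gamma>)"
    by (simp only: entry_def sum_product)
  finally show ?thesis .
qed

lemma entry_mult:
  assumes "finite S" "\<And>\<beta>. entry q \<beta> \<gamma> \<noteq> 0 \<Longrightarrow> \<beta> \<in> S"
  shows "entry (p * q) \<alpha> \<gamma> = (\<Sum>\<beta> \<in> S. entry p \<alpha> \<beta> * entry q \<beta> \<gamma>)"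
proof -
  let ?T = "S \<union> (\<lambda>w. the (act w \<gamma>)) ` Poly_Mapping.keys q"
  have "entry (p * q) \<alpha> \<gamma> = (\<Sum>\<beta> \<in> ?T. entry p \<alpha> \<beta> * entry q \<beta> \<gamma>)"
    using assms(1) by (intro entry_mult_superset) force+
  also have "\<dots> = (\<Sum>\<beta> \<in> S. entry p \<alpha> \<beta> * entry q \<beta> \<gamma>)"
    using assms by (intro sum.mono_neutral_right) auto
  finally show ?thesis .
qed

text \<open>Paths are prepended and prefixes deleted, so no letter changes the source. This gives
  the matrices their block structure by source and keeps every level invariant.\<close>

lemma entry_src:
  assumes "entry p \<alpha> \<beta> \<noteq> 0" "\<beta> \<in> paths \<Lambda>"
  shows "\<alpha> \<in> paths \<Lambda>" "src \<Lambda> \<alpha> = src \<Lambda> \<beta>"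
proof -
  obtain w where "act w \<beta> = Some \<alpha>"
    using assms(1) by (rule entry_neq_0E)
  then show "\<alpha> \<in> paths \<Lambda>" "src \<Lambda> \<alpha> = src \<Lambda> \<beta>" using assms(2) act_list_src by blast+
qed

end

section \<open>Polynomials that vanish at large levels\<close>

context level_kgraph
begin

lemma entry_paths_to: "entry p \<alpha> \<beta> \<noteq> 0 \<Longrightarrow> \<beta> \<in> paths_to n \<Longrightarrow> \<alpha> \<in> paths_to n"
  using entry_src[of p \<alpha> \<beta>] by (simp add: paths_to_def)

text \<open>Relation (KP4) holds only on sufficiently long paths, so relators may act nontrivially on
  low levels.\<close>

definition null_polys :: "('a kp_gen word \<Rightarrow>\<^sub>0 'f::field) set" where
  "null_polys = {p \<in> kp_polys \<Gamma>.
     \<forall>\<^sub>F n in at_top. \<forall>\<alpha>. \<forall>\<beta> \<in> paths_to n. entry p \<alpha> \<beta> = 0}"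

lemma null_polysI:
  "p \<in> kp_polys \<Gamma> \<Longrightarrow> (\<And>\<alpha> \<beta>. entry p \<alpha> \<beta> = 0) \<Longrightarrow> p \<in> null_polys"
  by (simp add: null_polys_def)

lemma null_polys_mult_left:
  assumes "p \<in> kp_polys \<Gamma>" "q \<in> null_polys"
  shows "p * q \<in> null_polys"
proof -
  have "\<forall>\<^sub>F n in at_top. \<forall>\<alpha>. \<forall>\<beta> \<in> paths_to n. entry q \<alpha> \<beta> = 0"
    using assms by (simp add: null_polys_def)
  then have "\<forall>\<^sub>F n in at_top. \<forall>\<alpha>. \<forall>\<beta> \<in> paths_to n. entry (p * q) \<alpha> \<beta> = 0"
    \<comment> \<open>The column of \<open>q\<close> is zero, so the product can be summed over an
      empty set of intermediate paths.\<close>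
    by eventually_elim (intro allI ballI, subst entry_mult[of "{}"], auto)
  then show ?thesis using assms by (simp add: null_polys_def poly_over_mult)
qed

text \<open>Here \<open>p\<close> acts first; since it stays within level n, \<open>q\<close> is
  only applied where it vanishes.\<close>

lemma null_polys_mult_right:
  assumes "p \<in> kp_polys \<Gamma>" "q \<in> null_polys"
  shows "q * p \<in> null_polys"
proof -
  have "\<forall>\<^sub>F n in at_top. \<forall>\<alpha>. \<forall>\<beta> \<in> paths_to n. entry q \<alpha> \<beta> = 0"
    using assms by (simp add: null_polys_def)
  then have "\<forall>\<^sub>F n in at_top. \<forall>\<alpha>. \<forall>\<beta> \<in> paths_to n. entry (q * p) \<alpha> \<beta> = 0"
  proof eventually_elim
    case (elim n)
    then show ?case
      by (auto simp: entry_mult[OF finite_entry_column] intro!: sum.neutral dest: entry_paths_to)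
  qed
  then show ?thesis using assms by (simp add: null_polys_def poly_over_mult)
qed

lemma ideal_null_polys: "ideal (null_polys :: ('a kp_gen word \<Rightarrow>\<^sub>0 'f::field) set) (kp_free \<Gamma>)"
proof (rule idealI)
  let ?R = "kp_free \<Gamma> :: ('a kp_gen word \<Rightarrow>\<^sub>0 'f) ring"
  let ?N = "null_polys :: ('a kp_gen word \<Rightarrow>\<^sub>0 'f) set"
  interpret F: ring "free_algebra (kp_gens \<Gamma>) :: ('a kp_gen word \<Rightarrow>\<^sub>0 'f) ring" by (rule ring_free_algebra)
  show "subgroup ?N (add_monoid ?R)"
  proof (rule group.subgroupI)
    show "group (add_monoid ?R)" unfolding kp_free_eq by (rule F.a_group)
    show "?N \<subseteq> carrier (add_monoid ?R)"
      by (auto simp: null_polys_def kp_free_eq)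
    show "?N \<noteq> {}" using null_polysI[of 0] by auto
  next
    fix p :: "'a kp_gen word \<Rightarrow>\<^sub>0 'f" assume p: "p \<in> null_polys"
    have "inv\<^bsub>add_monoid (kp_free \<Gamma>)\<^esub> p = \<ominus>\<^bsub>free_algebra (kp_gens \<Gamma>)\<^esub> p"
      by (simp only: kp_free_eq a_inv_def)
    also have "\<dots> = \<zero>\<^bsub>free_algebra (kp_gens \<Gamma>)\<^esub> \<ominus>\<^bsub>free_algebra (kp_gens \<Gamma>)\<^esub> p"
      using p F.a_inv_closed[of p] F.l_zero[of "\<ominus>\<^bsub>free_algebra (kp_gens \<Gamma>)\<^esub> p"]
      by (simp add: null_polys_def a_minus_def)
    also have "\<dots> = - p"
      using p by (subst minus_free_algebra) (auto simp: null_polys_def)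
    finally show "inv\<^bsub>add_monoid (kp_free \<Gamma>)\<^esub> p \<in> null_polys"
      using p entry_diff[of 0 p] by (auto simp: null_polys_def poly_over_uminus)
  next
    fix p q :: "'a kp_gen word \<Rightarrow>\<^sub>0 'f" assume pq: "p \<in> null_polys" "q \<in> null_polys"
    then have "\<forall>\<^sub>F n in at_top. \<forall>\<alpha>. \<forall>\<beta> \<in> paths_to n. entry p \<alpha> \<beta> = 0"
      "\<forall>\<^sub>F n in at_top. \<forall>\<alpha>. \<forall>\<beta> \<in> paths_to n. entry q \<alpha> \<beta> = 0"
      by (simp_all add: null_polys_def)
    then have "\<forall>\<^sub>F n in at_top. \<forall>\<alpha>. \<forall>\<beta> \<in> paths_to n. entry (p + q) \<alpha> \<beta> = 0"
      by eventually_elim (simp add: entry_add)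
    then show "p \<otimes>\<^bsub>add_monoid (kp_free \<Gamma>)\<^esub> q \<in> null_polys"
      using pq by (simp add: null_polys_def poly_over_add kp_free_eq)
  qed
  show "ring ?R" unfolding kp_free_eq by (rule ring_free_algebra)
qed (auto simp: kp_free_eq intro: null_polys_mult_left null_polys_mult_right)

text \<open>A path from \<open>v\<close> to a level above \<open>level v + vec_int d\<close> has
  degree at least \<open>d\<close>, hence exactly one prefix of degree \<open>d\<close>. Deleting
  and restoring that prefix fixes the path, and all other summands kill it.\<close>

lemma entry_ck:
  assumes v: "v \<in> verts \<Gamma>" and n: "level v + vec_int d \<le> n" and \<beta>: "\<beta> \<in> paths_to n"
  shows "entry (\<Sum>\<mu> \<in> paths_from \<Gamma> v d. path \<mu> * ghost \<mu>) \<alpha> \<beta> = entry (path v) \<alpha> \<beta>"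
proof -
  have \<beta>': "\<beta> \<in> paths \<Gamma>" "level (rng \<Gamma> \<beta>) + vec_int (deg \<Gamma> \<beta>) = n"
    using \<beta> level_src by (auto simp: paths_to_def)
  have act: "act_list [Path \<mu>, Ghost \<mu>] \<beta> = Some \<alpha> \<longleftrightarrow> \<alpha> = \<beta> \<and> (\<exists>\<gamma>. composable \<mu> \<gamma> \<and> cmp \<Gamma> \<mu> \<gamma> = \<beta>)" for \<mu>
    by (auto simp: bind_eq_Some_conv act_gen_iff)
  have eq: "entry (\<Sum>\<mu> \<in> paths_from \<Gamma> v d. path \<mu> * ghost \<mu>) \<alpha> \<beta> =
     (\<Sum>\<mu> \<in> paths_from \<Gamma> v d. if \<alpha> = \<beta> \<and> (\<exists>\<gamma>. composable \<mu> \<gamma> \<and> cmp \<Gamma> \<mu> \<gamma> = \<beta>) then 1 else 0)"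
    unfolding entry_sum mult_single entry_single plus_Word word.sel by (simp only: append.simps act mult_1)
  show ?thesis
  proof (cases "\<alpha> = \<beta> \<and> rng \<Gamma> \<beta> = v")
    case True
    then have "level v + vec_int d \<le> level v + vec_int (deg \<Gamma> \<beta>)" using n \<beta>'(2) by simp
    then have "d \<le> deg \<Gamma> \<beta>" by (simp add: less_eq_vec_def vec_int_def)
    then obtain \<mu> \<gamma> where \<mu>: "composable \<mu> \<gamma>" "deg \<Gamma> \<mu> = d" "cmp \<Gamma> \<mu> \<gamma> = \<beta>"
      using factor \<beta>'(1) by metis
    then have mem: "\<mu> \<in> paths_from \<Gamma> v d" using True rng_cmp[of \<mu> \<gamma>] by (auto simp: paths_from_def)
    have "\<nu> = \<mu>" if "\<nu> \<in> paths_from \<Gamma> v d" "composable \<nu> \<delta>" "cmp \<Gamma> \<nu> \<delta> = \<beta>" for \<nu> \<delta>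
      using cmp_inject(1)[of \<nu> \<delta> \<mu> \<gamma>] that \<mu> by (simp add: paths_from_def)
    then have "(\<Sum>\<nu> \<in> paths_from \<Gamma> v d. if \<alpha> = \<beta> \<and> (\<exists>\<gamma>. composable \<nu> \<gamma> \<and> cmp \<Gamma> \<nu> \<gamma> = \<beta>) then 1 else 0) =
      (\<Sum>\<nu> \<in> paths_from \<Gamma> v d. if \<nu> = \<mu> then (1::'b) else 0)"
      using True \<mu> by (intro sum.cong if_cong) blast+
    also have "\<dots> = 1" using mem v by (simp add: finite_paths_from)
    finally show ?thesis unfolding eq using True v \<beta>' by (simp add: entry_single act_gen_vert)
  next
    case False
    have "rng \<Gamma> \<beta> = v" if "\<mu> \<in> paths_from \<Gamma> v d" "composable \<mu> \<gamma>" "cmp \<Gamma> \<mu> \<gamma> = \<beta>" for \<mu> \<gamma>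
      using that rng_cmp[of \<mu> \<gamma>] by (simp add: paths_from_def)
    then have "(\<Sum>\<nu> \<in> paths_from \<Gamma> v d. if \<alpha> = \<beta> \<and> (\<exists>\<gamma>. composable \<nu> \<gamma> \<and> cmp \<Gamma> \<nu> \<gamma> = \<beta>) then 1 else 0) = (0::'b)"
      using False by (intro sum.neutral) auto
    then show ?thesis unfolding eq using False v \<beta>' by (auto simp: entry_single act_gen_vert)
  qed
qed

text \<open>Unlike (KP4), these relations hold on every path: each compares two words with the same
  partial action, or a word that acts nowhere with 0.\<close>

lemma entry_relator:
  assumes "p \<in> kp1_relators \<Gamma> \<union> kp2_relators \<Gamma> \<union> kp3_relators \<Gamma>"
  shows "entry p \<alpha> \<beta> = 0"
proof -
  have 1: "entry (Poly_Mapping.single u 1 - Poly_Mapping.single w 1) \<alpha> \<beta> = 0" if "act u \<beta> = act w \<beta>" for u w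
    using that by (simp add: entry_diff entry_single)
  have 2: "entry (Poly_Mapping.single u 1 - (if P then Poly_Mapping.single w 1 else 0)) \<alpha> \<beta> = 0"
    if "act u \<beta> = (if P then act w \<beta> else None)" for u w P
    using that by (auto simp: entry_diff entry_single)
  note sgl = mult_single plus_Word append.simps mult_1
  from assms show ?thesis
    unfolding kp1_relators_def kp2_relators_def kp3_relators_def
  proof (elim UnE CollectE exE conjE; hypsubst; unfold sgl)
    fix v w assume "v \<in> verts \<Gamma>" "w \<in> verts \<Gamma>"
    then show "entry (Poly_Mapping.single (Word [Path v, Path w]) 1 - (if v = w then path v else 0)) \<alpha> \<beta> = 0"
      by (intro 2) (auto simp: act_gen_vert)
  next
    fix v assume "v \<in> verts \<Gamma>"
    then show "entry (path v - ghost v) \<alpha> \<beta> = 0"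
      by (intro 1) (simp add: act_gen_vert_ghost)
  next
    fix \<mu> \<nu> assume "\<mu> \<in> paths \<Gamma>" "\<nu> \<in> paths \<Gamma>" "rng \<Gamma> \<nu> = src \<Gamma> \<mu>"
    then show "entry (Poly_Mapping.single (Word [Path \<mu>, Path \<nu>]) 1 - path (cmp \<Gamma> \<mu> \<nu>)) \<alpha> \<beta> = 0"
      by (intro 1) (simp only: word.sel act_list_Path_Path)
  next
    fix \<mu> \<nu> assume "\<mu> \<in> paths \<Gamma>" "\<nu> \<in> paths \<Gamma>" "rng \<Gamma> \<nu> = src \<Gamma> \<mu>"
    then show "entry (Poly_Mapping.single (Word [Ghost \<nu>, Ghost \<mu>]) 1 - ghost (cmp \<Gamma> \<mu> \<nu>)) \<alpha> \<beta> = 0"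
      by (intro 1) (simp only: word.sel act_list_Ghost_Ghost)
  next
    fix \<mu> assume "\<mu> \<in> paths \<Gamma>"
    then show "entry (Poly_Mapping.single (Word [Path (rng \<Gamma> \<mu>), Path \<mu>]) 1 - path \<mu>) \<alpha> \<beta> = 0"
      using act_list_Path_Path[of "rng \<Gamma> \<mu>" \<mu>]
      by (intro 1) (simp only: word.sel rng_path src_vert rng_closed cmp_rng)
  next
    fix \<mu> assume "\<mu> \<in> paths \<Gamma>"
    then show "entry (Poly_Mapping.single (Word [Path \<mu>, Path (src \<Gamma> \<mu>)]) 1 - path \<mu>) \<alpha> \<beta> = 0"
      using act_list_Path_Path[of \<mu> "src \<Gamma> \<mu>"]
      by (intro 1) (simp only: word.sel src_path rng_vert src_closed cmp_src)
  next
    fix \<mu> assume m: "\<mu> \<in> paths \<Gamma>"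
    \<comment> \<open>For a vertex, \<open>Path\<close> and \<open>Ghost\<close> act alike, so the
      mixed relation is an instance of the one for two ghosts.\<close>
    have "act_list [Path (src \<Gamma> \<mu>), Ghost \<mu>] \<beta> = act_list [Ghost \<mu>] \<beta>"
      using act_list_Ghost_Ghost[of \<mu> "src \<Gamma> \<mu>" \<beta>] m src_path[OF m] src_closed[OF m]
      by (simp add: rng_vert cmp_src act_gen_vert_ghost)
    then show "entry (Poly_Mapping.single (Word [Path (src \<Gamma> \<mu>), Ghost \<mu>]) 1 - ghost \<mu>) \<alpha> \<beta> = 0"
      by (intro 1) (simp only: word.sel)
  next
    fix \<mu> assume m: "\<mu> \<in> paths \<Gamma>"
    have "act_list [Ghost \<mu>, Path (rng \<Gamma> \<mu>)] \<beta> = act_list [Ghost \<mu>] \<beta>"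
      using act_list_Ghost_Ghost[of "rng \<Gamma> \<mu>" \<mu> \<beta>] m rng_path[OF m] rng_closed[OF m]
      by (simp add: src_vert cmp_rng act_gen_vert_ghost)
    then show "entry (Poly_Mapping.single (Word [Ghost \<mu>, Path (rng \<Gamma> \<mu>)]) 1 - ghost \<mu>) \<alpha> \<beta> = 0"
      by (intro 1) (simp only: word.sel)
  next
    fix \<mu> \<nu> assume "\<mu> \<in> paths \<Gamma>" "\<nu> \<in> paths \<Gamma>" "deg \<Gamma> \<mu> = deg \<Gamma> \<nu>"
    then show "entry (Poly_Mapping.single (Word [Ghost \<mu>, Path \<nu>]) 1 -
        (if \<mu> = \<nu> then path (src \<Gamma> \<mu>) else 0)) \<alpha> \<beta> = 0"
      by (intro 2) (simp only: word.sel act_list_Ghost_Path)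
  qed
qed

text \<open>Since \<open>null_polys\<close> is an ideal, only the relators have to be inspected; a
  (KP4) relator vanishes from level \<open>level v + vec_int d\<close> on.\<close>

lemma kp_ideal_null: "kp_ideal \<Gamma> \<subseteq> null_polys"
proof -
  have "p \<in> null_polys" if p4: "p \<in> kp4_relators \<Gamma>" for p :: "'a kp_gen word \<Rightarrow>\<^sub>0 'b"
  proof -
    obtain v d where p: "p = path v - (\<Sum>\<mu> \<in> paths_from \<Gamma> v d. path \<mu> * ghost \<mu>)" and v: "v \<in> verts \<Gamma>"
      using p4 unfolding kp4_relators_def by blast
    have "\<forall>\<^sub>F n in at_top. level v + vec_int d \<le> n" by (rule eventually_ge_at_top_vec)
    then have "\<forall>\<^sub>F n in at_top. \<forall>\<alpha>. \<forall>\<beta> \<in> paths_to n. entry p \<alpha> \<beta> = 0"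
      by eventually_elim (simp add: p entry_diff entry_ck[OF v])
    moreover have "p \<in> kp_polys \<Gamma>" using p4 kp_relators_subset by (auto simp: kp_relators_def)
    ultimately show ?thesis by (simp add: null_polys_def)
  qed
  moreover have "p \<in> null_polys" if "p \<in> kp1_relators \<Gamma> \<union> kp2_relators \<Gamma> \<union> kp3_relators \<Gamma>"
    for p :: "'a kp_gen word \<Rightarrow>\<^sub>0 'b"
    using that entry_relator[OF that] kp_relators_subset
    by (intro null_polysI) (auto simp: kp_relators_def)
  ultimately show ?thesis
    unfolding kp_ideal_def kp_free_eq
    by (intro ring.genideal_minimal[OF ring_free_algebra] ideal_null_polys[unfolded kp_free_eq]) blast
qed

text \<open>The level from which the matrices agree depends on the pair, because a congruence may
  use (KP4) in arbitrary degrees. Every distinction between idempotents is drawn from this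
  lemma.\<close>

lemma kp_cong_entry:
  assumes "kp_cong \<Gamma> p q"
  shows "\<forall>\<^sub>F n in at_top. \<forall>\<alpha>. \<forall>\<beta> \<in> paths_to n. entry p \<alpha> \<beta> = entry q \<alpha> \<beta>"
proof -
  have "p - q \<in> null_polys" using assms kp_ideal_null by (auto simp: kp_cong_def)
  then show ?thesis by (simp add: null_polys_def entry_diff)
qed

end

section \<open>Spanning by matrix units\<close>

context level_kgraph
begin

definition dom_at :: "int ^ 'k \<Rightarrow> 'a kp_gen list \<Rightarrow> 'a set" where
  "dom_at n gs = {\<beta> \<in> paths_to n. act_list gs \<beta> \<noteq> None}"

lemma dom_at_Path: "\<mu> \<in> paths \<Gamma> \<Longrightarrow> dom_at n [Path \<mu>] = {\<beta> \<in> paths_to n. rng \<Gamma> \<beta> = src \<Gamma> \<mu>}"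
  by (auto simp: dom_at_def act_gen.simps paths_to_def)

lemma dom_at_Ghost:
  "\<mu> \<in> paths \<Gamma> \<Longrightarrow> dom_at n [Ghost \<mu>] = cmp \<Gamma> \<mu> ` {\<beta> \<in> paths_to n. rng \<Gamma> \<beta> = src \<Gamma> \<mu>}"
proof (intro equalityI subsetI)
  fix \<alpha> assume \<mu>: "\<mu> \<in> paths \<Gamma>" and "\<alpha> \<in> dom_at n [Ghost \<mu>]"
  then obtain \<beta> where "\<alpha> \<in> paths_to n" "composable \<mu> \<beta>" "cmp \<Gamma> \<mu> \<beta> = \<alpha>"
    by (auto simp: dom_at_def act_gen_Ghost_iff)
  then show "\<alpha> \<in> cmp \<Gamma> \<mu> ` {\<beta> \<in> paths_to n. rng \<Gamma> \<beta> = src \<Gamma> \<mu>}"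
    using src_cmp[of \<mu> \<beta>] by (intro image_eqI[of _ _ \<beta>]) (auto simp: paths_to_def)
next
  fix \<alpha> assume \<mu>: "\<mu> \<in> paths \<Gamma>" and "\<alpha> \<in> cmp \<Gamma> \<mu> ` {\<beta> \<in> paths_to n. rng \<Gamma> \<beta> = src \<Gamma> \<mu>}"
  then obtain \<beta> where \<beta>: "\<beta> \<in> paths_to n" "composable \<mu> \<beta>" "\<alpha> = cmp \<Gamma> \<mu> \<beta>"
    by (auto simp: paths_to_def)
  then have "act_gen (Ghost \<mu>) \<alpha> = Some \<beta>" by (simp add: act_gen_Ghost_iff)
  moreover have "\<alpha> \<in> paths_to n" using \<beta> src_cmp[of \<mu> \<beta>] cmp_closed[of \<mu> \<beta>] by (simp add: paths_to_def)
  ultimately show "\<alpha> \<in> dom_at n [Ghost \<mu>]" by (simp add: dom_at_def)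
qed

lemma finite_dom_at_single: "g \<in> kp_gens \<Gamma> \<Longrightarrow> finite (dom_at n [g])"
  by (cases g) (auto simp: dom_at_Path dom_at_Ghost finite_paths_to_from src_closed)

text \<open>The last letter acts first and is defined on only finitely many paths of level n: those
  with a fixed range, or their extensions by a fixed prefix. The empty word is defined on all of
  them, which is why constant terms are excluded.\<close>

lemma finite_dom_at: "gs \<noteq> [] \<Longrightarrow> set gs \<subseteq> kp_gens \<Gamma> \<Longrightarrow> finite (dom_at n gs)"
proof -
  assume gs: "gs \<noteq> []" "set gs \<subseteq> kp_gens \<Gamma>"
  then obtain hs g where hs: "gs = hs @ [g]" by (meson rev_exhaust)
  have "dom_at n gs \<subseteq> dom_at n [g]"
    unfolding hs dom_at_def by (auto simp: act_list_append split: bind_splits)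
  then show ?thesis using finite_dom_at_single[of g n] gs hs by (auto intro: finite_subset)
qed

lemma path_poly: "\<mu> \<in> paths \<Gamma> \<Longrightarrow> path \<mu> \<in> kp_polys \<Gamma>"
  and ghost_poly: "\<mu> \<in> paths \<Gamma> \<Longrightarrow> ghost \<mu> \<in> kp_polys \<Gamma>"
  by (auto intro: poly_over_single)

text \<open>With a common range the degrees agree and (KP3) applies. With different ranges,
  inserting \<open>r(\<alpha>)\<close> and \<open>r(\<beta>)\<close> in the middle produces a
  product of orthogonal vertices.\<close>

lemma kp_cong_ghost_path:
  assumes "\<alpha> \<in> paths_to n" "\<beta> \<in> paths_to n"
  shows "kp_cong \<Gamma> (ghost \<alpha> * path \<beta>) (if \<alpha> = \<beta> then path (src \<Gamma> \<alpha>) else 0)"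
proof -
  have ab: "\<alpha> \<in> paths \<Gamma>" "\<beta> \<in> paths \<Gamma>" using assms by (auto simp: paths_to_def)
  have lev: "level (rng \<Gamma> \<alpha>) + vec_int (deg \<Gamma> \<alpha>) = level (rng \<Gamma> \<beta>) + vec_int (deg \<Gamma> \<beta>)"
    using assms level_src[of \<alpha>] level_src[of \<beta>] by (simp add: paths_to_def)
  show ?thesis
  proof (cases "rng \<Gamma> \<alpha> = rng \<Gamma> \<beta>")
    case True
    then have "deg \<Gamma> \<alpha> = deg \<Gamma> \<beta>" using lev by simp
    then show ?thesis using kp_cong_ghost_path_same_deg ab by blast
  next
    case False
    have "kp_cong \<Gamma> (ghost \<alpha> * path \<beta>) ((ghost \<alpha> * path (rng \<Gamma> \<alpha>)) * (path (rng \<Gamma> \<beta>) * path \<beta>))"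
      using ab by (intro kp_cong_mult kp_cong_sym[OF kp_cong_path_rng] kp_cong_sym[OF kp_cong_ghost_rng])
    also have "(ghost \<alpha> * path (rng \<Gamma> \<alpha>)) * (path (rng \<Gamma> \<beta>) * path \<beta>) =
        ghost \<alpha> * ((path (rng \<Gamma> \<alpha>) * path (rng \<Gamma> \<beta>)) * path \<beta>)"
      by (simp add: mult.assoc)
    also have "kp_cong \<Gamma> \<dots> (ghost \<alpha> * ((if rng \<Gamma> \<alpha> = rng \<Gamma> \<beta> then path (rng \<Gamma> \<alpha>) else 0) * path \<beta>))"
      using ab by (intro kp_cong_mult kp_cong_verts kp_cong_refl path_poly ghost_poly rng_closed)
    finally show ?thesis using False by auto
  qed
qed

text \<open>This is the rule for matrix units. Equality of the sources of \<open>\<alpha>\<close>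
  and \<open>\<beta>\<close> lets the vertex left over by (KP3) be absorbed into
  \<open>\<alpha>\<close>.\<close>

lemma kp_cong_unit_mult:
  assumes "\<alpha> \<in> paths \<Gamma>" "\<beta> \<in> paths_to n" "\<gamma> \<in> paths_to n" "\<delta> \<in> paths \<Gamma>" "src \<Gamma> \<alpha> = src \<Gamma> \<beta>"
  shows "kp_cong \<Gamma> ((path \<alpha> * ghost \<beta>) * (path \<gamma> * ghost \<delta>)) (if \<beta> = \<gamma> then path \<alpha> * ghost \<delta> else 0)"
proof -
  have "(path \<alpha> * ghost \<beta>) * (path \<gamma> * ghost \<delta>) = path \<alpha> * (ghost \<beta> * path \<gamma>) * ghost \<delta>"
    by (simp add: mult.assoc)
  also have "kp_cong \<Gamma> \<dots> (path \<alpha> * (if \<beta> = \<gamma> then path (src \<Gamma> \<beta>) else 0) * ghost \<delta>)"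
    using assms by (intro kp_cong_mult kp_cong_ghost_path kp_cong_refl path_poly ghost_poly)
  also have "kp_cong \<Gamma> \<dots> (if \<beta> = \<gamma> then path \<alpha> * ghost \<delta> else 0)"
    using kp_cong_mult[OF kp_cong_path_src[OF assms(1)] kp_cong_refl[OF ghost_poly[OF assms(4)]]]
    unfolding assms(5) by (auto simp: kp_cong_refl)
  finally show ?thesis .
qed

lemma kp_cong_ck_level:
  assumes "v \<in> verts \<Gamma>" "level v \<le> n"
  shows "kp_cong \<Gamma> (path v) (\<Sum>\<mu> \<in> {\<mu> \<in> paths_to n. rng \<Gamma> \<mu> = v}. path \<mu> * ghost \<mu>)"
  using kp_cong_ck[OF assms(1)] assms(2) by (simp add: paths_to_from)

text \<open>Expanding the source vertex on the right of \<open>\<mu>\<close> by (KP4) gives the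
  terms \<open>\<mu> \<beta> \<beta>*\<close>, which are matrix units of level n.\<close>

lemma kp_cong_Path_span:
  assumes \<mu>: "\<mu> \<in> paths \<Gamma>" and n: "level (src \<Gamma> \<mu>) \<le> n"
  shows "kp_cong \<Gamma> (path \<mu>) (\<Sum>\<beta> \<in> dom_at n [Path \<mu>]. path (the (act_list [Path \<mu>] \<beta>)) * ghost \<beta>)"
proof -
  let ?D = "{\<beta> \<in> paths_to n. rng \<Gamma> \<beta> = src \<Gamma> \<mu>}"
  have c: "composable \<mu> \<beta>" if "\<beta> \<in> ?D" for \<beta> using that \<mu> by (auto simp: paths_to_def)
  have "kp_cong \<Gamma> (path \<mu>) (path \<mu> * path (src \<Gamma> \<mu>))"
    using \<mu> by (rule kp_cong_sym[OF kp_cong_path_src])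
  also have "kp_cong \<Gamma> \<dots> (path \<mu> * (\<Sum>\<beta> \<in> ?D. path \<beta> * ghost \<beta>))"
    using \<mu> n by (intro kp_cong_mult kp_cong_refl path_poly kp_cong_ck_level src_closed)
  also have "\<dots> = (\<Sum>\<beta> \<in> ?D. (path \<mu> * path \<beta>) * ghost \<beta>)"
    by (simp only: sum_distrib_left mult.assoc)
  also have "kp_cong \<Gamma> \<dots> (\<Sum>\<beta> \<in> ?D. path (cmp \<Gamma> \<mu> \<beta>) * ghost \<beta>)"
    using c by (intro kp_cong_sum kp_cong_mult kp_cong_path_cmp kp_cong_refl ghost_poly) blast+
  also have "\<dots> = (\<Sum>\<beta> \<in> dom_at n [Path \<mu>]. path (the (act_list [Path \<mu>] \<beta>)) * ghost \<beta>)"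
  proof (rule sum.cong)
    fix \<beta> assume "\<beta> \<in> dom_at n [Path \<mu>]"
    then have "composable \<mu> \<beta>" using c \<mu> by (simp only: dom_at_Path)
    then show "path (cmp \<Gamma> \<mu> \<beta>) * ghost \<beta> = path (the (act_list [Path \<mu>] \<beta>)) * ghost \<beta>"
      by (simp add: act_gen.simps)
  qed (use \<mu> in \<open>simp add: dom_at_Path\<close>)
  finally show ?thesis .
qed

lemma kp_cong_Ghost_span:
  assumes \<mu>: "\<mu> \<in> paths \<Gamma>" and n: "level (src \<Gamma> \<mu>) \<le> n"
  shows "kp_cong \<Gamma> (ghost \<mu>) (\<Sum>\<beta> \<in> dom_at n [Ghost \<mu>]. path (the (act_list [Ghost \<mu>] \<beta>)) * ghost \<beta>)"
proof -
  let ?D = "{\<beta> \<in> paths_to n. rng \<Gamma> \<beta> = src \<Gamma> \<mu>}"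
  have c: "composable \<mu> \<beta>" if "\<beta> \<in> ?D" for \<beta> using that \<mu> by (auto simp: paths_to_def)
  have "kp_cong \<Gamma> (ghost \<mu>) (path (src \<Gamma> \<mu>) * ghost \<mu>)"
    using \<mu> by (rule kp_cong_sym[OF kp_cong_ghost_src])
  also have "kp_cong \<Gamma> \<dots> ((\<Sum>\<beta> \<in> ?D. path \<beta> * ghost \<beta>) * ghost \<mu>)"
    using \<mu> n by (intro kp_cong_mult kp_cong_refl ghost_poly kp_cong_ck_level src_closed)
  also have "\<dots> = (\<Sum>\<beta> \<in> ?D. path \<beta> * (ghost \<beta> * ghost \<mu>))"
    by (simp only: sum_distrib_right mult.assoc)
  also have "kp_cong \<Gamma> \<dots> (\<Sum>\<beta> \<in> ?D. path \<beta> * ghost (cmp \<Gamma> \<mu> \<beta>))"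
    using c by (intro kp_cong_sum kp_cong_mult kp_cong_ghost_cmp kp_cong_refl path_poly) blast+
  also have "\<dots> = (\<Sum>\<beta> \<in> ?D. path (the (act_list [Ghost \<mu>] (cmp \<Gamma> \<mu> \<beta>))) * ghost (cmp \<Gamma> \<mu> \<beta>))"
  proof (rule sum.cong)
    fix \<beta> assume "\<beta> \<in> ?D"
    then have "act_gen (Ghost \<mu>) (cmp \<Gamma> \<mu> \<beta>) = Some \<beta>" using c by (simp only: act_gen_Ghost_iff simp_thms)
    then show "path \<beta> * ghost (cmp \<Gamma> \<mu> \<beta>) =
        path (the (act_list [Ghost \<mu>] (cmp \<Gamma> \<mu> \<beta>))) * ghost (cmp \<Gamma> \<mu> \<beta>)"
      by simp
  qed simp
  also have "\<dots> = (\<Sum>\<beta> \<in> dom_at n [Ghost \<mu>]. path (the (act_list [Ghost \<mu>] \<beta>)) * ghost \<beta>)"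
  proof -
    \<comment> \<open>By left cancellation, prepending \<open>\<mu>\<close> is a bijection onto the
      domain of the ghost, so the sum can be reindexed.\<close>
    have "inj_on (cmp \<Gamma> \<mu>) ?D" by (rule inj_onI) (rule cmp_left_cancel[OF c c])
    then show ?thesis unfolding dom_at_Ghost[OF \<mu>] by (simp add: sum.reindex)
  qed
  finally show ?thesis .
qed

lemma dom_at_paths:
  assumes "\<beta> \<in> dom_at n gs"
  shows "\<beta> \<in> paths_to n" "the (act_list gs \<beta>) \<in> paths_to n" "src \<Gamma> (the (act_list gs \<beta>)) = src \<Gamma> \<beta>"
    "act_list gs \<beta> = Some (the (act_list gs \<beta>))"
  using assms act_list_src[of gs \<beta> "the (act_list gs \<beta>)"] by (auto simp: dom_at_def paths_to_def)

text \<open>In matrix units a word becomes the graph of the partial function by which it acts, and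
  multiplying such sums composes the functions. Each letter needs a level above that of its source,
  so the bound depends on the word.\<close>

lemma kp_cong_word_span:
  assumes "gs \<noteq> []" "set gs \<subseteq> kp_gens \<Gamma>"
  shows "\<forall>\<^sub>F n in at_top. kp_cong \<Gamma> (Poly_Mapping.single (Word gs) (1 :: 'f::field))
    (\<Sum>\<beta> \<in> dom_at n gs. path (the (act_list gs \<beta>)) * ghost \<beta>)"
  using assms
proof (induction gs rule: list_nonempty_induct)
  case (single g)
  then obtain \<mu> where \<mu>: "\<mu> \<in> paths \<Gamma>" "g = Path \<mu> \<or> g = Ghost \<mu>"
    by (auto simp: kp_gens_def)
  have "\<forall>\<^sub>F n in at_top. level (src \<Gamma> \<mu>) \<le> n" by (rule eventually_ge_at_top_vec)
  then show ?case
    by eventually_elim (use \<mu> kp_cong_Path_span kp_cong_Ghost_span in blast)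
next
  case (cons g gs)
  let ?U = "\<lambda>gs \<beta>. path (the (act_list gs \<beta>)) * ghost \<beta> :: 'a kp_gen word \<Rightarrow>\<^sub>0 'f"
  from cons obtain \<mu> where \<mu>: "\<mu> \<in> paths \<Gamma>" "g = Path \<mu> \<or> g = Ghost \<mu>"
    by (auto simp: kp_gens_def)
  have gs: "set gs \<subseteq> kp_gens \<Gamma>" and g: "g \<in> kp_gens \<Gamma>" using cons.prems by auto
  have "\<forall>\<^sub>F n in at_top. level (src \<Gamma> \<mu>) \<le> n" by (rule eventually_ge_at_top_vec)
  then have "\<forall>\<^sub>F n in at_top. kp_cong \<Gamma> (Poly_Mapping.single (Word [g]) (1 :: 'f)) (\<Sum>\<gamma> \<in> dom_at n [g]. ?U [g] \<gamma>)"
    by eventually_elim (use \<mu> kp_cong_Path_span kp_cong_Ghost_span in blast)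
  with cons.IH[OF gs] show ?case
  proof eventually_elim
    case (elim n)
    have fin: "finite (dom_at n [g])" by (rule finite_dom_at_single[OF g])
    have "Poly_Mapping.single (Word (g # gs)) (1::'f) = Poly_Mapping.single (Word [g]) 1 * Poly_Mapping.single (Word gs) 1"
      by (simp add: mult_single plus_Word)
    also have "kp_cong \<Gamma> \<dots> ((\<Sum>\<gamma> \<in> dom_at n [g]. ?U [g] \<gamma>) * (\<Sum>\<beta> \<in> dom_at n gs. ?U gs \<beta>))"
      by (rule kp_cong_mult[OF elim(2,1)])
    also have "\<dots> = (\<Sum>\<gamma> \<in> dom_at n [g]. \<Sum>\<beta> \<in> dom_at n gs. ?U [g] \<gamma> * ?U gs \<beta>)"
      by (rule sum_product)
    also have "\<dots> = (\<Sum>\<beta> \<in> dom_at n gs. \<Sum>\<gamma> \<in> dom_at n [g]. ?U [g] \<gamma> * ?U gs \<beta>)"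
      by (rule sum.swap)
    also have "kp_cong \<Gamma> \<dots> (\<Sum>\<beta> \<in> dom_at n gs. \<Sum>\<gamma> \<in> dom_at n [g].
        if \<gamma> = the (act_list gs \<beta>) then path (the (act_list [g] \<gamma>)) * ghost \<beta> else 0)"
    proof (intro kp_cong_sum kp_cong_unit_mult)
      fix \<beta> \<gamma> assume "\<beta> \<in> dom_at n gs" "\<gamma> \<in> dom_at n [g]"
      from this[THEN dom_at_paths(1)] this[THEN dom_at_paths(2)] this[THEN dom_at_paths(3)]
      show "\<gamma> \<in> paths_to n" "the (act_list gs \<beta>) \<in> paths_to n" "\<beta> \<in> paths \<Gamma>"
        "the (act_list [g] \<gamma>) \<in> paths \<Gamma>" "src \<Gamma> (the (act_list [g] \<gamma>)) = src \<Gamma> \<gamma>"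
        by (auto simp: paths_to_def)
    qed
    \<comment> \<open>The image of \<open>\<beta>\<close> under \<open>gs\<close> is the only
      \<open>\<gamma>\<close> that survives; if \<open>g\<close> is undefined there, the term for
      \<open>\<beta>\<close> disappears.\<close>
    also have "\<dots> = (\<Sum>\<beta> \<in> dom_at n gs. if the (act_list gs \<beta>) \<in> dom_at n [g]
        then path (the (act_list [g] (the (act_list gs \<beta>)))) * ghost \<beta> else 0)"
      using fin by (simp add: sum.delta' cong: if_cong)
    also have "\<dots> = (\<Sum>\<beta> \<in> dom_at n (g # gs). ?U (g # gs) \<beta>)"
    proof (rule sum.mono_neutral_cong_right)
      show "finite (dom_at n gs)" by (rule finite_dom_at[OF cons.hyps gs])
      show "dom_at n (g # gs) \<subseteq> dom_at n gs"
        by (auto simp: dom_at_def split: bind_splits)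
      show "\<forall>\<beta> \<in> dom_at n gs - dom_at n (g # gs). (if the (act_list gs \<beta>) \<in> dom_at n [g]
        then path (the (act_list [g] (the (act_list gs \<beta>)))) * ghost \<beta> else 0) = 0"
        by (auto simp: dom_at_def)
      show "(if the (act_list gs \<beta>) \<in> dom_at n [g]
        then path (the (act_list [g] (the (act_list gs \<beta>)))) * ghost \<beta> else 0) = ?U (g # gs) \<beta>"
        if "\<beta> \<in> dom_at n (g # gs)" for \<beta>
      proof -
        have "\<beta> \<in> dom_at n gs" using that by (auto simp: dom_at_def split: bind_splits)
        from dom_at_paths[OF this] that have "the (act_list gs \<beta>) \<in> dom_at n [g]"
          by (auto simp: dom_at_def split: bind_splits)
        then show ?thesis using dom_at_paths(4)[OF \<open>\<beta> \<in> dom_at n gs\<close>]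
          by (metis act_list.simps bind.bind_lunit)
      qed
    qed
    finally show ?case .
  qed
qed

text \<open>Row and column indices share one set, since an idempotent has to become a square
  matrix.\<close>

definition supp_at :: "int ^ 'k \<Rightarrow> ('a kp_gen word \<Rightarrow>\<^sub>0 'f::field) \<Rightarrow> 'a set" where
  "supp_at n p = (\<Union>w \<in> Poly_Mapping.keys p. dom_at n (letters w) \<union> (\<lambda>\<beta>. the (act w \<beta>)) ` dom_at n (letters w))"

lemma nonconst_keys:
  assumes "p \<in> kp_polys_nonconst \<Gamma>" "w \<in> Poly_Mapping.keys p"
  shows "letters w \<noteq> []" "set (letters w) \<subseteq> kp_gens \<Gamma>"
proof -
  have "w \<noteq> 0" using assms by (auto simp: poly_over_nonconst_def in_keys_iff)
  then show "letters w \<noteq> []" by (simp add: word_eq_0_iff)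
  show "set (letters w) \<subseteq> kp_gens \<Gamma>" using assms by (auto simp: poly_over_nonconst_def poly_over_def)
qed

lemma finite_supp_at: "p \<in> kp_polys_nonconst \<Gamma> \<Longrightarrow> finite (supp_at n p)"
  by (auto simp: supp_at_def intro!: finite_dom_at dest: nonconst_keys)

lemma supp_at_paths_to: "supp_at n p \<subseteq> paths_to n"
  using dom_at_paths(1,2) by (force simp: supp_at_def)

lemma entry_supp_at:
  assumes "entry p \<alpha> \<beta> \<noteq> 0" "\<beta> \<in> paths_to n"
  shows "\<alpha> \<in> supp_at n p" "\<beta> \<in> supp_at n p"
proof -
  obtain w where w: "w \<in> Poly_Mapping.keys p" "act w \<beta> = Some \<alpha>" using assms(1) by (rule entry_neq_0E)
  then have "\<beta> \<in> dom_at n (letters w)" using assms(2) by (simp add: dom_at_def)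
  with w show "\<beta> \<in> supp_at n p" "\<alpha> \<in> supp_at n p" by (auto simp: supp_at_def intro!: bexI[of _ w] image_eqI)
qed

text \<open>The freedom in \<open>Q\<close> allows all entries of a matrix over the algebra to be
  expanded over a common index set. Columns are cut to level n because \<open>Q\<close> may contain
  paths of other levels, where \<open>p\<close> can have further nonzero entries.\<close>

lemma kp_cong_span:
  fixes p :: "'a kp_gen word \<Rightarrow>\<^sub>0 'f::field"
  assumes p: "p \<in> kp_polys_nonconst \<Gamma>"
  shows "\<forall>\<^sub>F n in at_top. \<forall>Q. finite Q \<longrightarrow> supp_at n p \<subseteq> Q \<longrightarrow>
    kp_cong \<Gamma> p (\<Sum>\<alpha> \<in> Q. \<Sum>\<beta> \<in> Q \<inter> paths_to n. Poly_Mapping.single (Word [Path \<alpha>, Ghost \<beta>]) (entry p \<alpha> \<beta>))"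
proof -
  let ?S = "\<lambda>\<alpha> \<beta> c. Poly_Mapping.single (Word [Path \<alpha>, Ghost \<beta>]) c :: 'a kp_gen word \<Rightarrow>\<^sub>0 'f"
  have "\<forall>\<^sub>F n in at_top. kp_cong \<Gamma> (Poly_Mapping.single (Word (letters w)) (1 :: 'f))
      (\<Sum>\<beta> \<in> dom_at n (letters w). path (the (act w \<beta>)) * ghost \<beta>)" if "w \<in> Poly_Mapping.keys p" for w
    using nonconst_keys[OF p that] by (rule kp_cong_word_span)
  then have "\<forall>\<^sub>F n in at_top. \<forall>w \<in> Poly_Mapping.keys p. kp_cong \<Gamma> (Poly_Mapping.single (Word (letters w)) (1 :: 'f))
      (\<Sum>\<beta> \<in> dom_at n (letters w). path (the (act w \<beta>)) * ghost \<beta>)"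
    by (intro eventually_ball_finite) auto
  then show ?thesis
  proof eventually_elim
    case (elim n)
    show ?case
    proof (intro allI impI)
      fix Q assume Q: "finite Q" "supp_at n p \<subseteq> Q"
      let ?c = "Poly_Mapping.lookup p"
      \<comment> \<open>Scalars are written as multiples of the empty word, so that multiplying by
        them preserves congruence.\<close>
      have "p = (\<Sum>w \<in> Poly_Mapping.keys p. Poly_Mapping.single 0 (?c w) * Poly_Mapping.single (Word (letters w)) 1)"
        by (simp add: mult_single sum_single_keys)
      also have "kp_cong \<Gamma> \<dots> (\<Sum>w \<in> Poly_Mapping.keys p. Poly_Mapping.single 0 (?c w) *
          (\<Sum>\<beta> \<in> dom_at n (letters w). path (the (act w \<beta>)) * ghost \<beta>))"
        using elim by (intro kp_cong_sum kp_cong_mult kp_cong_refl) (auto intro: poly_over_single)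
      also have "\<dots> = (\<Sum>w \<in> Poly_Mapping.keys p. \<Sum>\<beta> \<in> dom_at n (letters w). ?S (the (act w \<beta>)) \<beta> (?c w))"
        by (simp add: sum_distrib_left mult_single plus_Word mult.assoc[symmetric])
      also have "\<dots> = (\<Sum>w \<in> Poly_Mapping.keys p. \<Sum>\<alpha> \<in> Q. \<Sum>\<beta> \<in> Q \<inter> paths_to n.
          ?S \<alpha> \<beta> (if act w \<beta> = Some \<alpha> then ?c w else 0))"
      proof (rule sum.cong[OF refl])
        fix w assume w: "w \<in> Poly_Mapping.keys p"
        have sub: "dom_at n (letters w) \<subseteq> Q \<inter> paths_to n"
          using w Q(2) dom_at_paths(1) by (fastforce simp: supp_at_def)
        have "(\<Sum>\<alpha> \<in> Q. \<Sum>\<beta> \<in> Q \<inter> paths_to n. ?S \<alpha> \<beta> (if act w \<beta> = Some \<alpha> then ?c w else 0)) =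
            (\<Sum>\<beta> \<in> Q \<inter> paths_to n. \<Sum>\<alpha> \<in> Q. ?S \<alpha> \<beta> (if act w \<beta> = Some \<alpha> then ?c w else 0))"
          by (rule sum.swap)
        also have "\<dots> = (\<Sum>\<beta> \<in> dom_at n (letters w). \<Sum>\<alpha> \<in> Q. ?S \<alpha> \<beta> (if act w \<beta> = Some \<alpha> then ?c w else 0))"
          using Q sub by (intro sum.mono_neutral_right) (auto simp: dom_at_def)
        also have "\<dots> = (\<Sum>\<beta> \<in> dom_at n (letters w). ?S (the (act w \<beta>)) \<beta> (?c w))"
        proof (rule sum.cong[OF refl])
          fix \<beta> assume \<beta>: "\<beta> \<in> dom_at n (letters w)"
          then have "the (act w \<beta>) \<in> Q" using w Q(2) by (auto simp: supp_at_def)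
          moreover have "(\<Sum>\<alpha> \<in> Q. ?S \<alpha> \<beta> (if act w \<beta> = Some \<alpha> then ?c w else 0)) =
              (\<Sum>\<alpha> \<in> Q. if \<alpha> = the (act w \<beta>) then ?S (the (act w \<beta>)) \<beta> (?c w) else 0)"
            using dom_at_paths(4)[OF \<beta>] by (intro sum.cong) auto
          ultimately show "(\<Sum>\<alpha> \<in> Q. ?S \<alpha> \<beta> (if act w \<beta> = Some \<alpha> then ?c w else 0)) = ?S (the (act w \<beta>)) \<beta> (?c w)"
            using Q(1) by simp
        qed
        finally show "(\<Sum>\<beta> \<in> dom_at n (letters w). ?S (the (act w \<beta>)) \<beta> (?c w)) =
            (\<Sum>\<alpha> \<in> Q. \<Sum>\<beta> \<in> Q \<inter> paths_to n. ?S \<alpha> \<beta> (if act w \<beta> = Some \<alpha> then ?c w else 0))" ..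
      qed
      also have "\<dots> = (\<Sum>\<alpha> \<in> Q. \<Sum>\<beta> \<in> Q \<inter> paths_to n. \<Sum>w \<in> Poly_Mapping.keys p.
          ?S \<alpha> \<beta> (if act w \<beta> = Some \<alpha> then ?c w else 0))"
        by (simp only: sum.swap[where A = "Poly_Mapping.keys p"])
      also have "\<dots> = (\<Sum>\<alpha> \<in> Q. \<Sum>\<beta> \<in> Q \<inter> paths_to n. ?S \<alpha> \<beta> (entry p \<alpha> \<beta>))"
      proof -
        have "Poly_Mapping.single k (sum f A) = (\<Sum>x \<in> A. Poly_Mapping.single k (f x))"
          for k :: "'a kp_gen word" and f :: "'a kp_gen word \<Rightarrow> 'f" and A
          by (induction A rule: infinite_finite_induct) (simp_all add: single_add)
        then show ?thesis by (simp only: entry_def)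
      qed
      finally show "kp_cong \<Gamma> p (\<Sum>\<alpha> \<in> Q. \<Sum>\<beta> \<in> Q \<inter> paths_to n. ?S \<alpha> \<beta> (entry p \<alpha> \<beta>))" .
    qed
  qed
qed

end

section \<open>Linear algebra over a field\<close>

text \<open>Gaussian elimination on the columns of \<open>Y\<close>: one intermediate index is
  removed at the cost of at most one index of \<open>S\<close>. This is the bound on the rank of an
  identity matrix that factors through \<open>T\<close>.\<close>

lemma card_le_if_right_inverse:
  fixes X :: "'s \<Rightarrow> 't \<Rightarrow> 'f::field"
  assumes "finite T" "finite S"
    and "\<And>s s'. s \<in> S \<Longrightarrow> s' \<in> S \<Longrightarrow> (\<Sum>t \<in> T. X s t * Y t s') = (if s = s' then 1 else 0)"
  shows "card S \<le> card T"
  using assms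
proof (induction T arbitrary: S Y rule: finite_induct)
  case empty
  have "S = {}" using empty(2) by fastforce
  then show ?case by simp
next
  case (insert t T)
  show ?case
  proof (cases "\<forall>s \<in> S. Y t s = 0")
    case True
    have "card S \<le> card T"
      using insert.hyps insert.prems True by (intro insert.IH[of _ Y]) auto
    then show ?thesis using insert.hyps by simp
  next
    case False
    then obtain s0 where s0: "s0 \<in> S" "Y t s0 \<noteq> 0" by auto
    \<comment> \<open>Subtracting a multiple of the pivot column \<open>s0\<close> clears row
      \<open>t\<close>. The product with \<open>X\<close> is unchanged on the remaining indices,
      since its column \<open>s0\<close> vanishes there.\<close>
    define Y' where "Y' u s = Y u s - Y u s0 * (Y t s / Y t s0)" for u s
    have "card (S - {s0}) \<le> card T"
    proof (rule insert.IH[of _ Y'])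
      fix s s' assume s: "s \<in> S - {s0}" "s' \<in> S - {s0}"
      have "(\<Sum>u \<in> insert t T. X s u * Y' u s') =
          (\<Sum>u \<in> insert t T. X s u * Y u s') - (\<Sum>u \<in> insert t T. X s u * Y u s0) * (Y t s' / Y t s0)"
        unfolding Y'_def sum_distrib_right sum_subtractf[symmetric] by (intro sum.cong) (auto simp: algebra_simps)
      also have "\<dots> = (if s = s' then 1 else 0)"
        using insert.prems(2) s s0 by auto
      finally show "(\<Sum>u \<in> T. X s u * Y' u s') = (if s = s' then 1 else 0)"
        using insert.hyps s0 by (simp add: Y'_def)
    qed (use insert.prems in auto)
    then show ?thesis using insert.hyps insert.prems(1) s0 by simp
  qed
qed

text \<open>If \<open>M i\<^sub>0 j\<^sub>0 \<noteq> 0\<close>, then the column \<open>j\<^sub>0\<close> times the row \<open>i\<^sub>0\<close>, divided by \<open>M i\<^sub>0 j\<^sub>0\<close>, is an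
  idempotent of rank one below \<open>M\<close>, and subtracting it clears the row \<open>i\<^sub>0\<close>.\<close>

lemma idempotent_rank_decomposition:
  fixes M :: "'i \<Rightarrow> 'i \<Rightarrow> 'f::field" and b :: "'i \<Rightarrow> 'b"
  assumes I: "finite I"
    and "\<And>i j. i \<in> I \<Longrightarrow> j \<in> I \<Longrightarrow> (\<Sum>l \<in> I. M i l * M l j) = M i j"
    and "\<And>i j. i \<in> I \<Longrightarrow> j \<in> I \<Longrightarrow> M i j \<noteq> 0 \<Longrightarrow> b i = b j"
  shows "\<exists>r x y w. (\<forall>i \<in> I. \<forall>j \<in> I. M i j = (\<Sum>t<(r::nat). x t i * y t j)) \<and>
    (\<forall>t<r. \<forall>t'<r. (\<Sum>i \<in> I. y t i * x t' i) = (if t = t' then 1 else 0)) \<and>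
    (\<forall>t<r. w t \<in> b ` I \<and> (\<forall>i \<in> I. (x t i \<noteq> 0 \<longrightarrow> b i = w t) \<and> (y t i \<noteq> 0 \<longrightarrow> b i = w t)))"
  using assms(2,3)
proof (induction "card {i \<in> I. \<exists>j \<in> I. M i j \<noteq> 0}" arbitrary: M rule: less_induct)
  case less
  note idem = less.prems(1) and blk = less.prems(2)
  show ?case
  proof (cases "\<forall>i \<in> I. \<forall>j \<in> I. M i j = 0")
    case True
    then show ?thesis by (intro exI[of _ 0]) simp
  next
    case False
    then obtain i0 j0 where ij: "i0 \<in> I" "j0 \<in> I" and nz: "M i0 j0 \<noteq> 0" by auto
    define x0 where "x0 i = M i j0" for i
    define y0 where "y0 j = M i0 j / M i0 j0" for j
    define F where "F i j = M i j - x0 i * y0 j" for i j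
    have My: "(\<Sum>i \<in> I. y0 i * M i j) = y0 j" if "j \<in> I" for j
      using idem[OF ij(1) that] by (simp add: y0_def sum_divide_distrib[symmetric])
    have Mx: "(\<Sum>j \<in> I. M i j * x0 j) = x0 i" if "i \<in> I" for i
      using idem[OF that ij(2)] by (simp add: x0_def)
    have yx: "(\<Sum>i \<in> I. y0 i * x0 i) = 1"
      using My[OF ij(2)] nz by (simp add: x0_def y0_def)
    have Fy: "(\<Sum>i \<in> I. y0 i * F i j) = 0" if "j \<in> I" for j
    proof -
      have "(\<Sum>i \<in> I. y0 i * F i j) = (\<Sum>i \<in> I. y0 i * M i j) - (\<Sum>i \<in> I. y0 i * x0 i) * y0 j"
        by (simp add: F_def algebra_simps sum_subtractf sum_distrib_left)
      then show ?thesis using My[OF that] yx by simp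
    qed
    have Fx: "(\<Sum>j \<in> I. F i j * x0 j) = 0" if "i \<in> I" for i
    proof -
      have "(\<Sum>j \<in> I. F i j * x0 j) = (\<Sum>j \<in> I. M i j * x0 j) - x0 i * (\<Sum>j \<in> I. y0 j * x0 j)"
        by (simp add: F_def algebra_simps sum_subtractf sum_distrib_left)
      then show ?thesis using Mx[OF that] yx by simp
    qed
    have "(\<Sum>l \<in> I. F i l * F l j) = F i j" if "i \<in> I" "j \<in> I" for i j
    proof -
      have "(\<Sum>l \<in> I. F i l * F l j) = (\<Sum>l \<in> I. F i l * M l j) - (\<Sum>l \<in> I. F i l * x0 l) * y0 j"
        by (simp add: F_def[of _ j] algebra_simps sum_subtractf sum_distrib_left)
      also have "\<dots> = (\<Sum>l \<in> I. M i l * M l j) - x0 i * (\<Sum>l \<in> I. y0 l * M l j)"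
        using Fx[OF that(1)] by (simp add: F_def algebra_simps sum_subtractf sum_distrib_left)
      also have "\<dots> = F i j" using idem[OF that] My[OF that(2)] by (simp add: F_def)
      finally show ?thesis .
    qed
    moreover have Fblk: "b i = b j" if "i \<in> I" "j \<in> I" "F i j \<noteq> 0" for i j
    proof (cases "M i j = 0")
      case True
      \<comment> \<open>The correction \<open>x0 i * y0 j\<close> is then nonzero, and the labels
        agree along \<open>i\<close>, \<open>j0\<close>, \<open>i0\<close>,
        \<open>j\<close>.\<close>
      then have "M i j0 \<noteq> 0" "M i0 j \<noteq> 0" using that(3) by (auto simp: F_def x0_def y0_def)
      then show ?thesis using blk that ij nz by metis
    qed (use blk that in auto)
    moreover have "{i \<in> I. \<exists>j \<in> I. F i j \<noteq> 0} \<subset> {i \<in> I. \<exists>j \<in> I. M i j \<noteq> 0}"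
    proof
      show "{i \<in> I. \<exists>j \<in> I. F i j \<noteq> 0} \<subseteq> {i \<in> I. \<exists>j \<in> I. M i j \<noteq> 0}"
      proof -
        \<comment> \<open>Subtraction creates no new nonzero rows: row \<open>i\<close> changes by a
          multiple of \<open>y0\<close> whose factor is the entry of \<open>M\<close> in column
          \<open>j0\<close>.\<close>
        have "M i j \<noteq> 0 \<or> M i j0 \<noteq> 0" if "F i j \<noteq> 0" for i j
          using that by (auto simp: F_def x0_def)
        then show ?thesis using ij by blast
      qed
      have "F i0 j = 0" for j using nz by (simp add: F_def x0_def y0_def)
      then show "{i \<in> I. \<exists>j \<in> I. F i j \<noteq> 0} \<noteq> {i \<in> I. \<exists>j \<in> I. M i j \<noteq> 0}"
        using ij nz by blast
    qed
    then have "card {i \<in> I. \<exists>j \<in> I. F i j \<noteq> 0} < card {i \<in> I. \<exists>j \<in> I. M i j \<noteq> 0}"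
      using I by (intro psubset_card_mono) auto
    ultimately obtain r x y w where
      F: "\<And>i j. i \<in> I \<Longrightarrow> j \<in> I \<Longrightarrow> F i j = (\<Sum>t<(r::nat). x t i * y t j)"
      and orth: "\<And>t t'. t < r \<Longrightarrow> t' < r \<Longrightarrow> (\<Sum>i \<in> I. y t i * x t' i) = (if t = t' then 1 else 0)"
      and w: "\<And>t. t < r \<Longrightarrow> w t \<in> b ` I \<and> (\<forall>i \<in> I. (x t i \<noteq> 0 \<longrightarrow> b i = w t) \<and> (y t i \<noteq> 0 \<longrightarrow> b i = w t))"
      using less.hyps[of F] by blast
    have xF: "(\<Sum>j \<in> I. F i j * x t j) = x t i" if "t < r" "i \<in> I" for t i
    proof -
      have "(\<Sum>j \<in> I. F i j * x t j) = (\<Sum>j \<in> I. \<Sum>s<r. x s i * (y s j * x t j))"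
        using that by (intro sum.cong) (simp_all add: F sum_distrib_right mult.assoc)
      also have "\<dots> = (\<Sum>s<r. x s i * (\<Sum>j \<in> I. y s j * x t j))"
        by (subst sum.swap) (simp add: sum_distrib_left)
      also have "\<dots> = (\<Sum>s<r. if s = t then x s i else 0)"
        using that by (intro sum.cong) (auto simp: orth)
      also have "\<dots> = x t i" using that by simp
      finally show ?thesis .
    qed
    have yF: "(\<Sum>i \<in> I. y t i * F i j) = y t j" if "t < r" "j \<in> I" for t j
    proof -
      have "(\<Sum>i \<in> I. y t i * F i j) = (\<Sum>i \<in> I. \<Sum>s<r. (y t i * x s i) * y s j)"
        using that by (intro sum.cong) (simp_all add: F sum_distrib_left mult.assoc)
      also have "\<dots> = (\<Sum>s<r. (\<Sum>i \<in> I. y t i * x s i) * y s j)"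
        by (subst sum.swap) (simp add: sum_distrib_right)
      also have "\<dots> = (\<Sum>s<r. if s = t then y s j else 0)"
        using that by (intro sum.cong) (auto simp: orth)
      also have "\<dots> = y t j" using that by simp
      finally show ?thesis .
    qed
    \<comment> \<open>\<open>x t\<close> is fixed by \<open>F\<close> and \<open>y0\<close>
      annihilates \<open>F\<close> from the left, so inserting \<open>F\<close> in between gives 0;
      the mirror argument yields \<open>yx0\<close>.\<close>
    have y0x: "(\<Sum>i \<in> I. y0 i * x t i) = 0" if "t < r" for t
    proof -
      have "(\<Sum>i \<in> I. y0 i * x t i) = (\<Sum>i \<in> I. \<Sum>j \<in> I. y0 i * F i j * x t j)"
      proof (rule sum.cong[OF refl])
        fix i assume "i \<in> I"
        from xF[OF that this] show "y0 i * x t i = (\<Sum>j \<in> I. y0 i * F i j * x t j)"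
          by (simp add: mult.assoc sum_distrib_left[symmetric])
      qed
      also have "\<dots> = (\<Sum>j \<in> I. (\<Sum>i \<in> I. y0 i * F i j) * x t j)"
        by (subst sum.swap) (simp add: sum_distrib_right)
      finally show ?thesis by (simp add: Fy)
    qed
    have yx0: "(\<Sum>i \<in> I. y t i * x0 i) = 0" if "t < r" for t
    proof -
      have "(\<Sum>j \<in> I. y t j * x0 j) = (\<Sum>j \<in> I. \<Sum>i \<in> I. y t i * F i j * x0 j)"
      proof (rule sum.cong[OF refl])
        fix j assume "j \<in> I"
        from yF[OF that this] show "y t j * x0 j = (\<Sum>i \<in> I. y t i * F i j * x0 j)"
          by (simp add: sum_distrib_right[symmetric])
      qed
      also have "\<dots> = (\<Sum>i \<in> I. y t i * (\<Sum>j \<in> I. F i j * x0 j))"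
        by (subst sum.swap) (simp add: sum_distrib_left mult.assoc)
      finally show ?thesis by (simp add: Fx)
    qed
    define x' where "x' = x(r := x0)"
    define y' where "y' = y(r := y0)"
    \<comment> \<open>Column \<open>j0\<close> is supported on indices labelled \<open>b j0\<close>;
      so is row \<open>i0\<close>, because \<open>M i0 j0 \<noteq> 0\<close> gives
      \<open>b i0 = b j0\<close>.\<close>
    define w' where "w' = w(r := b j0)"
    have "M i j = (\<Sum>t<Suc r. x' t i * y' t j)" if "i \<in> I" "j \<in> I" for i j
      using F[OF that] by (simp add: x'_def y'_def F_def algebra_simps)
    moreover have "(\<Sum>i \<in> I. y' t i * x' t' i) = (if t = t' then 1 else 0)" if "t < Suc r" "t' < Suc r" for t t'
      using that orth y0x yx0 yx by (auto simp: x'_def y'_def less_Suc_eq)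
    moreover have "w' t \<in> b ` I \<and> (\<forall>i \<in> I. (x' t i \<noteq> 0 \<longrightarrow> b i = w' t) \<and> (y' t i \<noteq> 0 \<longrightarrow> b i = w' t))"
      if "t < Suc r" for t
    proof (cases "t = r")
      case True
      have row: "b i = b j0" if "i \<in> I" "M i0 i \<noteq> 0" for i
        using blk[of i0 i] blk[of i0 j0] ij nz that by simp
      have col: "b i = b j0" if "i \<in> I" "M i j0 \<noteq> 0" for i
        using blk[of i j0] ij that by simp
      have "w' t = b j0" "x' t = x0" "y' t = y0"
        using True by (simp_all add: w'_def x'_def y'_def)
      then show ?thesis using ij(2) by (auto simp: x0_def y0_def intro: row col)
    next
      case False
      then show ?thesis using that w[of t] by (simp add: x'_def y'_def w'_def)
    qed
    ultimately show ?thesis by blast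
  qed
qed

section \<open>Matrices over the Kumjian--Pask algebra\<close>

context is_kgraph
begin

lemma kumjian_pask_simps:
  fixes K :: "'f::field itself"
  shows "carrier (kumjian_pask K \<Lambda>) = kp_class \<Lambda> ` kp_polys_nonconst \<Lambda>"
    and "\<zero>\<^bsub>kumjian_pask K \<Lambda>\<^esub> = kp_class \<Lambda> 0"
    and "p \<in> kp_polys \<Lambda> \<Longrightarrow> q \<in> kp_polys \<Lambda> \<Longrightarrow>
      kp_class \<Lambda> p \<oplus>\<^bsub>kumjian_pask K \<Lambda>\<^esub> kp_class \<Lambda> q = kp_class \<Lambda> (p + q)"
    and "p \<in> kp_polys \<Lambda> \<Longrightarrow> q \<in> kp_polys \<Lambda> \<Longrightarrow>
      kp_class \<Lambda> p \<otimes>\<^bsub>kumjian_pask K \<Lambda>\<^esub> kp_class \<Lambda> q = kp_class \<Lambda> (p * q)"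
proof -
  show "carrier (kumjian_pask K \<Lambda>) = kp_class \<Lambda> ` kp_polys_nonconst \<Lambda>"
    by (auto simp: kumjian_pask_def kp_free_eq poly_over_nonconst_def)
  have "kp_ideal \<Lambda> = a_r_coset (kp_free \<Lambda>) (kp_ideal \<Lambda>) (0 :: 'a kp_gen word \<Rightarrow>\<^sub>0 'f)"
    by (rule ring.a_rcos_zero[symmetric, OF _ ideal_kp_ideal kp_ideal_zero])
      (simp add: kp_free_eq ring_free_algebra)
  then show "\<zero>\<^bsub>kumjian_pask K \<Lambda>\<^esub> = kp_class \<Lambda> 0"
    by (simp add: kumjian_pask_def FactRing_def kp_class_def)
qed (simp_all add: kumjian_pask_def FactRing_def kp_class_add kp_class_mult)

lemma kp_class_eqI: "kp_cong \<Lambda> p q \<Longrightarrow> kp_class \<Lambda> p = kp_class \<Lambda> q"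
  using kp_class_eq_iff[of p q] by (auto simp: kp_cong_def)

text \<open>Only the additive monoid is recorded: it is what \<open>finsum\<close> works over, and
  the field \<open>one\<close> may lie outside the carrier.\<close>

lemma abelian_monoid_kumjian_pask: "abelian_monoid (kumjian_pask K \<Lambda>)"
  by (rule abelian_monoidI)
    (auto simp: kumjian_pask_simps poly_over_nonconstD poly_over_add add_ac nonconst_add)

lemma finsum_kp_class:
  assumes "finite S" "\<And>i. i \<in> S \<Longrightarrow> f i \<in> kp_polys_nonconst \<Lambda>"
  shows "(\<Oplus>\<^bsub>kumjian_pask K \<Lambda>\<^esub> i \<in> S. kp_class \<Lambda> (f i)) = kp_class \<Lambda> (sum f S)"
proof -
  interpret abelian_monoid "kumjian_pask K \<Lambda>" by (rule abelian_monoid_kumjian_pask)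
  show ?thesis using assms
  proof (induction S rule: finite_induct)
    case empty
    then show ?case by (simp add: kumjian_pask_simps)
  next
    case (insert i S)
    then have "(\<Oplus>\<^bsub>kumjian_pask K \<Lambda>\<^esub> i \<in> insert i S. kp_class \<Lambda> (f i)) =
        kp_class \<Lambda> (f i) \<oplus>\<^bsub>kumjian_pask K \<Lambda>\<^esub> kp_class \<Lambda> (sum f S)"
      by (subst finsum_insert) (auto simp: kumjian_pask_simps)
    then show ?case using insert
      by (simp add: kumjian_pask_simps poly_over_nonconstD poly_over_sum)
  qed
qed

text \<open>Matrices over the quotient are handled through polynomial representatives that are
  literally zero, not merely congruent to zero, outside the N by N corner; products then become sums
  over \<open>l < N\<close>.\<close>

definition poly_mat :: "nat \<Rightarrow> (nat \<Rightarrow> nat \<Rightarrow> 'a kp_gen word \<Rightarrow>\<^sub>0 'f::field) \<Rightarrow> bool" where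
  "poly_mat N X \<longleftrightarrow> (\<forall>i j. X i j \<in> kp_polys_nonconst \<Lambda> \<and> (X i j \<noteq> 0 \<longrightarrow> i < N \<and> j < N))"

definition class_mat :: "(nat \<Rightarrow> nat \<Rightarrow> 'a kp_gen word \<Rightarrow>\<^sub>0 'f::field) \<Rightarrow> nat \<Rightarrow> nat \<Rightarrow> ('a kp_gen word \<Rightarrow>\<^sub>0 'f) set" where
  "class_mat X = (\<lambda>i j. kp_class \<Lambda> (X i j))"

definition poly_mat_mult :: "nat \<Rightarrow> (nat \<Rightarrow> nat \<Rightarrow> 'a kp_gen word \<Rightarrow>\<^sub>0 'f::field) \<Rightarrow>
    (nat \<Rightarrow> nat \<Rightarrow> 'a kp_gen word \<Rightarrow>\<^sub>0 'f) \<Rightarrow> nat \<Rightarrow> nat \<Rightarrow> 'a kp_gen word \<Rightarrow>\<^sub>0 'f" where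
  "poly_mat_mult N X Y = (\<lambda>i j. \<Sum>l<N. X i l * Y l j)"

lemma poly_mat_mono: "poly_mat M X \<Longrightarrow> M \<le> N \<Longrightarrow> poly_mat N X"
  by (force simp: poly_mat_def)

lemma poly_matD: "poly_mat N X \<Longrightarrow> X i j \<in> kp_polys_nonconst \<Lambda>" "poly_mat N X \<Longrightarrow> X i j \<in> kp_polys \<Lambda>"
  by (auto simp: poly_mat_def poly_over_nonconstD)

lemma poly_mat_zero: "poly_mat N X \<Longrightarrow> N \<le> i \<or> N \<le> j \<Longrightarrow> X i j = 0"
  by (metis poly_mat_def not_le)

lemma poly_mat_mult: "poly_mat N X \<Longrightarrow> poly_mat N Y \<Longrightarrow> poly_mat N (poly_mat_mult N X Y)"
  unfolding poly_mat_def[of N "poly_mat_mult N X Y"]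
proof (intro allI conjI impI)
  fix i j assume X: "poly_mat N X" and Y: "poly_mat N Y"
  show "poly_mat_mult N X Y i j \<in> kp_polys_nonconst \<Lambda>"
    using X Y unfolding poly_mat_mult_def by (intro nonconst_sum nonconst_mult poly_matD)
  assume nz: "poly_mat_mult N X Y i j \<noteq> 0"
  show "i < N"
    using nz poly_mat_zero[OF X, of i] by (cases "i < N") (auto simp: poly_mat_mult_def)
  show "j < N"
    using nz poly_mat_zero[OF Y, of _ j] by (cases "j < N") (auto simp: poly_mat_mult_def)
qed

lemma class_mat_eq_iff:
  assumes "poly_mat N X" "poly_mat N Y"
  shows "class_mat X = class_mat Y \<longleftrightarrow> (\<forall>i<N. \<forall>j<N. kp_cong \<Lambda> (X i j) (Y i j))"
proof -
  have "class_mat X = class_mat Y \<longleftrightarrow> (\<forall>i j. kp_cong \<Lambda> (X i j) (Y i j))"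
    using poly_matD[OF assms(1)] poly_matD[OF assms(2)]
    by (simp add: class_mat_def fun_eq_iff kp_class_eq_iff)
  also have "\<dots> \<longleftrightarrow> (\<forall>i<N. \<forall>j<N. kp_cong \<Lambda> (X i j) (Y i j))"
    using poly_mat_zero[OF assms(1)] poly_mat_zero[OF assms(2)]
    by (metis kp_cong_refl not_le poly_over_0)
  finally show ?thesis .
qed

lemma class_mat_nonzero:
  "poly_mat N X \<Longrightarrow> class_mat X i j \<noteq> kp_class \<Lambda> 0 \<Longrightarrow> i < N \<and> j < N"
  by (cases "X i j = 0") (auto simp: class_mat_def poly_mat_def)

lemma class_mat_Minf:
  fixes X :: "nat \<Rightarrow> nat \<Rightarrow> 'a kp_gen word \<Rightarrow>\<^sub>0 'f::field" and K :: "'f itself"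
  assumes "poly_mat N X"
  shows "class_mat X \<in> Minf (kumjian_pask K \<Lambda>)"
proof -
  have "{(i, j). class_mat X i j \<noteq> kp_class \<Lambda> 0} \<subseteq> {..<N} \<times> {..<N}"
    using class_mat_nonzero[OF assms] by auto
  then have "finite {(i, j). class_mat X i j \<noteq> kp_class \<Lambda> 0}"
    by (rule finite_subset) simp
  moreover have "class_mat X i j \<in> kp_class \<Lambda> ` kp_polys_nonconst \<Lambda>" for i j
    unfolding class_mat_def by (rule imageI) (rule poly_matD(1)[OF assms])
  ultimately show ?thesis unfolding Minf_def kumjian_pask_simps by blast
qed

text \<open>The zero class is represented by the polynomial 0, so that bounds on the support of a
  matrix pass to its representative; this is used when blocks are cut out.\<close>

lemma Minf_class_mat:
  fixes K :: "'f::field itself"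
  assumes "x \<in> Minf (kumjian_pask K \<Lambda>)"
  obtains N and X :: "nat \<Rightarrow> nat \<Rightarrow> 'a kp_gen word \<Rightarrow>\<^sub>0 'f" where "poly_mat N X" "x = class_mat X"
    "\<forall>i j. x i j = kp_class \<Lambda> 0 \<longrightarrow> X i j = 0"
proof -
  have "\<forall>i j. \<exists>p. p \<in> kp_polys_nonconst \<Lambda> \<and> x i j = kp_class \<Lambda> p \<and> (x i j = kp_class \<Lambda> 0 \<longrightarrow> p = 0)"
  proof (intro allI)
    fix i j
    have "x i j \<in> kp_class \<Lambda> ` kp_polys_nonconst \<Lambda>"
      using assms by (auto simp: Minf_def kumjian_pask_simps)
    then show "\<exists>p. p \<in> kp_polys_nonconst \<Lambda> \<and> x i j = kp_class \<Lambda> p \<and> (x i j = kp_class \<Lambda> 0 \<longrightarrow> p = 0)"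
      by (cases "x i j = kp_class \<Lambda> 0") auto
  qed
  then obtain X where X: "\<And>i j. X i j \<in> kp_polys_nonconst \<Lambda>" "\<And>i j. x i j = kp_class \<Lambda> (X i j)"
    "\<And>i j. x i j = kp_class \<Lambda> 0 \<Longrightarrow> X i j = 0" by metis
  let ?S = "{(i, j). x i j \<noteq> kp_class \<Lambda> 0}"
  have "finite (fst ` ?S \<union> snd ` ?S)" using assms by (simp add: Minf_def kumjian_pask_simps)
  then obtain N where N: "\<forall>k \<in> fst ` ?S \<union> snd ` ?S. k < N"
    using finite_nat_set_iff_bounded by auto
  have "poly_mat N X"
    unfolding poly_mat_def
  proof (intro allI conjI impI X(1))
    fix i j assume "X i j \<noteq> 0"
    then have "(i, j) \<in> ?S" using X(3) by auto
    then have "fst (i, j) \<in> fst ` ?S \<union> snd ` ?S" "snd (i, j) \<in> fst ` ?S \<union> snd ` ?S"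
      by (blast intro: imageI)+
    then have "fst (i, j) < N" "snd (i, j) < N" using N by blast+
    then show "i < N" "j < N" by simp_all
  qed
  moreover have "x = class_mat X" using X(2) by (simp add: class_mat_def fun_eq_iff)
  ultimately show thesis by (rule that) (simp add: X(3))
qed

text \<open>\<open>Minf_mult\<close> sums only over \<open>l\<close> with a nonzero class in row
  \<open>i\<close>. The other representatives may be nonzero polynomials, but they are congruent to
  0, so summing over all \<open>l < N\<close> gives the same class.\<close>

lemma Minf_mult_class_mat:
  fixes X Y :: "nat \<Rightarrow> nat \<Rightarrow> 'a kp_gen word \<Rightarrow>\<^sub>0 'f::field" and K :: "'f itself"
  assumes X: "poly_mat N X" and Y: "poly_mat N Y"
  shows "Minf_mult (kumjian_pask K \<Lambda>) (class_mat X) (class_mat Y) = class_mat (poly_mat_mult N X Y)"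
proof (intro ext)
  fix i j
  let ?L = "{l. class_mat X i l \<noteq> kp_class \<Lambda> 0}"
  have L: "?L \<subseteq> {..<N}" using class_mat_nonzero[OF X] by auto
  then have fin: "finite ?L" by (rule finite_subset) simp
  have "Minf_mult (kumjian_pask K \<Lambda>) (class_mat X) (class_mat Y) i j =
      (\<Oplus>\<^bsub>kumjian_pask K \<Lambda>\<^esub> l \<in> ?L. kp_class \<Lambda> (X i l * Y l j))"
    using poly_matD[OF X] poly_matD[OF Y]
    by (simp add: Minf_mult_def kumjian_pask_simps) (simp add: class_mat_def kumjian_pask_simps)
  also have "\<dots> = kp_class \<Lambda> (\<Sum>l \<in> ?L. X i l * Y l j)"
    using poly_matD[OF X] poly_matD[OF Y] fin by (intro finsum_kp_class nonconst_mult)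
  also have "\<dots> = kp_class \<Lambda> (\<Sum>l<N. if l \<in> ?L then X i l * Y l j else 0)"
    using L by (intro arg_cong[of _ _ "kp_class \<Lambda>"] sum.mono_neutral_cong_left) auto
  also have "\<dots> = kp_class \<Lambda> (\<Sum>l<N. X i l * Y l j)"
  proof (intro kp_class_eqI kp_cong_sum)
    fix l
    have "kp_cong \<Lambda> (0 * Y l j) (X i l * Y l j)" if "l \<notin> ?L"
    proof (rule kp_cong_mult)
      show "kp_cong \<Lambda> 0 (X i l)" using that poly_matD[OF X] by (simp add: class_mat_def kp_class_eq_iff[symmetric])
      show "kp_cong \<Lambda> (Y l j) (Y l j)" using poly_matD[OF Y] by (simp add: kp_cong_refl)
    qed
    moreover have "X i l * Y l j \<in> kp_polys \<Lambda>"
      using poly_matD[OF X] poly_matD[OF Y] by (simp add: poly_over_mult)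
    ultimately show "kp_cong \<Lambda> (if l \<in> ?L then X i l * Y l j else 0) (X i l * Y l j)"
      by (auto simp: kp_cong_refl)
  qed
  finally show "Minf_mult (kumjian_pask K \<Lambda>) (class_mat X) (class_mat Y) i j = class_mat (poly_mat_mult N X Y) i j"
    by (simp add: class_mat_def poly_mat_mult_def)
qed

lemma poly_mat_mult_assoc:
  "poly_mat_mult N (poly_mat_mult N X Y) Z = poly_mat_mult N X (poly_mat_mult N Y Z)"
proof (intro ext)
  fix i j
  have "poly_mat_mult N (poly_mat_mult N X Y) Z i j = (\<Sum>l<N. \<Sum>m<N. X i m * Y m l * Z l j)"
    by (simp add: poly_mat_mult_def sum_distrib_right)
  also have "\<dots> = (\<Sum>m<N. \<Sum>l<N. X i m * Y m l * Z l j)" by (rule sum.swap)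
  also have "\<dots> = poly_mat_mult N X (poly_mat_mult N Y Z) i j"
    by (simp add: poly_mat_mult_def sum_distrib_left mult.assoc)
  finally show "poly_mat_mult N (poly_mat_mult N X Y) Z i j = poly_mat_mult N X (poly_mat_mult N Y Z) i j" .
qed

lemma Minf_mult_closed:
  assumes "x \<in> Minf (kumjian_pask K \<Lambda>)" "y \<in> Minf (kumjian_pask K \<Lambda>)"
  shows "Minf_mult (kumjian_pask K \<Lambda>) x y \<in> Minf (kumjian_pask K \<Lambda>)"
proof -
  obtain M X where X: "poly_mat M X" "x = class_mat X" using assms(1) by (rule Minf_class_mat)
  obtain N Y where Y: "poly_mat N Y" "y = class_mat Y" using assms(2) by (rule Minf_class_mat)
  have *: "poly_mat (max M N) X" "poly_mat (max M N) Y"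
    using X Y by (auto intro: poly_mat_mono)
  show ?thesis unfolding X(2) Y(2) Minf_mult_class_mat[OF *]
    by (rule class_mat_Minf[OF poly_mat_mult[OF *]])
qed

lemma Minf_mult_assoc:
  assumes "x \<in> Minf (kumjian_pask K \<Lambda>)" "y \<in> Minf (kumjian_pask K \<Lambda>)" "z \<in> Minf (kumjian_pask K \<Lambda>)"
  shows "Minf_mult (kumjian_pask K \<Lambda>) (Minf_mult (kumjian_pask K \<Lambda>) x y) z =
    Minf_mult (kumjian_pask K \<Lambda>) x (Minf_mult (kumjian_pask K \<Lambda>) y z)"
proof -
  obtain L X where X: "poly_mat L X" "x = class_mat X" using assms(1) by (rule Minf_class_mat)
  obtain M Y where Y: "poly_mat M Y" "y = class_mat Y" using assms(2) by (rule Minf_class_mat)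
  obtain N Z where Z: "poly_mat N Z" "z = class_mat Z" using assms(3) by (rule Minf_class_mat)
  have *: "poly_mat (L + M + N) X" "poly_mat (L + M + N) Y" "poly_mat (L + M + N) Z"
    using X Y Z by (auto intro: poly_mat_mono)
  show ?thesis unfolding X(2) Y(2) Z(2)
    by (simp add: Minf_mult_class_mat[OF *(1,2)] Minf_mult_class_mat[OF *(2,3)]
        Minf_mult_class_mat[OF poly_mat_mult[OF *(1,2)] *(3)]
        Minf_mult_class_mat[OF *(1) poly_mat_mult[OF *(2,3)]] poly_mat_mult_assoc)
qed

end

section \<open>Equivalence of idempotents without a unit\<close>

locale nonunital_matrices =
  fixes B :: "('b, 'm) ring_scheme"
  assumes mult_closed: "x \<in> Minf B \<Longrightarrow> y \<in> Minf B \<Longrightarrow> Minf_mult B x y \<in> Minf B"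
    and mult_assoc: "x \<in> Minf B \<Longrightarrow> y \<in> Minf B \<Longrightarrow> z \<in> Minf B \<Longrightarrow>
      Minf_mult B (Minf_mult B x y) z = Minf_mult B x (Minf_mult B y z)"
begin

abbreviation mmul (infixl "\<odot>" 70) where "x \<odot> y \<equiv> Minf_mult B x y"

text \<open>The witnesses \<open>x\<close>, \<open>y\<close> can be cut down to \<open>e x f\<close> and \<open>f y e\<close>.\<close>

lemma idem_relE:
  assumes "(e, f) \<in> idem_rel B"
  obtains x y where "x \<in> Minf B" "y \<in> Minf B" "e = x \<odot> y" "f = y \<odot> x"
    "e \<odot> x = x" "x \<odot> f = x" "f \<odot> y = y" "y \<odot> e = y"
proof -
  obtain x y where xy: "x \<in> Minf B" "y \<in> Minf B" "e = x \<odot> y" "f = y \<odot> x"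
    and ef: "e \<in> Minf B" "f \<in> Minf B" "e \<odot> e = e" "f \<odot> f = f"
    using assms by (auto simp: idem_rel_def Minf_idem_def)
  note a = mult_assoc mult_closed xy(1,2) ef(1,2)
  have ex: "e \<odot> x = x \<odot> f" "f \<odot> y = y \<odot> e" unfolding xy(3,4) by (simp_all add: a)
  show thesis
  proof (rule that[of "e \<odot> x" "f \<odot> y"])
    have "(e \<odot> x) \<odot> (f \<odot> y) = e \<odot> (x \<odot> (y \<odot> e))" by (simp add: a ex(2))
    also have "\<dots> = e \<odot> ((x \<odot> y) \<odot> e)" by (simp only: mult_assoc[OF xy(1,2) ef(1)])
    also have "\<dots> = e" unfolding xy(3)[symmetric] by (simp add: ef)
    finally show "e = (e \<odot> x) \<odot> (f \<odot> y)" ..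
    have "(f \<odot> y) \<odot> (e \<odot> x) = f \<odot> (y \<odot> (x \<odot> f))" by (simp add: a ex(1)[symmetric])
    also have "\<dots> = f \<odot> ((y \<odot> x) \<odot> f)" by (simp only: mult_assoc[OF xy(2,1) ef(2)])
    also have "\<dots> = f" unfolding xy(4)[symmetric] by (simp add: ef)
    finally show "f = (f \<odot> y) \<odot> (e \<odot> x)" ..
    show "e \<odot> (e \<odot> x) = e \<odot> x" "f \<odot> (f \<odot> y) = f \<odot> y"
      by (simp_all add: mult_assoc[symmetric] a(3-) ef)
    have "(e \<odot> x) \<odot> f = (x \<odot> f) \<odot> f" by (simp only: ex)
    then show "(e \<odot> x) \<odot> f = e \<odot> x" by (simp add: a(1,3-) ef ex)
    have "(f \<odot> y) \<odot> e = (y \<odot> e) \<odot> e" by (simp only: ex)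
    then show "(f \<odot> y) \<odot> e = f \<odot> y" by (simp add: a(1,3-) ef ex)
  qed (simp_all add: a(2-))
qed

lemma idem_rel_refl: "e \<in> Minf_idem B \<Longrightarrow> (e, e) \<in> idem_rel B"
  unfolding idem_rel_def Minf_idem_def by force

lemma idem_rel_sym: "(e, f) \<in> idem_rel B \<Longrightarrow> (f, e) \<in> idem_rel B"
  by (auto simp: idem_rel_def)

text \<open>With witnesses that are cut down, the idempotent in the middle is absorbed:
  \<open>(x z)(w y) = x f y = x y = e\<close>.\<close>

lemma idem_rel_trans:
  assumes "(e, f) \<in> idem_rel B" "(f, g) \<in> idem_rel B"
  shows "(e, g) \<in> idem_rel B"
proof -
  obtain x y where xy: "x \<in> Minf B" "y \<in> Minf B" "e = x \<odot> y" "f = y \<odot> x" "x \<odot> f = x" "f \<odot> y = y"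
    using assms(1) by (rule idem_relE)
  obtain z w where zw: "z \<in> Minf B" "w \<in> Minf B" "f = z \<odot> w" "g = w \<odot> z" "f \<odot> z = z" "w \<odot> f = w"
    using assms(2) by (rule idem_relE)
  have "(x \<odot> z) \<odot> (w \<odot> y) = x \<odot> ((z \<odot> w) \<odot> y)"
    by (simp only: mult_assoc mult_closed xy(1,2) zw(1,2))
  also have "\<dots> = e" using xy by (simp add: zw(3)[symmetric])
  finally have e: "e = (x \<odot> z) \<odot> (w \<odot> y)" ..
  have "(w \<odot> y) \<odot> (x \<odot> z) = w \<odot> ((y \<odot> x) \<odot> z)"
    by (simp only: mult_assoc mult_closed xy(1,2) zw(1,2))
  also have "\<dots> = g" using zw by (simp add: xy(4)[symmetric])
  finally have g: "g = (w \<odot> y) \<odot> (x \<odot> z)" ..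
  have "x \<odot> z \<in> Minf B" "w \<odot> y \<in> Minf B" using mult_closed xy zw by auto
  then show ?thesis using e g assms by (auto simp: idem_rel_def)
qed

lemma equiv_idem_rel: "equiv (Minf_idem B) (idem_rel B)"
proof (rule equivI)
  show "idem_rel B \<subseteq> Minf_idem B \<times> Minf_idem B"
    by (auto simp: idem_rel_def)
  show "refl_on (Minf_idem B) (idem_rel B)"
    using idem_rel_refl by (rule refl_onI)
  show "sym (idem_rel B)"
    using idem_rel_sym by (rule symI)
  show "trans (idem_rel B)"
    using idem_rel_trans by (rule transI)
qed

end

lemma (in is_kgraph) nonunital_matrices_kumjian_pask: "nonunital_matrices (kumjian_pask K \<Lambda>)"
  by (simp add: nonunital_matrices_def Minf_mult_closed Minf_mult_assoc)

section \<open>Idempotents and vertices\<close>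

context is_kgraph
begin

lemma idem_rel_class_matI:
  fixes X Y :: "nat \<Rightarrow> nat \<Rightarrow> 'a kp_gen word \<Rightarrow>\<^sub>0 'f::field" and K :: "'f itself"
  assumes "poly_mat N X" "poly_mat N Y" "poly_mat N E" "poly_mat N F"
    and "\<And>i j. i < N \<Longrightarrow> j < N \<Longrightarrow> kp_cong \<Lambda> (poly_mat_mult N X Y i j) (E i j)"
    and "\<And>i j. i < N \<Longrightarrow> j < N \<Longrightarrow> kp_cong \<Lambda> (poly_mat_mult N Y X i j) (F i j)"
    and "class_mat E \<in> Minf_idem (kumjian_pask K \<Lambda>)" "class_mat F \<in> Minf_idem (kumjian_pask K \<Lambda>)"
  shows "(class_mat E, class_mat F) \<in> idem_rel (kumjian_pask K \<Lambda>)"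
proof -
  have "class_mat E = Minf_mult (kumjian_pask K \<Lambda>) (class_mat X) (class_mat Y)"
    unfolding Minf_mult_class_mat[OF assms(1,2)] class_mat_eq_iff[OF assms(3) poly_mat_mult[OF assms(1,2)]]
    using assms(5) kp_cong_sym by blast
  moreover have "class_mat F = Minf_mult (kumjian_pask K \<Lambda>) (class_mat Y) (class_mat X)"
    unfolding Minf_mult_class_mat[OF assms(2,1)] class_mat_eq_iff[OF assms(4) poly_mat_mult[OF assms(2,1)]]
    using assms(6) kp_cong_sym by blast
  ultimately show ?thesis
    using assms(7,8) class_mat_Minf[OF assms(1), of K] class_mat_Minf[OF assms(2), of K]
    unfolding idem_rel_def by blast
qed

definition diag_mat :: "'a list \<Rightarrow> nat \<Rightarrow> nat \<Rightarrow> 'a kp_gen word \<Rightarrow>\<^sub>0 'f::field" where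
  "diag_mat vs = (\<lambda>i j. if i = j \<and> i < length vs then path (vs ! i) else 0)"

lemma path_nonconst: "\<mu> \<in> paths \<Lambda> \<Longrightarrow> path \<mu> \<in> kp_polys_nonconst \<Lambda>"
  by (auto intro: nonconst_single)

lemma poly_mat_diag: "set vs \<subseteq> verts \<Lambda> \<Longrightarrow> length vs \<le> N \<Longrightarrow> poly_mat N (diag_mat vs)"
  by (auto simp: poly_mat_def diag_mat_def intro!: path_nonconst vert_path subsetD[OF _ nth_mem])

lemma sum_if_eq_and:
  fixes f :: "nat \<Rightarrow> 'c::comm_monoid_add"
  shows "(\<Sum>l<N. if l = j \<and> P l then f l else 0) = (if j < N \<and> P j then f j else 0)"
proof -
  have "(\<Sum>l<N. if l = j \<and> P l then f l else 0) = (\<Sum>l<N. if l = j then (if P j then f j else 0) else 0)"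
    by (intro sum.cong) auto
  then show ?thesis by simp
qed

lemma mult_diag_mat:
  "length vs \<le> N \<Longrightarrow> poly_mat_mult N X (diag_mat vs) i j = (if j < length vs then X i j * path (vs ! j) else 0)"
proof -
  have "poly_mat_mult N X (diag_mat vs) i j = (\<Sum>l<N. if l = j \<and> l < length vs then X i l * path (vs ! l) else 0)"
    unfolding poly_mat_mult_def diag_mat_def by (intro sum.cong) auto
  then show "length vs \<le> N \<Longrightarrow> ?thesis" by (auto simp: sum_if_eq_and)
qed

lemma diag_mat_idem:
  fixes K :: "'f::field itself"
  assumes "set vs \<subseteq> verts \<Lambda>"
  shows "class_mat (diag_mat vs) \<in> Minf_idem (kumjian_pask K \<Lambda>)"
proof -
  let ?D = "diag_mat vs :: nat \<Rightarrow> nat \<Rightarrow> 'a kp_gen word \<Rightarrow>\<^sub>0 'f"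
  have pm: "poly_mat (length vs) ?D" using assms by (rule poly_mat_diag) simp
  have "class_mat (poly_mat_mult (length vs) ?D ?D) = class_mat ?D"
    unfolding class_mat_eq_iff[OF poly_mat_mult[OF pm pm] pm]
  proof (intro allI impI)
    fix i j assume j: "i < length vs" "j < length vs"
    then have "vs ! j \<in> verts \<Lambda>" using assms by auto
    then show "kp_cong \<Lambda> (poly_mat_mult (length vs) ?D ?D i j) (?D i j)"
      using j kp_cong_verts[of "vs ! j" "vs ! j"]
      unfolding mult_diag_mat[OF order_refl] by (cases "i = j") (simp_all add: diag_mat_def kp_cong_refl)
  qed
  then show ?thesis
    unfolding Minf_idem_def by (simp add: Minf_mult_class_mat[OF pm pm] class_mat_Minf[OF pm])
qed

end

section \<open>Lists that enumerate a given multiset\<close>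

lemma map_eq_if_image_mset_eq:
  "image_mset g M = mset ws \<Longrightarrow> \<exists>L. mset L = M \<and> map g L = ws"
proof (induction ws arbitrary: M)
  case Nil
  then show ?case by simp
next
  case (Cons w ws)
  then obtain a M' where M: "M = add_mset a M'" "g a = w" "image_mset g M' = mset ws"
    using msed_map_invR[of g M w "mset ws"] by auto
  then obtain L where "mset L = M'" "map g L = ws" using Cons.IH by blast
  then show ?case using M by (intro exI[of _ "a # L"]) simp
qed

text \<open>Used to number a finite set of paths in such a way that their sources come out in the
  order prescribed by \<open>ws\<close>.\<close>

lemma enumeration_if_image_mset_set_eq:
  assumes "finite S" "image_mset g (mset_set S) = mset ws"
  obtains L where "distinct L" "set L = S" "map g L = ws"
proof -
  obtain L where L: "mset L = mset_set S" "map g L = ws"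
    using map_eq_if_image_mset_eq[OF assms(2)] by blast
  have "set L = S" using arg_cong[OF L(1), of set_mset] assms(1) by simp
  moreover have "distinct L"
    using L(1) by (metis assms(1) calculation distinct_count_atmost_1 count_mset_set(1,3))
  ultimately show thesis using L(2) that by blast
qed

context level_kgraph
begin

text \<open>The connecting map for a general level graph, with multiplicities produced by listing
  paths rather than by cardinalities.\<close>

definition push :: "nat ^ 'k \<Rightarrow> 'a multiset \<Rightarrow> 'a multiset" where
  "push d A = (\<Sum>v \<in># A. image_mset (src \<Gamma>) (mset_set (paths_from \<Gamma> v d)))"

lemma image_mset_Sigma:
  assumes "finite I" "\<And>i. i \<in> I \<Longrightarrow> finite (P i)"
  shows "image_mset (\<lambda>(i, \<mu>). g \<mu>) (mset_set (Sigma I P)) = (\<Sum>i \<in> I. image_mset g (mset_set (P i)))"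
  using assms
proof (induction I rule: finite_induct)
  case (insert i I)
  have "Sigma (insert i I) P = Pair i ` P i \<union> Sigma I P" by auto
  moreover have "Pair i ` P i \<inter> Sigma I P = {}" using insert by auto
  ultimately have "mset_set (Sigma (insert i I) P) = mset_set (Pair i ` P i) + mset_set (Sigma I P)"
    using insert by (simp add: mset_set_Union finite_SigmaI)
  also have "mset_set (Pair i ` P i) = image_mset (Pair i) (mset_set (P i))"
    by (rule image_mset_mset_set[symmetric]) (simp add: inj_on_def)
  finally show ?case using insert by (simp add: image_mset.compositionality comp_def)
qed simp

lemma push_mset:
  "push d (mset vs) = (\<Sum>i<length vs. image_mset (src \<Gamma>) (mset_set (paths_from \<Gamma> (vs ! i) d)))"
  unfolding push_def by (simp add: sum_mset_sum_list sum_list_sum_nth atLeast0LessThan flip: mset_map)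

text \<open>The equivalence is given by a matrix of paths and the transposed matrix of ghosts, whose columns
  and rows are indexed by all paths of degree \<open>d\<close> starting from the entries of \<open>vs\<close>.\<close>

lemma idem_rel_diag_push:
  fixes K :: "'f::field itself"
  assumes vs: "set vs \<subseteq> verts \<Gamma>" and ws: "mset ws = push d (mset vs)"
  shows "(class_mat (diag_mat vs), class_mat (diag_mat ws)) \<in> idem_rel (kumjian_pask K \<Gamma>)"
proof -
  let ?P = "\<lambda>i. paths_from \<Gamma> (vs ! i) d"
  let ?S = "Sigma {..<length vs} ?P"
  have v: "vs ! i \<in> verts \<Gamma>" if "i < length vs" for i using vs that by auto
  have finP: "finite (?P i)" if "i < length vs" for i using v[OF that] by (rule finite_paths_from)
  then have fin: "finite ?S" by auto
  have "image_mset (\<lambda>(i, \<mu>). src \<Gamma> \<mu>) (mset_set ?S) = mset ws"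
    unfolding ws push_mset using finP by (intro image_mset_Sigma) auto
  then obtain L where L: "distinct L" "set L = ?S" "map (\<lambda>(i, \<mu>). src \<Gamma> \<mu>) L = ws"
    using enumeration_if_image_mset_set_eq[OF fin] by metis
  have len: "length ws = length L" using L(3) by auto
  have mem: "fst (L ! t) < length vs" "snd (L ! t) \<in> paths \<Gamma>" "deg \<Gamma> (snd (L ! t)) = d"
    "src \<Gamma> (snd (L ! t)) = ws ! t" if "t < length L" for t
  proof -
    have "L ! t \<in> ?S" using L(2) that nth_mem by blast
    then show "fst (L ! t) < length vs" "snd (L ! t) \<in> paths \<Gamma>" "deg \<Gamma> (snd (L ! t)) = d"
      by (auto simp: paths_from_def)
    show "src \<Gamma> (snd (L ! t)) = ws ! t" using L(3) that by (auto simp: case_prod_beta)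
  qed
  have ws_verts: "set ws \<subseteq> verts \<Gamma>"
  proof -
    have "set ws = (\<lambda>(i, \<mu>). src \<Gamma> \<mu>) ` ?S" using L(2,3) by (metis set_map)
    then show ?thesis by (auto simp: paths_from_def src_closed)
  qed
  define N where "N = max (length vs) (length ws)"
  have N: "length vs \<le> N" "length ws \<le> N" "length L \<le> N" by (auto simp: N_def len)
  define X :: "nat \<Rightarrow> nat \<Rightarrow> 'a kp_gen word \<Rightarrow>\<^sub>0 'f" where
    "X i t = (if i = fst (L ! t) \<and> t < length L then path (snd (L ! t)) else 0)" for i t
  define Y :: "nat \<Rightarrow> nat \<Rightarrow> 'a kp_gen word \<Rightarrow>\<^sub>0 'f" where
    "Y t i = (if i = fst (L ! t) \<and> t < length L then ghost (snd (L ! t)) else 0)" for t i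
  have X: "poly_mat N X" and Y: "poly_mat N Y"
    unfolding poly_mat_def X_def Y_def using mem N
    by (auto intro!: nonconst_single intro: less_le_trans)
  \<comment> \<open>A common column index t forces both row indices to be the entry of
    \<open>vs\<close> from which the t-th path starts; what remains is the sum in (KP4) for that
    vertex.\<close>
  have XY: "kp_cong \<Gamma> (poly_mat_mult N X Y i i') (diag_mat vs i i')" if "i < N" "i' < N" for i i'
  proof -
    let ?f = "\<lambda>(k, \<mu>). if k = i \<and> i = i' then path \<mu> * ghost \<mu> else (0 :: 'a kp_gen word \<Rightarrow>\<^sub>0 'f)"
    have "poly_mat_mult N X Y i i' = (\<Sum>t<length L. X i t * Y t i')"
      unfolding poly_mat_mult_def using N by (intro sum.mono_neutral_right) (auto simp: X_def)
    also have "\<dots> = (\<Sum>t<length L. ?f (L ! t))"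
      by (intro sum.cong) (auto simp: X_def Y_def case_prod_beta)
    also have "\<dots> = (\<Sum>p \<in> ?S. ?f p)"
      using bij_betw_nth[OF L(1), of "{..<length L}" ?S] L(2) by (intro sum.reindex_bij_betw) auto
    also have "\<dots> = (\<Sum>k<length vs. \<Sum>\<mu> \<in> ?P k. ?f (k, \<mu>))"
      using finP by (subst sum.Sigma) auto
    also have "\<dots> = (\<Sum>k<length vs. if k = i \<and> k = i' then (\<Sum>\<mu> \<in> ?P k. path \<mu> * ghost \<mu>) else 0)"
      by (intro sum.cong) auto
    also have "\<dots> = (if i < length vs \<and> i = i' then (\<Sum>\<mu> \<in> ?P i. path \<mu> * ghost \<mu>) else 0)"
      by (rule sum_if_eq_and)
    also have "kp_cong \<Gamma> \<dots> (diag_mat vs i i')"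
      using v by (auto simp: diag_mat_def kp_cong_refl intro: kp_cong_sym kp_cong_ck)
    finally show ?thesis .
  qed
  \<comment> \<open>Different paths from the same entry are orthogonal by (KP3), as all have degree
    \<open>d\<close>. Paths from different entries never meet, even when these entries are the same
    vertex.\<close>
  have YX: "kp_cong \<Gamma> (poly_mat_mult N Y X t t') (diag_mat ws t t')" if "t < N" "t' < N" for t t'
  proof -
    have "poly_mat_mult N Y X t t' = (\<Sum>i<N. if i = fst (L ! t) \<and>
        (i = fst (L ! t') \<and> t < length L \<and> t' < length L) then ghost (snd (L ! t)) * path (snd (L ! t')) else 0)"
      unfolding poly_mat_mult_def by (intro sum.cong) (auto simp: X_def Y_def)
    also have "\<dots> = (if fst (L ! t) < N \<and> fst (L ! t) = fst (L ! t') \<and> t < length L \<and> t' < length L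
        then ghost (snd (L ! t)) * path (snd (L ! t')) else 0)"
      by (rule sum_if_eq_and)
    also have "\<dots> = (if fst (L ! t) = fst (L ! t') \<and> t < length L \<and> t' < length L
        then ghost (snd (L ! t)) * path (snd (L ! t')) else 0)"
      using mem(1) N(1) by (intro if_cong) (auto intro: less_le_trans)
    also have "kp_cong \<Gamma> \<dots> (diag_mat ws t t')"
    proof (cases "fst (L ! t) = fst (L ! t') \<and> t < length L \<and> t' < length L")
      case True
      then have "snd (L ! t) = snd (L ! t') \<longleftrightarrow> t = t'"
        using nth_eq_iff_index_eq[OF L(1)] by (metis prod.expand)
      then show ?thesis
        using True kp_cong_ghost_path_same_deg[of "snd (L ! t)" "snd (L ! t')"] mem[of t] mem[of t'] len
        by (simp add: diag_mat_def split: if_splits)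
    next
      case False
      then show ?thesis using len by (auto simp: diag_mat_def kp_cong_refl)
    qed
    finally show ?thesis .
  qed
  show ?thesis
    using X Y poly_mat_diag[OF vs N(1)] poly_mat_diag[OF ws_verts N(2)] XY YX diag_mat_idem[OF vs] diag_mat_idem[OF ws_verts]
    by (rule idem_rel_class_matI)
qed

lemma push_0: "set_mset A \<subseteq> verts \<Gamma> \<Longrightarrow> push 0 A = A"
proof -
  assume A: "set_mset A \<subseteq> verts \<Gamma>"
  have "push 0 A = (\<Sum>v \<in># A. {#v#})"
    unfolding push_def using A by (intro arg_cong[of _ _ sum_mset] image_mset_cong) (auto simp: paths_from_0 src_vert)
  then show "push 0 A = A" by simp
qed

text \<open>In degree 0 the only path from a vertex is the vertex itself, so \<open>push 0\<close>
  is the identity and the previous equivalence specialises to a permutation.\<close>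

lemma idem_rel_diag_perm:
  "set vs \<subseteq> verts \<Gamma> \<Longrightarrow> mset vs = mset ws \<Longrightarrow>
    (class_mat (diag_mat vs), class_mat (diag_mat ws)) \<in> idem_rel (kumjian_pask K \<Gamma>)"
  using push_0[of "mset ws"] mset_eq_setD[of vs ws] by (intro idem_rel_diag_push[where d = 0]) simp_all

text \<open>At a large level the idempotent becomes one over the field, indexed by pairs of a matrix
  position and a path. The vectors \<open>x t\<close> and \<open>y t\<close> of its rank
  decomposition turn into columns of paths and rows of ghosts: \<open>X Y\<close> restores
  \<open>E\<close>, and orthogonality makes \<open>Y X\<close> diagonal with the vertices
  \<open>w t\<close>.\<close>

lemma idempotent_equiv_diag:
  fixes K :: "'f::field itself"
  assumes e: "e \<in> Minf_idem (kumjian_pask K \<Gamma>)"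
  shows "\<forall>\<^sub>F n in at_top. \<exists>ws. set ws \<subseteq> {v \<in> verts \<Gamma>. level v = n} \<and>
    (e, class_mat (diag_mat ws)) \<in> idem_rel (kumjian_pask K \<Gamma>)"
proof -
  obtain N and E :: "nat \<Rightarrow> nat \<Rightarrow> 'a kp_gen word \<Rightarrow>\<^sub>0 'f" where E: "poly_mat N E" "e = class_mat E"
    using e unfolding Minf_idem_def by (blast elim: Minf_class_mat)
  have EE: "kp_cong \<Gamma> (poly_mat_mult N E E i j) (E i j)" if "i < N" "j < N" for i j
    using e that class_mat_eq_iff[OF poly_mat_mult[OF E(1) E(1)] E(1)]
    unfolding E(2) Minf_idem_def by (simp add: Minf_mult_class_mat[OF E(1) E(1)])
  have "\<forall>\<^sub>F n in at_top. \<forall>i \<in> {..<N}. \<forall>j \<in> {..<N}. \<forall>\<alpha>. \<forall>\<beta> \<in> paths_to n.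
      entry (poly_mat_mult N E E i j) \<alpha> \<beta> = entry (E i j) \<alpha> \<beta>"
    using EE by (intro eventually_ball_finite finite_lessThan ballI kp_cong_entry) auto
  moreover have "\<forall>\<^sub>F n in at_top. \<forall>i \<in> {..<N}. \<forall>j \<in> {..<N}. \<forall>Q. finite Q \<longrightarrow> supp_at n (E i j) \<subseteq> Q \<longrightarrow>
      kp_cong \<Gamma> (E i j) (\<Sum>\<alpha> \<in> Q. \<Sum>\<beta> \<in> Q \<inter> paths_to n. Poly_Mapping.single (Word [Path \<alpha>, Ghost \<beta>]) (entry (E i j) \<alpha> \<beta>))"
    by (intro eventually_ball_finite finite_lessThan ballI kp_cong_span poly_matD[OF E(1)])
  ultimately show ?thesis
  proof eventually_elim
    case (elim n)
    define Q where "Q = (\<Union>i<N. \<Union>j<N. supp_at n (E i j))"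
    have Qfin: "finite Q" unfolding Q_def using poly_matD[OF E(1)] by (auto intro: finite_supp_at)
    have Qn: "Q \<subseteq> paths_to n" unfolding Q_def using supp_at_paths_to by blast
    have Qs: "supp_at n (E i j) \<subseteq> Q" if "i < N" "j < N" for i j using that unfolding Q_def by blast
    let ?I = "{..<N} \<times> Q"
    let ?M = "\<lambda>(i, \<alpha>) (j, \<beta>). entry (E i j) \<alpha> \<beta>"
    have idem: "(\<Sum>l \<in> ?I. ?M p l * ?M l q) = ?M p q" if mem: "p \<in> ?I" "q \<in> ?I" for p q
    proof -
      obtain i \<alpha> j \<beta> where pq: "p = (i, \<alpha>)" "q = (j, \<beta>)" "i < N" "j < N" "\<alpha> \<in> Q" "\<beta> \<in> Q" using mem by auto
      have \<beta>: "\<beta> \<in> paths_to n" using pq Qn by auto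
      have "(\<Sum>l \<in> ?I. ?M p l * ?M l q) = (\<Sum>l<N. \<Sum>\<gamma> \<in> Q. entry (E i l) \<alpha> \<gamma> * entry (E l j) \<gamma> \<beta>)"
        unfolding pq by (simp add: sum.cartesian_product case_prod_beta)
      also have "\<dots> = (\<Sum>l<N. entry (E i l * E l j) \<alpha> \<beta>)"
      proof (rule sum.cong[OF refl])
        fix l assume "l \<in> {..<N}"
        then have "\<gamma> \<in> Q" if "entry (E l j) \<gamma> \<beta> \<noteq> 0" for \<gamma>
          using entry_supp_at(1)[OF that \<beta>] Qs[of l j] pq by auto
        then show "(\<Sum>\<gamma> \<in> Q. entry (E i l) \<alpha> \<gamma> * entry (E l j) \<gamma> \<beta>) = entry (E i l * E l j) \<alpha> \<beta>"
          by (rule entry_mult[OF Qfin, symmetric])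
      qed
      also have "\<dots> = entry (poly_mat_mult N E E i j) \<alpha> \<beta>"
        by (simp add: poly_mat_mult_def entry_sum)
      also have "\<dots> = ?M p q" using elim(1) \<beta> pq by simp
      finally show ?thesis .
    qed
    \<comment> \<open>A nonzero entry joins two paths with the same source, so the source serves as
      the block label.\<close>
    have blk: "src \<Gamma> (snd p) = src \<Gamma> (snd q)" if "p \<in> ?I" "q \<in> ?I" "?M p q \<noteq> 0" for p q
      using that entry_src(2) Qn by (fastforce simp: paths_to_def)
    have "\<exists>r x y w. (\<forall>p \<in> ?I. \<forall>q \<in> ?I. ?M p q = (\<Sum>t<(r::nat). x t p * y t q)) \<and>
      (\<forall>t<r. \<forall>t'<r. (\<Sum>p \<in> ?I. y t p * x t' p) = (if t = t' then 1 else 0)) \<and>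
      (\<forall>t<r. w t \<in> (\<lambda>p. src \<Gamma> (snd p)) ` ?I \<and>
        (\<forall>p \<in> ?I. (x t p \<noteq> 0 \<longrightarrow> src \<Gamma> (snd p) = w t) \<and> (y t p \<noteq> 0 \<longrightarrow> src \<Gamma> (snd p) = w t)))"
      by (rule idempotent_rank_decomposition[OF finite_cartesian_product[OF finite_lessThan Qfin]])
        (erule (1) idem, erule (2) blk)
    then obtain r x y w where
      M: "\<forall>p \<in> ?I. \<forall>q \<in> ?I. ?M p q = (\<Sum>t<(r::nat). x t p * y t q)"
      and orth: "\<forall>t<r. \<forall>t'<r. (\<Sum>p \<in> ?I. y t p * x t' p) = (if t = t' then 1 else 0)"
      and w: "\<forall>t<r. w t \<in> (\<lambda>p. src \<Gamma> (snd p)) ` ?I \<and>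
        (\<forall>p \<in> ?I. (x t p \<noteq> 0 \<longrightarrow> src \<Gamma> (snd p) = w t) \<and> (y t p \<noteq> 0 \<longrightarrow> src \<Gamma> (snd p) = w t))"
      by (elim exE conjE) (rule that)
    define ws where "ws = map w [0..<r]"
    have ws: "set ws \<subseteq> {v \<in> verts \<Gamma>. level v = n}"
      using w Qn src_closed by (force simp: ws_def paths_to_def)
    then have ws_verts: "set ws \<subseteq> verts \<Gamma>" by auto
    have len: "length ws = r" by (simp add: ws_def)
    define R where "R = max N r"
    have R: "N \<le> R" "r \<le> R" by (auto simp: R_def)
    let ?p = "\<lambda>\<alpha> c. Poly_Mapping.single (Word [Path \<alpha>]) c :: 'a kp_gen word \<Rightarrow>\<^sub>0 'f"
    let ?g = "\<lambda>\<alpha> c. Poly_Mapping.single (Word [Ghost \<alpha>]) c :: 'a kp_gen word \<Rightarrow>\<^sub>0 'f"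
    define X where "X i t = (if i < N \<and> t < r then \<Sum>\<alpha> \<in> Q. ?p \<alpha> (x t (i, \<alpha>)) else 0)" for i t
    define Y where "Y t i = (if i < N \<and> t < r then \<Sum>\<alpha> \<in> Q. ?g \<alpha> (y t (i, \<alpha>)) else 0)" for t i
    have Qp: "\<alpha> \<in> paths \<Gamma>" if "\<alpha> \<in> Q" for \<alpha> using that Qn by (auto simp: paths_to_def)
    have X: "poly_mat R X" and Y: "poly_mat R Y"
      unfolding poly_mat_def X_def Y_def using R Qp by (auto intro!: nonconst_sum nonconst_single)
    have single_sum: "Poly_Mapping.single k (sum f A) = (\<Sum>x \<in> A. Poly_Mapping.single k (f x))"
      for k :: "'a kp_gen word" and f :: "'x \<Rightarrow> 'f" and A
      by (induction A rule: infinite_finite_induct) (simp_all add: single_add)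
    have XY: "kp_cong \<Gamma> (poly_mat_mult R X Y i j) (E i j)" if "i < R" "j < R" for i j
    proof (cases "i < N \<and> j < N")
      case True
      have "poly_mat_mult R X Y i j = (\<Sum>t<r. X i t * Y t j)"
        unfolding poly_mat_mult_def using R by (intro sum.mono_neutral_right) (auto simp: X_def)
      also have "\<dots> = (\<Sum>t<r. \<Sum>\<alpha> \<in> Q. \<Sum>\<beta> \<in> Q. Poly_Mapping.single (Word [Path \<alpha>, Ghost \<beta>]) (x t (i, \<alpha>) * y t (j, \<beta>)))"
        using True by (intro sum.cong) (simp_all add: X_def Y_def sum_product mult_single plus_Word)
      also have "\<dots> = (\<Sum>\<alpha> \<in> Q. \<Sum>\<beta> \<in> Q. \<Sum>t<r. Poly_Mapping.single (Word [Path \<alpha>, Ghost \<beta>]) (x t (i, \<alpha>) * y t (j, \<beta>)))"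
        by (simp only: sum.swap[where A = "{..<r}"])
      also have "\<dots> = (\<Sum>\<alpha> \<in> Q. \<Sum>\<beta> \<in> Q. Poly_Mapping.single (Word [Path \<alpha>, Ghost \<beta>]) (entry (E i j) \<alpha> \<beta>))"
        unfolding single_sum[symmetric] using M True by (intro sum.cong) auto
      also have "\<dots> = (\<Sum>\<alpha> \<in> Q. \<Sum>\<beta> \<in> Q \<inter> paths_to n. Poly_Mapping.single (Word [Path \<alpha>, Ghost \<beta>]) (entry (E i j) \<alpha> \<beta>))"
        using Qn by (simp add: Int_absorb2)
      also have "kp_cong \<Gamma> \<dots> (E i j)"
        by (rule kp_cong_sym, rule elim(2)[rule_format]) (use True Qfin Qs in simp_all)
      finally show ?thesis .
    next
      case False
      then have "E i j = 0" using poly_mat_zero[OF E(1), of i j] by auto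
      moreover have "poly_mat_mult R X Y i j = 0"
        unfolding poly_mat_mult_def using False by (intro sum.neutral) (auto simp: X_def Y_def)
      ultimately show ?thesis by (simp add: kp_cong_refl)
    qed
    have YX: "kp_cong \<Gamma> (poly_mat_mult R Y X t t') (diag_mat ws t t')" if "t < R" "t' < R" for t t'
    proof (cases "t < r \<and> t' < r")
      case True
      have "poly_mat_mult R Y X t t' = (\<Sum>i<N. Y t i * X i t')"
        unfolding poly_mat_mult_def using R by (intro sum.mono_neutral_right) (auto simp: X_def)
      also have "\<dots> = (\<Sum>i<N. \<Sum>\<beta> \<in> Q. \<Sum>\<alpha> \<in> Q. Poly_Mapping.single 0 (y t (i, \<beta>) * x t' (i, \<alpha>)) * (ghost \<beta> * path \<alpha>))"
        using True by (intro sum.cong) (simp_all add: X_def Y_def sum_product mult_single plus_Word)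
      also have "kp_cong \<Gamma> \<dots> (\<Sum>i<N. \<Sum>\<beta> \<in> Q. \<Sum>\<alpha> \<in> Q. Poly_Mapping.single 0 (y t (i, \<beta>) * x t' (i, \<alpha>)) *
          (if \<beta> = \<alpha> then path (src \<Gamma> \<beta>) else 0))"
        using Qn by (intro kp_cong_sum kp_cong_mult kp_cong_ghost_path[of _ n] kp_cong_refl poly_over_single) auto
      also have "\<dots> = (\<Sum>i<N. \<Sum>\<beta> \<in> Q. ?p (src \<Gamma> \<beta>) (y t (i, \<beta>) * x t' (i, \<beta>)))"
      proof (intro sum.cong refl)
        fix i \<beta> assume "\<beta> \<in> Q"
        have "(\<Sum>\<alpha> \<in> Q. Poly_Mapping.single 0 (y t (i, \<beta>) * x t' (i, \<alpha>)) * (if \<beta> = \<alpha> then path (src \<Gamma> \<beta>) else 0)) =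
            (\<Sum>\<alpha> \<in> Q. if \<alpha> = \<beta> then ?p (src \<Gamma> \<beta>) (y t (i, \<beta>) * x t' (i, \<beta>)) else 0)"
          by (intro sum.cong) (auto simp: mult_single)
        then show "(\<Sum>\<alpha> \<in> Q. Poly_Mapping.single 0 (y t (i, \<beta>) * x t' (i, \<alpha>)) * (if \<beta> = \<alpha> then path (src \<Gamma> \<beta>) else 0)) =
            ?p (src \<Gamma> \<beta>) (y t (i, \<beta>) * x t' (i, \<beta>))"
          using Qfin \<open>\<beta> \<in> Q\<close> by simp
      qed
      also have "\<dots> = (\<Sum>p \<in> ?I. ?p (src \<Gamma> (snd p)) (y t p * x t' p))"
        by (simp add: sum.cartesian_product case_prod_beta)
      \<comment> \<open>\<open>x t'\<close> is supported on the block of source \<open>w t'\<close>,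
        so the vertex no longer depends on the summation index and orthogonality can be
        used.\<close>
      also have "\<dots> = (\<Sum>p \<in> ?I. ?p (w t') (y t p * x t' p))"
      proof (rule sum.cong[OF refl])
        fix p assume "p \<in> ?I"
        then show "?p (src \<Gamma> (snd p)) (y t p * x t' p) = ?p (w t') (y t p * x t' p)"
          using w True by (cases "x t' p = 0") auto
      qed
      also have "\<dots> = diag_mat ws t t'"
        unfolding single_sum[symmetric] using orth True by (simp add: diag_mat_def len) (auto simp: ws_def)
      finally show ?thesis .
    next
      case False
      have "poly_mat_mult R Y X t t' = 0"
        unfolding poly_mat_mult_def using False by (intro sum.neutral) (auto simp: X_def Y_def)
      with False show ?thesis by (auto simp: diag_mat_def len kp_cong_refl)
    qed
    have "(class_mat E, class_mat (diag_mat ws)) \<in> idem_rel (kumjian_pask K \<Gamma>)"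
      using X Y poly_mat_mono[OF E(1) R(1)] poly_mat_diag[OF ws_verts R(2)[folded len]] XY YX
        e[unfolded E(2)] diag_mat_idem[OF ws_verts]
      by (rule idem_rel_class_matI)
    then show ?case using ws E(2) by blast
  qed
qed

end

section \<open>Invariance of the rank\<close>

context level_kgraph
begin

lemma entry_path_vert:
  "v \<in> verts \<Gamma> \<Longrightarrow> \<beta> \<in> paths \<Gamma> \<Longrightarrow> entry (path v :: _ \<Rightarrow>\<^sub>0 'f::field) \<alpha> \<beta> = (if \<alpha> = \<beta> \<and> rng \<Gamma> \<beta> = v then 1 else 0)"
  by (auto simp: entry_single act_gen_vert)

text \<open>At level \<open>p\<close>, the matrix \<open>diag_mat vs\<close> acts as the projection onto the span of the sets
  \<open>basis_at p vs u\<close>.\<close>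

definition basis_at :: "int ^ 'k \<Rightarrow> 'a list \<Rightarrow> 'a \<Rightarrow> (nat \<times> 'a) set" where
  "basis_at p vs u = {(i, \<alpha>). i < length vs \<and> \<alpha> \<in> paths_to p \<and> rng \<Gamma> \<alpha> = vs ! i \<and> src \<Gamma> \<alpha> = u}"

lemma basis_at_Sigma:
  "basis_at p vs u = Sigma {..<length vs} (\<lambda>i. {\<alpha> \<in> paths_to p. rng \<Gamma> \<alpha> = vs ! i \<and> src \<Gamma> \<alpha> = u})"
  by (auto simp: basis_at_def)

lemma finite_basis_at: "set vs \<subseteq> verts \<Gamma> \<Longrightarrow> finite (basis_at p vs u)"
proof -
  assume vs: "set vs \<subseteq> verts \<Gamma>"
  have "finite {\<alpha> \<in> paths_to p. rng \<Gamma> \<alpha> = vs ! i \<and> src \<Gamma> \<alpha> = u}" if "i < length vs" for i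
    using that vs by (intro finite_subset[OF _ finite_paths_to_from[of "vs ! i" p]]) auto
  then show ?thesis unfolding basis_at_Sigma by (intro finite_SigmaI) auto
qed

text \<open>Ending at level \<open>p\<close> fixes the degree as \<open>p - m\<close>, so the basis
  for source \<open>u\<close> consists of the paths that \<open>push\<close> lists. This reads the
  rank of the block \<open>u\<close> off the connecting map.\<close>

lemma card_basis_at:
  assumes vs: "set vs \<subseteq> verts \<Gamma>" "\<forall>v \<in> set vs. level v = m" and m: "m \<le> p"
  shows "card (basis_at p vs u) = count (push (vec_nat (p - m)) (mset vs)) u"
proof -
  have fin: "finite {\<alpha> \<in> paths_to p. rng \<Gamma> \<alpha> = vs ! i \<and> src \<Gamma> \<alpha> = u}" if "i < length vs" for i
    using that vs by (intro finite_subset[OF _ finite_paths_to_from[of "vs ! i" p]]) auto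
  have "card (basis_at p vs u) = (\<Sum>i<length vs. card {\<alpha> \<in> paths_to p. rng \<Gamma> \<alpha> = vs ! i \<and> src \<Gamma> \<alpha> = u})"
    unfolding basis_at_Sigma using fin by (intro card_SigmaI) auto
  also have "\<dots> = (\<Sum>i<length vs. count (image_mset (src \<Gamma>) (mset_set (paths_from \<Gamma> (vs ! i) (vec_nat (p - m))))) u)"
  proof (rule sum.cong[OF refl])
    fix i assume i: "i \<in> {..<length vs}"
    then have "vs ! i \<in> set vs" by auto
    then have "vs ! i \<in> verts \<Gamma>" and lev: "level (vs ! i) = m" using vs by auto
    then have "finite (paths_from \<Gamma> (vs ! i) (vec_nat (p - m)))" by (intro finite_paths_from)
    moreover have "{\<alpha> \<in> paths_to p. rng \<Gamma> \<alpha> = vs ! i} = paths_from \<Gamma> (vs ! i) (vec_nat (p - m))"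
      using paths_to_from[of p "vs ! i"] lev m by simp
    then have "{\<alpha> \<in> paths_to p. rng \<Gamma> \<alpha> = vs ! i \<and> src \<Gamma> \<alpha> = u} =
        {\<alpha> \<in> paths_from \<Gamma> (vs ! i) (vec_nat (p - m)). u = src \<Gamma> \<alpha>}" by blast
    moreover have "count (image_mset f (mset_set A)) x = card {y \<in> A. x = f y}" if "finite A"
      for f :: "'a \<Rightarrow> 'a" and A x
      using that by (simp add: count_image_mset')
    ultimately show "card {\<alpha> \<in> paths_to p. rng \<Gamma> \<alpha> = vs ! i \<and> src \<Gamma> \<alpha> = u} =
        count (image_mset (src \<Gamma>) (mset_set (paths_from \<Gamma> (vs ! i) (vec_nat (p - m))))) u"
      by (simp only:)
  qed
  also have "\<dots> = count (push (vec_nat (p - m)) (mset vs)) u"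
    by (simp add: push_mset count_sum)
  finally show ?thesis .
qed

text \<open>With a witness cut down to \<open>x = x f\<close>, the relations \<open>e = x y\<close>
  and \<open>x = x f\<close> become matrix identities over the field at a large level. Restricted to
  one source, they factor the identity on the basis of \<open>vs\<close> through the basis of
  \<open>ws\<close>.\<close>

lemma card_basis_at_le:
  fixes K :: "'f::field itself"
  assumes vs: "set vs \<subseteq> verts \<Gamma>" and ws: "set ws \<subseteq> verts \<Gamma>"
    and rel: "(class_mat (diag_mat vs), class_mat (diag_mat ws)) \<in> idem_rel (kumjian_pask K \<Gamma>)"
  shows "\<forall>\<^sub>F p in at_top. \<forall>u. card (basis_at p vs u) \<le> card (basis_at p ws u)"
proof -
  let ?V = "diag_mat vs :: nat \<Rightarrow> nat \<Rightarrow> 'a kp_gen word \<Rightarrow>\<^sub>0 'f"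
  let ?W = "diag_mat ws :: nat \<Rightarrow> nat \<Rightarrow> 'a kp_gen word \<Rightarrow>\<^sub>0 'f"
  obtain x y where xy: "x \<in> Minf (kumjian_pask K \<Gamma>)" "y \<in> Minf (kumjian_pask K \<Gamma>)"
    "class_mat ?V = Minf_mult (kumjian_pask K \<Gamma>) x y"
    "Minf_mult (kumjian_pask K \<Gamma>) x (class_mat ?W) = x"
    using rel by (rule nonunital_matrices.idem_relE[OF nonunital_matrices_kumjian_pask])
  obtain N1 X where X1: "poly_mat N1 X" "x = class_mat X" using xy(1) by (rule Minf_class_mat)
  obtain N2 Y where Y1: "poly_mat N2 Y" "y = class_mat Y" using xy(2) by (rule Minf_class_mat)
  define N where "N = N1 + N2 + length vs + length ws"
  have X: "poly_mat N X" and Y: "poly_mat N Y" and V: "poly_mat N ?V" and W: "poly_mat N ?W"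
    using X1(1) Y1(1) vs ws by (auto simp: N_def intro: poly_mat_mono poly_mat_diag)
  have len: "length vs \<le> N" "length ws \<le> N" by (auto simp: N_def)
  have 1: "kp_cong \<Gamma> (poly_mat_mult N X Y i j) (?V i j)" if "i < N" "j < N" for i j
    using xy(3) that class_mat_eq_iff[OF V poly_mat_mult[OF X Y]] kp_cong_sym
    unfolding X1(2) Y1(2) Minf_mult_class_mat[OF X Y] by blast
  have 2: "kp_cong \<Gamma> (poly_mat_mult N X ?W i j) (X i j)" if "i < N" "j < N" for i j
    using xy(4) that class_mat_eq_iff[OF poly_mat_mult[OF X W] X]
    unfolding X1(2) Minf_mult_class_mat[OF X W] by blast
  have "\<forall>\<^sub>F p in at_top. \<forall>i \<in> {..<N}. \<forall>j \<in> {..<N}. \<forall>\<alpha>. \<forall>\<beta> \<in> paths_to p.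
      entry (poly_mat_mult N X Y i j) \<alpha> \<beta> = entry (?V i j) \<alpha> \<beta>"
    using 1 by (intro eventually_ball_finite finite_lessThan ballI kp_cong_entry) auto
  moreover have "\<forall>\<^sub>F p in at_top. \<forall>i \<in> {..<N}. \<forall>j \<in> {..<N}. \<forall>\<alpha>. \<forall>\<beta> \<in> paths_to p.
      entry (poly_mat_mult N X ?W i j) \<alpha> \<beta> = entry (X i j) \<alpha> \<beta>"
    using 2 by (intro eventually_ball_finite finite_lessThan ballI kp_cong_entry) auto
  ultimately show ?thesis
  proof eventually_elim
    case (elim p)
    \<comment> \<open>Because \<open>x = x f\<close>, the columns of \<open>x\<close> outside the basis of \<open>ws\<close> vanish at level \<open>p\<close>.\<close>
    have Xsupp: "j < length ws \<and> rng \<Gamma> \<beta> = ws ! j"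
      if nz: "entry (X i j) \<alpha> \<beta> \<noteq> 0" and ij: "i < N" "j < N" and \<beta>: "\<beta> \<in> paths_to p" for i j \<alpha> \<beta>
    proof -
      have "entry (poly_mat_mult N X ?W i j) \<alpha> \<beta> \<noteq> 0" using elim(2) nz ij \<beta> by auto
      then have j: "j < length ws" and nz': "entry (X i j * path (ws ! j)) \<alpha> \<beta> \<noteq> 0"
        by (auto simp: mult_diag_mat[OF len(2)] split: if_splits)
      have v: "ws ! j \<in> verts \<Gamma>" using ws j by auto
      have \<beta>': "\<beta> \<in> paths \<Gamma>" using \<beta> by (simp add: paths_to_def)
      have "entry (X i j * path (ws ! j)) \<alpha> \<beta> = (\<Sum>\<gamma> \<in> {\<beta>}. entry (X i j) \<alpha> \<gamma> * entry (path (ws ! j)) \<gamma> \<beta>)"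
        using entry_path_vert[OF v \<beta>', where 'f = 'f] by (intro entry_mult) (auto split: if_splits)
      then show ?thesis using nz' j entry_path_vert[OF v \<beta>', where 'f = 'f] by (auto split: if_splits)
    qed
    show ?case
    proof
      fix u
      let ?S = "basis_at p vs u" and ?T = "basis_at p ws u"
      show "card ?S \<le> card ?T"
      proof (rule card_le_if_right_inverse[OF finite_basis_at[OF ws] finite_basis_at[OF vs]])
        fix s s' assume s: "s \<in> ?S" "s' \<in> ?S"
        obtain i \<alpha> i' \<alpha>' where ss: "s = (i, \<alpha>)" "s' = (i', \<alpha>')" by fastforce
        have i: "i < N" "i' < N" "i < length vs" "i' < length vs" and \<alpha>: "\<alpha> \<in> paths_to p" "\<alpha>' \<in> paths_to p"
          and rs: "rng \<Gamma> \<alpha> = vs ! i" "rng \<Gamma> \<alpha>' = vs ! i'" "src \<Gamma> \<alpha> = u" "src \<Gamma> \<alpha>' = u"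
          using s len by (auto simp: ss basis_at_def)
        have \<alpha>p: "\<alpha>' \<in> paths \<Gamma>" using \<alpha> by (simp add: paths_to_def)
        \<comment> \<open>These are the intermediate paths in the columns of \<open>Y\<close> at
          \<open>\<alpha>'\<close>, enlarged by the paths of \<open>?T\<close> so that both sums
          live in one finite rectangle.\<close>
        define G where "G = (\<Union>j<N. {\<beta>. entry (Y j i') \<beta> \<alpha>' \<noteq> 0}) \<union> snd ` ?T"
        have G: "finite G" unfolding G_def using finite_entry_column finite_basis_at[OF ws] by auto
        have sub: "?T \<subseteq> {..<N} \<times> G" using len(2) by (force simp: G_def basis_at_def)
        have "(\<Sum>t \<in> ?T. entry (X (fst s) (fst t)) (snd s) (snd t) * entry (Y (fst t) (fst s')) (snd t) (snd s')) =
            (\<Sum>t \<in> {..<N} \<times> G. entry (X (fst s) (fst t)) (snd s) (snd t) * entry (Y (fst t) (fst s')) (snd t) (snd s'))"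
        proof (rule sum.mono_neutral_left)
          show "\<forall>t \<in> {..<N} \<times> G - ?T. entry (X (fst s) (fst t)) (snd s) (snd t) * entry (Y (fst t) (fst s')) (snd t) (snd s') = 0"
          proof
            fix t assume t: "t \<in> {..<N} \<times> G - ?T"
            show "entry (X (fst s) (fst t)) (snd s) (snd t) * entry (Y (fst t) (fst s')) (snd t) (snd s') = 0"
            proof (rule ccontr)
              assume "entry (X (fst s) (fst t)) (snd s) (snd t) * entry (Y (fst t) (fst s')) (snd t) (snd s') \<noteq> 0"
              then have nX: "entry (X i (fst t)) \<alpha> (snd t) \<noteq> 0" and nY: "entry (Y (fst t) i') (snd t) \<alpha>' \<noteq> 0"
                by (auto simp: ss)
              have "snd t \<in> paths_to p" "src \<Gamma> (snd t) = u"
                using entry_paths_to[OF nY \<alpha>(2)] entry_src(2)[OF nY \<alpha>p] rs by auto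
              moreover have "fst t < length ws \<and> rng \<Gamma> (snd t) = ws ! fst t"
                using Xsupp[OF nX i(1) _ \<open>snd t \<in> paths_to p\<close>] t by auto
              ultimately have "t \<in> ?T" by (cases t) (simp add: basis_at_def)
              then show False using t by simp
            qed
          qed
        qed (use G sub in auto)
        also have "\<dots> = (\<Sum>j<N. \<Sum>\<beta> \<in> G. entry (X i j) \<alpha> \<beta> * entry (Y j i') \<beta> \<alpha>')"
          by (simp add: ss sum.cartesian_product case_prod_beta)
        also have "\<dots> = (\<Sum>j<N. entry (X i j * Y j i') \<alpha> \<alpha>')"
          using G by (intro sum.cong[OF refl] entry_mult[symmetric]) (auto simp: G_def)
        also have "\<dots> = entry (poly_mat_mult N X Y i i') \<alpha> \<alpha>'"
          by (simp add: poly_mat_mult_def entry_sum)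
        also have "\<dots> = entry (?V i i') \<alpha> \<alpha>'" using elim(1) i \<alpha> by simp
        also have "\<dots> = (if s = s' then 1 else 0)"
        proof (cases "i = i'")
          case True
          have "vs ! i \<in> verts \<Gamma>" using vs i by auto
          then show ?thesis
            using True i rs entry_path_vert[of "vs ! i" \<alpha>' \<alpha>, where 'f = 'f] \<alpha>p by (auto simp: ss diag_mat_def)
        next
          case False
          then show ?thesis by (simp add: ss diag_mat_def)
        qed
        finally show "(\<Sum>t \<in> ?T. entry (X (fst s) (fst t)) (snd s) (snd t) *
            entry (Y (fst t) (fst s')) (snd t) (snd s')) = (if s = s' then 1 else 0)" .
      qed
    qed
  qed
qed

text \<open>The rank inequality applied to the equivalence and to its inverse holds for all sources
  at once, so the two multisets agree at every large level.\<close>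

lemma push_eq_if_idem_rel_diag:
  fixes K :: "'f::field itself"
  assumes vs: "set vs \<subseteq> {v \<in> verts \<Gamma>. level v = m}" and ws: "set ws \<subseteq> {v \<in> verts \<Gamma>. level v = n}"
    and rel: "(class_mat (diag_mat vs), class_mat (diag_mat ws)) \<in> idem_rel (kumjian_pask K \<Gamma>)"
  shows "\<forall>\<^sub>F p in at_top. m \<le> p \<and> n \<le> p \<and> push (vec_nat (p - m)) (mset vs) = push (vec_nat (p - n)) (mset ws)"
proof -
  have vs': "set vs \<subseteq> verts \<Gamma>" "\<forall>v \<in> set vs. level v = m" and ws': "set ws \<subseteq> verts \<Gamma>" "\<forall>v \<in> set ws. level v = n"
    using vs ws by auto
  note rel' = nonunital_matrices.idem_rel_sym[OF nonunital_matrices_kumjian_pask rel]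
  have "\<forall>\<^sub>F p in at_top. m \<le> p" "\<forall>\<^sub>F p in at_top. n \<le> p" by (rule eventually_ge_at_top_vec)+
  with card_basis_at_le[OF vs'(1) ws'(1) rel] card_basis_at_le[OF ws'(1) vs'(1) rel'] show ?thesis
  proof eventually_elim
    case (elim p)
    then have "card (basis_at p vs u) = card (basis_at p ws u)" for u by (simp add: le_antisym)
    then show ?case
      using card_basis_at[OF vs' elim(3)] card_basis_at[OF ws' elim(4)] elim by (simp add: multiset_eq_iff)
  qed
qed

end

section \<open>Block-diagonal sums of idempotents\<close>

definition rect_block :: "nat \<Rightarrow> nat \<Rightarrow> (nat \<Rightarrow> nat \<Rightarrow> 'c::zero) \<Rightarrow> (nat \<Rightarrow> nat \<Rightarrow> 'c) \<Rightarrow> nat \<Rightarrow> nat \<Rightarrow> 'c" where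
  "rect_block k l X X' = (\<lambda>i j. if i < k \<and> j < l then X i j
     else if k \<le> i \<and> l \<le> j then X' (i - k) (j - l) else 0)"

context is_kgraph
begin

lemma poly_mat_rect_block:
  "poly_mat N X \<Longrightarrow> poly_mat N X' \<Longrightarrow> k + N \<le> M \<Longrightarrow> l + N \<le> M \<Longrightarrow> poly_mat M (rect_block k l X X')"
proof -
  assume a: "poly_mat N X" "poly_mat N X'" "k + N \<le> M" "l + N \<le> M"
  have "i < M \<and> j < M" if "rect_block k l X X' i j \<noteq> 0" for i j
  proof (cases "i < k \<and> j < l")
    case True
    then show ?thesis using a by auto
  next
    case False
    then have "k \<le> i" "l \<le> j" "X' (i - k) (j - l) \<noteq> 0"
      using that by (auto simp: rect_block_def split: if_splits)
    then show ?thesis using poly_mat_zero[OF a(2), of "i - k" "j - l"] a by linarith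
  qed
  then show ?thesis
    using poly_matD(1)[OF a(1)] poly_matD(1)[OF a(2)] by (auto simp: poly_mat_def rect_block_def)
qed

lemma sum_lessThan_add:
  fixes f :: "nat \<Rightarrow> 'c::comm_monoid_add"
  shows "(\<Sum>h<l + m. f h) = (\<Sum>h<l. f h) + (\<Sum>h<m. f (l + h))"
  by (induction m) (simp_all add: add.assoc)

text \<open>The corners are rectangular because the witnesses of an equivalence connect idempotents
  of different sizes. Cutting \<open>X\<close> to \<open>l\<close> columns must lose nothing, hence
  the condition that its later columns vanish.\<close>

lemma mult_rect_block:
  assumes X: "poly_mat N X" and X': "poly_mat N X'" and l: "\<And>i j. l \<le> j \<Longrightarrow> X i j = 0" and M: "l + N \<le> M"
  shows "poly_mat_mult M (rect_block k l X X') (rect_block l m Y Y') =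
    rect_block k m (poly_mat_mult N X Y) (poly_mat_mult N X' Y')"
proof (intro ext)
  fix i j
  have split: "(\<Sum>h<M. f h) = (\<Sum>h<l. f h) + (\<Sum>h<M - l. f (h + l))" for f :: "nat \<Rightarrow> 'a kp_gen word \<Rightarrow>\<^sub>0 'b"
  proof -
    have "(\<Sum>h<l + (M - l). f h) = (\<Sum>h<l. f h) + (\<Sum>h<M - l. f (l + h))"
      by (rule sum_lessThan_add)
    then show ?thesis using M by (simp add: add.commute)
  qed
  have X0: "(\<Sum>h<l. X i h * Y h j) = poly_mat_mult N X Y i j"
  proof -
    have "(\<Sum>h<l. X i h * Y h j) = (\<Sum>h<max l N. X i h * Y h j)"
      using l by (intro sum.mono_neutral_left) auto
    also have "\<dots> = (\<Sum>h<N. X i h * Y h j)"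
      using poly_mat_zero[OF X] by (intro sum.mono_neutral_right) auto
    finally show ?thesis by (simp add: poly_mat_mult_def)
  qed
  have X'0: "(\<Sum>h<M - l. X' (i - k) h * Y' h (j - m)) = poly_mat_mult N X' Y' (i - k) (j - m)"
    unfolding poly_mat_mult_def using poly_mat_zero[OF X'] M by (intro sum.mono_neutral_right) auto
  consider "i < k" "j < m" | "i < k" "m \<le> j" | "k \<le> i" "j < m" | "k \<le> i" "m \<le> j" by linarith
  then show "poly_mat_mult M (rect_block k l X X') (rect_block l m Y Y') i j =
    rect_block k m (poly_mat_mult N X Y) (poly_mat_mult N X' Y') i j"
    unfolding poly_mat_mult_def[of M] split
    by cases (simp_all add: rect_block_def X0 X'0)
qed

lemma block_diag_class_mat:
  fixes K :: "'f::field itself"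
  shows "block_diag (kumjian_pask K \<Lambda>) k (class_mat X) (class_mat Y) = class_mat (rect_block k k X Y)"
  by (auto simp: block_diag_def class_mat_def rect_block_def kumjian_pask_simps fun_eq_iff)

lemma rect_block_diag_mat:
  "rect_block (length vs) (length vs) (diag_mat vs) (diag_mat ws) = diag_mat (vs @ ws)"
  by (intro ext) (auto simp: rect_block_def diag_mat_def nth_append)

lemma Minf_mult_zero_column:
  fixes K :: "'f::field itself"
  assumes "x \<in> Minf (kumjian_pask K \<Lambda>)" "\<And>l. y l j = kp_class \<Lambda> 0"
  shows "Minf_mult (kumjian_pask K \<Lambda>) x y i j = kp_class \<Lambda> 0"
proof -
  interpret abelian_monoid "kumjian_pask K \<Lambda>" by (rule abelian_monoid_kumjian_pask)
  have "x i l \<otimes>\<^bsub>kumjian_pask K \<Lambda>\<^esub> kp_class \<Lambda> 0 = \<zero>\<^bsub>kumjian_pask K \<Lambda>\<^esub>" for l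
  proof -
    have "x i l \<in> kp_class \<Lambda> ` kp_polys_nonconst \<Lambda>" using assms(1) by (simp add: Minf_def kumjian_pask_simps)
    then show ?thesis by (auto simp: kumjian_pask_simps poly_over_nonconstD)
  qed
  then show ?thesis by (simp add: Minf_mult_def assms(2)) (simp add: kumjian_pask_simps)
qed

lemma block_diag_idem:
  fixes K :: "'f::field itself"
  assumes e: "e \<in> Minf_idem (kumjian_pask K \<Lambda>)" and f: "f \<in> Minf_idem (kumjian_pask K \<Lambda>)"
    and k: "supported_below (kumjian_pask K \<Lambda>) k e"
  shows "block_diag (kumjian_pask K \<Lambda>) k e f \<in> Minf_idem (kumjian_pask K \<Lambda>)"
proof -
  have em: "e \<in> Minf (kumjian_pask K \<Lambda>)" and fm: "f \<in> Minf (kumjian_pask K \<Lambda>)"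
    using e f by (simp_all add: Minf_idem_def)
  obtain N1 E where E1: "poly_mat N1 E" "e = class_mat E" "\<forall>i j. e i j = kp_class \<Lambda> 0 \<longrightarrow> E i j = 0"
    using em by (rule Minf_class_mat)
  obtain N2 F where F1: "poly_mat N2 F" "f = class_mat F"
    using fm by (rule Minf_class_mat)
  define N where "N = max N1 N2"
  have E: "poly_mat N E" and F: "poly_mat N F" using E1(1) F1(1) by (auto simp: N_def intro: poly_mat_mono)
  have Ek: "E i j = 0" if "k \<le> j" for i j
  proof -
    have "e i j = kp_class \<Lambda> 0"
      using that k unfolding supported_below_def kumjian_pask_simps by (meson not_le)
    then show ?thesis using E1(3) by simp
  qed
  have B: "poly_mat (k + N) (rect_block k k E F)" by (rule poly_mat_rect_block[OF E F]) simp_all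
  have "class_mat (rect_block k k (poly_mat_mult N E E) (poly_mat_mult N F F)) =
      block_diag (kumjian_pask K \<Lambda>) k (class_mat (poly_mat_mult N E E)) (class_mat (poly_mat_mult N F F))"
    by (rule block_diag_class_mat[symmetric])
  also have "\<dots> = block_diag (kumjian_pask K \<Lambda>) k (class_mat E) (class_mat F)"
    using e f unfolding E1(2) F1(2) Minf_idem_def
    by (simp add: Minf_mult_class_mat[OF E E, of K] Minf_mult_class_mat[OF F F, of K])
  also have "\<dots> = class_mat (rect_block k k E F)" by (rule block_diag_class_mat)
  finally show ?thesis
    unfolding E1(2) F1(2) block_diag_class_mat Minf_idem_def
    by (simp add: Minf_mult_class_mat[OF B B] class_mat_Minf[OF B] mult_rect_block[OF E F Ek order_refl])
qed

text \<open>The witnesses are placed in corners of size \<open>k\<close> by \<open>l\<close> and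
  \<open>l\<close> by \<open>k\<close>, where \<open>l\<close> is the length of \<open>vs\<close>.
  Once cut down, \<open>x\<close> absorbs the diagonal matrix of \<open>vs\<close> and has no
  columns beyond \<open>l\<close>, while \<open>y = y e\<close> has none beyond \<open>k\<close>, so
  the corners lose nothing.\<close>

lemma idem_rel_block_diag:
  fixes K :: "'f::field itself"
  assumes vs: "set vs \<subseteq> verts \<Lambda>" and ws: "set ws \<subseteq> verts \<Lambda>"
    and e: "(e, class_mat (diag_mat vs)) \<in> idem_rel (kumjian_pask K \<Lambda>)"
    and f: "(f, class_mat (diag_mat ws)) \<in> idem_rel (kumjian_pask K \<Lambda>)"
    and k: "supported_below (kumjian_pask K \<Lambda>) k e"
  shows "(block_diag (kumjian_pask K \<Lambda>) k e f, class_mat (diag_mat (vs @ ws))) \<in> idem_rel (kumjian_pask K \<Lambda>)"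
proof -
  let ?B = "kumjian_pask K \<Lambda>"
  let ?V = "diag_mat vs :: nat \<Rightarrow> nat \<Rightarrow> 'a kp_gen word \<Rightarrow>\<^sub>0 'f"
  let ?W = "diag_mat ws :: nat \<Rightarrow> nat \<Rightarrow> 'a kp_gen word \<Rightarrow>\<^sub>0 'f"
  note NM = nonunital_matrices_kumjian_pask[of K]
  obtain x y where xy: "x \<in> Minf ?B" "y \<in> Minf ?B" "e = Minf_mult ?B x y" "class_mat ?V = Minf_mult ?B y x"
    "Minf_mult ?B x (class_mat ?V) = x" "Minf_mult ?B y e = y"
    using e by (rule nonunital_matrices.idem_relE[OF NM])
  obtain x' y' where xy': "x' \<in> Minf ?B" "y' \<in> Minf ?B" "f = Minf_mult ?B x' y'" "class_mat ?W = Minf_mult ?B y' x'"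
    using f by (rule nonunital_matrices.idem_relE[OF NM])
  obtain N1 X where X1: "poly_mat N1 X" "x = class_mat X" "\<forall>i j. x i j = kp_class \<Lambda> 0 \<longrightarrow> X i j = 0"
    using xy(1) by (rule Minf_class_mat)
  obtain N2 Y where Y1: "poly_mat N2 Y" "y = class_mat Y" "\<forall>i j. y i j = kp_class \<Lambda> 0 \<longrightarrow> Y i j = 0"
    using xy(2) by (rule Minf_class_mat)
  obtain N3 X' where X'1: "poly_mat N3 X'" "x' = class_mat X'" using xy'(1) by (rule Minf_class_mat)
  obtain N4 Y' where Y'1: "poly_mat N4 Y'" "y' = class_mat Y'" using xy'(2) by (rule Minf_class_mat)
  define l where "l = length vs"
  define N where "N = N1 + N2 + N3 + N4"
  define M where "M = k + l + N"
  have X: "poly_mat N X" and Y: "poly_mat N Y" and X': "poly_mat N X'" and Y': "poly_mat N Y'"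
    using X1(1) Y1(1) X'1(1) Y'1(1) by (auto simp: N_def intro: poly_mat_mono)
  have Xl: "X i j = 0" if "l \<le> j" for i j
  proof (rule X1(3)[rule_format])
    have "class_mat ?V h j = kp_class \<Lambda> 0" for h using that by (auto simp: class_mat_def diag_mat_def l_def)
    then have "Minf_mult ?B x (class_mat ?V) i j = kp_class \<Lambda> 0" by (rule Minf_mult_zero_column[OF xy(1)])
    then show "x i j = kp_class \<Lambda> 0" by (simp only: xy(5))
  qed
  have Yk: "Y i j = 0" if "k \<le> j" for i j
  proof (rule Y1(3)[rule_format])
    have "e h j = kp_class \<Lambda> 0" for h
      using that k unfolding supported_below_def kumjian_pask_simps by (meson not_le)
    then have "Minf_mult ?B y e i j = kp_class \<Lambda> 0" by (rule Minf_mult_zero_column[OF xy(2)])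
    then show "y i j = kp_class \<Lambda> 0" by (simp only: xy(6))
  qed
  let ?Z = "rect_block k l X X'" and ?U = "rect_block l k Y Y'"
  have Z: "poly_mat M ?Z" and U: "poly_mat M ?U"
    by (rule poly_mat_rect_block[OF X X'] poly_mat_rect_block[OF Y Y']; simp add: M_def)+
  have "Minf_mult ?B (class_mat ?Z) (class_mat ?U) = class_mat (rect_block k k (poly_mat_mult N X Y) (poly_mat_mult N X' Y'))"
    unfolding Minf_mult_class_mat[OF Z U] by (subst mult_rect_block[OF X X' Xl]) (auto simp: M_def)
  also have "\<dots> = block_diag ?B k (class_mat (poly_mat_mult N X Y)) (class_mat (poly_mat_mult N X' Y'))"
    by (rule block_diag_class_mat[symmetric])
  also have "\<dots> = block_diag ?B k e f"
    unfolding xy(3) xy'(3) X1(2) Y1(2) X'1(2) Y'1(2) Minf_mult_class_mat[OF X Y] Minf_mult_class_mat[OF X' Y'] ..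
  finally have 1: "block_diag ?B k e f = Minf_mult ?B (class_mat ?Z) (class_mat ?U)" ..
  have "Minf_mult ?B (class_mat ?U) (class_mat ?Z) = class_mat (rect_block l l (poly_mat_mult N Y X) (poly_mat_mult N Y' X'))"
    unfolding Minf_mult_class_mat[OF U Z] by (subst mult_rect_block[OF Y Y' Yk]) (auto simp: M_def)
  also have "\<dots> = block_diag ?B l (class_mat (poly_mat_mult N Y X)) (class_mat (poly_mat_mult N Y' X'))"
    by (rule block_diag_class_mat[symmetric])
  also have "\<dots> = block_diag ?B l (class_mat ?V) (class_mat ?W)"
    unfolding xy(4) xy'(4) X1(2) Y1(2) X'1(2) Y'1(2) Minf_mult_class_mat[OF Y X] Minf_mult_class_mat[OF Y' X'] ..
  also have "\<dots> = class_mat (diag_mat (vs @ ws))"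
    unfolding block_diag_class_mat l_def rect_block_diag_mat ..
  finally have 2: "class_mat (diag_mat (vs @ ws)) = Minf_mult ?B (class_mat ?U) (class_mat ?Z)" ..
  have "block_diag ?B k e f \<in> Minf_idem ?B"
    using e f k by (intro block_diag_idem) (auto simp: idem_rel_def)
  moreover have "class_mat (diag_mat (vs @ ws)) \<in> Minf_idem ?B"
    using vs ws by (intro diag_mat_idem) auto
  ultimately show ?thesis
    using 1 2 class_mat_Minf[OF Z, of K] class_mat_Minf[OF U, of K] unfolding idem_rel_def by blast
qed

end

section \<open>The direct limit\<close>

text \<open>Grouping the paths by their source turns the multiset of sources into multiplicities;
  only finitely many sources occur.\<close>

lemma vertex_image_eq:
  fixes \<Lambda> :: "('a, 'k::finite) kgraph"
  assumes "is_kgraph \<Lambda>" and "row_finite \<Lambda>" and v: "v \<in> verts \<Lambda>"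
  shows "vertex_image \<Lambda> d v = image_mset (src \<Lambda>) (mset_set (paths_from \<Lambda> v d))"
proof (rule multiset_eqI)
  fix u
  interpret is_kgraph \<Lambda> by fact
  have fin: "finite (paths_from \<Lambda> v d)" using assms by (simp add: row_finite_def)
  have between: "paths_between \<Lambda> v d w = {\<mu> \<in> paths_from \<Lambda> v d. w = src \<Lambda> \<mu>}" for w
    by (auto simp: paths_between_def)
  let ?W = "{w \<in> verts \<Lambda>. paths_between \<Lambda> v d w \<noteq> {}}"
  have W: "?W = src \<Lambda> ` paths_from \<Lambda> v d"
    unfolding between by (auto simp: paths_from_def src_closed)
  have "count (vertex_image \<Lambda> d v) u = (\<Sum>w \<in> ?W. if w = u then card (paths_between \<Lambda> v d u) else 0)"
    unfolding vertex_image_def count_sum by (intro sum.cong) auto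
  also have "\<dots> = (if u \<in> ?W then card (paths_between \<Lambda> v d u) else 0)"
    using fin unfolding W by simp
  also have "\<dots> = card (paths_between \<Lambda> v d u)"
  proof (cases "u \<in> ?W")
    case False
    then have "u \<notin> src \<Lambda> ` paths_from \<Lambda> v d" by (simp only: W simp_thms)
    then have "paths_between \<Lambda> v d u = {}" unfolding between by blast
    with False show ?thesis by simp
  qed simp
  also have "\<dots> = count (image_mset (src \<Lambda>) (mset_set (paths_from \<Lambda> v d))) u"
    unfolding between using fin by (simp add: count_image_mset')
  finally show "count (vertex_image \<Lambda> d v) u = count (image_mset (src \<Lambda>) (mset_set (paths_from \<Lambda> v d))) u" .
qed

text \<open>Sums in both monoids are unions of coinciding classes; they are evaluated by showing
  that the family is constant and not empty.\<close>

lemma Union_eq_if_const: "(\<And>P. P \<in> S \<Longrightarrow> P = Q) \<Longrightarrow> P \<in> S \<Longrightarrow> \<Union>S = Q"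
  by blast

lemma connecting_map_alt: "connecting_map \<Lambda> m n A = (\<Sum>v \<in># A. vertex_image \<Lambda> (vec_nat (n - m)) v)"
  by (simp add: connecting_map_def vec_nat_def)

lemma connecting_map_add: "connecting_map \<Lambda> m n (A + B) = connecting_map \<Lambda> m n A + connecting_map \<Lambda> m n B"
  by (simp add: connecting_map_def)

lemma free_comm_monoid_simps [simp]:
  "A \<in> carrier (free_comm_monoid X) \<longleftrightarrow> set_mset A \<subseteq> X"
  "A \<otimes>\<^bsub>free_comm_monoid X\<^esub> B = A + B"
  "\<one>\<^bsub>free_comm_monoid X\<^esub> = {#}"
  by (simp_all add: free_comm_monoid_def)

section \<open>Application to the skew product\<close>

locale row_finite_kgraph = is_kgraph \<Lambda> for \<Lambda> :: "('a, 'k::finite) kgraph" +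
  assumes finite_rows: "row_finite \<Lambda>"
begin

sublocale skew: level_kgraph "skew_product \<Lambda>" snd
  by (rule level_kgraph_skew_product[OF is_kgraph_axioms finite_rows])

abbreviation B :: "'f::field itself \<Rightarrow> (('a \<times> (int ^ 'k)) kp_gen word \<Rightarrow>\<^sub>0 'f) set ring" where
  "B K \<equiv> kumjian_pask K (skew_product \<Lambda>)"

sublocale mats: nonunital_matrices "B K" for K
  by (rule skew.nonunital_matrices_kumjian_pask)

lemma set_connecting_map:
  "set_mset A \<subseteq> verts \<Lambda> \<Longrightarrow> set_mset (connecting_map \<Lambda> m n A) \<subseteq> verts \<Lambda>"
proof -
  assume A: "set_mset A \<subseteq> verts \<Lambda>"
  have "set_mset (vertex_image \<Lambda> d v) \<subseteq> verts \<Lambda>" if "v \<in> verts \<Lambda>" for v d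
  proof -
    have "finite (paths_from \<Lambda> v d)" using that finite_rows by (simp add: row_finite_def)
    then show ?thesis
      using that by (auto simp: vertex_image_eq[OF is_kgraph_axioms finite_rows] paths_from_def src_closed)
  qed
  then show ?thesis using A unfolding connecting_map_alt by fastforce
qed

text \<open>A path of degree \<open>n - m\<close> leads from level m to level n, so the level
  coordinate of the skew product becomes the index of the direct system.\<close>

lemma push_skew_product:
  assumes "set_mset A \<subseteq> verts \<Lambda>" "m \<le> n"
  shows "skew.push (vec_nat (n - m)) (image_mset (\<lambda>v. (v, m)) A) =
    image_mset (\<lambda>v. (v, n)) (connecting_map \<Lambda> m n A)"
proof -
  let ?d = "vec_nat (n - m)"
  have *: "image_mset (src (skew_product \<Lambda>)) (mset_set (paths_from (skew_product \<Lambda>) (v, m) ?d)) =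
      image_mset (\<lambda>v. (v, n)) (vertex_image \<Lambda> ?d v)" if "v \<in> verts \<Lambda>" for v
  proof -
    have "mset_set (paths_from (skew_product \<Lambda>) (v, m) ?d) = image_mset (\<lambda>\<mu>. (\<mu>, m)) (mset_set (paths_from \<Lambda> v ?d))"
      unfolding paths_from_skew_product by (rule image_mset_mset_set[symmetric]) (simp add: inj_on_def)
    moreover have "src (skew_product \<Lambda>) (\<mu>, m) = (src \<Lambda> \<mu>, n)" if "\<mu> \<in># mset_set (paths_from \<Lambda> v ?d)" for \<mu>
    proof -
      have "deg \<Lambda> \<mu> = ?d" using that by (cases "finite (paths_from \<Lambda> v ?d)") (auto simp: paths_from_def)
      then show ?thesis using vec_int_nat[OF assms(2)] by simp
    qed
    then have "image_mset (\<lambda>\<mu>. src (skew_product \<Lambda>) (\<mu>, m)) (mset_set (paths_from \<Lambda> v ?d)) =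
        image_mset (\<lambda>\<mu>. (src \<Lambda> \<mu>, n)) (mset_set (paths_from \<Lambda> v ?d))"
      by (rule image_mset_cong)
    ultimately show ?thesis
      by (simp only: vertex_image_eq[OF is_kgraph_axioms finite_rows that] image_mset.compositionality comp_def)
  qed
  have "skew.push ?d (image_mset (\<lambda>v. (v, m)) A) =
      (\<Sum>v \<in># A. image_mset (src (skew_product \<Lambda>)) (mset_set (paths_from (skew_product \<Lambda>) (v, m) ?d)))"
    by (simp add: skew.push_def image_mset.compositionality comp_def)
  also have "\<dots> = (\<Sum>v \<in># A. image_mset (\<lambda>v. (v, n)) (vertex_image \<Lambda> ?d v))"
    using assms(1) * by (intro arg_cong[of _ _ sum_mset] image_mset_cong) auto
  also have "\<dots> = image_mset (\<lambda>v. (v, n)) (connecting_map \<Lambda> m n A)"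
    unfolding connecting_map_alt by (induction A) simp_all
  finally show ?thesis .
qed

text \<open>The order picked by \<open>SOME\<close> does not matter: by
  \<open>idem_rel_diag_perm\<close>, any two orders give equivalent matrices.\<close>

definition vertex_list :: "int ^ 'k \<Rightarrow> 'a multiset \<Rightarrow> ('a \<times> (int ^ 'k)) list" where
  "vertex_list n A = map (\<lambda>v. (v, n)) (SOME l. mset l = A)"

lemma mset_vertex_list: "mset (vertex_list n A) = image_mset (\<lambda>v. (v, n)) A"
proof -
  have "mset (SOME l. mset l = A) = A" by (rule someI_ex) (rule ex_mset)
  then show ?thesis by (simp add: vertex_list_def)
qed

lemma set_vertex_list: "set (vertex_list n A) = (\<lambda>v. (v, n)) ` set_mset A"
  using arg_cong[OF mset_vertex_list[of n A], of set_mset] by simp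

lemma vertex_list_verts:
  "set_mset A \<subseteq> verts \<Lambda> \<Longrightarrow> set (vertex_list n A) \<subseteq> {v \<in> verts (skew_product \<Lambda>). snd v = n}"
  by (auto simp: set_vertex_list)

lemma vertex_list_verts': "set_mset A \<subseteq> verts \<Lambda> \<Longrightarrow> set (vertex_list n A) \<subseteq> verts (skew_product \<Lambda>)"
  by (auto simp: set_vertex_list)

definition vertex_mat :: "'f::field itself \<Rightarrow> int ^ 'k \<Rightarrow> 'a multiset \<Rightarrow>
    nat \<Rightarrow> nat \<Rightarrow> (('a \<times> (int ^ 'k)) kp_gen word \<Rightarrow>\<^sub>0 'f) set" where
  "vertex_mat K n A = skew.class_mat (skew.diag_mat (vertex_list n A))"

lemma vertex_mat_idem: "set_mset A \<subseteq> verts \<Lambda> \<Longrightarrow> vertex_mat K n A \<in> Minf_idem (B K)"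
  unfolding vertex_mat_def by (rule skew.diag_mat_idem[OF vertex_list_verts'])

lemma vertex_mat_connecting_map:
  assumes "set_mset A \<subseteq> verts \<Lambda>" "m \<le> n"
  shows "(vertex_mat K m A, vertex_mat K n (connecting_map \<Lambda> m n A)) \<in> idem_rel (B K)"
  unfolding vertex_mat_def
  using assms by (intro skew.idem_rel_diag_push[where d = "vec_nat (n - m)"] vertex_list_verts')
    (simp_all add: mset_vertex_list push_skew_product)

text \<open>This matches equivalence of idempotents with identification in the direct limit.
  Invariance of the rank gives one direction; for the other, both matrices are moved up to level p
  by the equivalences that come from (KP4).\<close>

lemma vertex_mat_rel_iff:
  assumes A: "set_mset A \<subseteq> verts \<Lambda>" and C: "set_mset C \<subseteq> verts \<Lambda>"
  shows "(vertex_mat K m A, vertex_mat K n C) \<in> idem_rel (B K) \<longleftrightarrow>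
    (\<exists>p. m \<le> p \<and> n \<le> p \<and> connecting_map \<Lambda> m p A = connecting_map \<Lambda> n p C)"
proof
  assume "(vertex_mat K m A, vertex_mat K n C) \<in> idem_rel (B K)"
  then have "\<forall>\<^sub>F p in at_top. m \<le> p \<and> n \<le> p \<and> skew.push (vec_nat (p - m)) (mset (vertex_list m A)) =
      skew.push (vec_nat (p - n)) (mset (vertex_list n C))"
    unfolding vertex_mat_def
    by (rule skew.push_eq_if_idem_rel_diag[OF vertex_list_verts[OF A] vertex_list_verts[OF C]])
  then obtain p where p: "m \<le> p" "n \<le> p" "skew.push (vec_nat (p - m)) (mset (vertex_list m A)) =
      skew.push (vec_nat (p - n)) (mset (vertex_list n C))"
    using eventually_happens'[OF at_top_vec_neq_bot] by blast
  then have "image_mset (\<lambda>v. (v, p)) (connecting_map \<Lambda> m p A) = image_mset (\<lambda>v. (v, p)) (connecting_map \<Lambda> n p C)"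
    by (simp add: mset_vertex_list push_skew_product[OF A] push_skew_product[OF C])
  then have "image_mset fst (image_mset (\<lambda>v. (v, p)) (connecting_map \<Lambda> m p A)) =
      image_mset fst (image_mset (\<lambda>v. (v, p)) (connecting_map \<Lambda> n p C))" by (rule arg_cong)
  then show "\<exists>p. m \<le> p \<and> n \<le> p \<and> connecting_map \<Lambda> m p A = connecting_map \<Lambda> n p C"
    using p(1,2) by (auto simp: image_mset.compositionality comp_def)
next
  assume "\<exists>p. m \<le> p \<and> n \<le> p \<and> connecting_map \<Lambda> m p A = connecting_map \<Lambda> n p C"
  then obtain p where p: "m \<le> p" "n \<le> p" "connecting_map \<Lambda> m p A = connecting_map \<Lambda> n p C" by blast
  have "(vertex_mat K m A, vertex_mat K p (connecting_map \<Lambda> m p A)) \<in> idem_rel (B K)"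
    by (rule vertex_mat_connecting_map[OF A p(1)])
  moreover have "(vertex_mat K p (connecting_map \<Lambda> m p A), vertex_mat K n C) \<in> idem_rel (B K)"
    unfolding p(3) by (rule mats.idem_rel_sym[OF vertex_mat_connecting_map[OF C p(2)]])
  ultimately show "(vertex_mat K m A, vertex_mat K n C) \<in> idem_rel (B K)" by (rule mats.idem_rel_trans)
qed

text \<open>Having this at all large levels, and not just at one, allows several idempotents to be
  brought to a common level.\<close>

lemma equiv_vertex_mat:
  assumes "e \<in> Minf_idem (B K)"
  shows "\<forall>\<^sub>F n in at_top. \<exists>A. set_mset A \<subseteq> verts \<Lambda> \<and> (e, vertex_mat K n A) \<in> idem_rel (B K)"
  using skew.idempotent_equiv_diag[OF assms]
proof eventually_elim
  case (elim n)
  then obtain ws where ws: "set ws \<subseteq> {v \<in> verts (skew_product \<Lambda>). snd v = n}"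
    "(e, skew.class_mat (skew.diag_mat ws)) \<in> idem_rel (B K)" by blast
  define A where "A = image_mset fst (mset ws)"
  have "image_mset (\<lambda>v. (v, n)) A = image_mset (\<lambda>v. v) (mset ws)"
    unfolding A_def image_mset.compositionality comp_def using ws(1) by (intro image_mset_cong) auto
  then have "mset ws = mset (vertex_list n A)" by (simp add: mset_vertex_list)
  then have "(skew.class_mat (skew.diag_mat ws), vertex_mat K n A) \<in> idem_rel (B K)"
    unfolding vertex_mat_def using ws(1) by (intro skew.idem_rel_diag_perm) auto
  then have "(e, vertex_mat K n A) \<in> idem_rel (B K)" by (rule mats.idem_rel_trans[OF ws(2)])
  moreover have "set_mset A \<subseteq> verts \<Lambda>" using ws(1) by (auto simp: A_def)
  ultimately show ?case by blast
qed

lemma block_diag_vertex_mat: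
  assumes A: "set_mset A \<subseteq> verts \<Lambda>" and C: "set_mset C \<subseteq> verts \<Lambda>"
    and "(e, vertex_mat K n A) \<in> idem_rel (B K)" "(f, vertex_mat K n C) \<in> idem_rel (B K)"
    and "supported_below (B K) k e"
  shows "(block_diag (B K) k e f, vertex_mat K n (A + C)) \<in> idem_rel (B K)"
proof -
  have "(block_diag (B K) k e f, skew.class_mat (skew.diag_mat (vertex_list n A @ vertex_list n C))) \<in> idem_rel (B K)"
    using assms(3-5) unfolding vertex_mat_def
    by (rule skew.idem_rel_block_diag[OF vertex_list_verts'[OF A] vertex_list_verts'[OF C]])
  moreover have "(skew.class_mat (skew.diag_mat (vertex_list n A @ vertex_list n C)), vertex_mat K n (A + C)) \<in> idem_rel (B K)"
    unfolding vertex_mat_def using vertex_list_verts'[OF A] vertex_list_verts'[OF C]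
    by (intro skew.idem_rel_diag_perm) (auto simp: mset_vertex_list)
  ultimately show ?thesis by (rule mats.idem_rel_trans)
qed

lemma supported_below_vertex_mat: "supported_below (B K) (size A) (vertex_mat K n A)"
proof -
  have "length (vertex_list n A) = size A"
    using arg_cong[OF mset_vertex_list[of n A], of size] by simp
  then show ?thesis
    by (auto simp: supported_below_def vertex_mat_def skew.class_mat_def skew.diag_mat_def
        skew.kumjian_pask_simps split: if_splits)
qed

text \<open>Both sums are equivalent to one and the same block matrix, built from the
  representatives at level m.\<close>

lemma vertex_mat_add:
  assumes "set_mset A \<subseteq> verts \<Lambda>" "set_mset A' \<subseteq> verts \<Lambda>" "set_mset C \<subseteq> verts \<Lambda>" "set_mset C' \<subseteq> verts \<Lambda>"
    and A: "(vertex_mat K m A, vertex_mat K n A') \<in> idem_rel (B K)"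
    and C: "(vertex_mat K m C, vertex_mat K n C') \<in> idem_rel (B K)"
  shows "(vertex_mat K m (A + C), vertex_mat K n (A' + C')) \<in> idem_rel (B K)"
proof -
  let ?b = "block_diag (B K) (size A) (vertex_mat K m A) (vertex_mat K m C)"
  have "(?b, vertex_mat K m (A + C)) \<in> idem_rel (B K)"
    using assms by (intro block_diag_vertex_mat supported_below_vertex_mat mats.idem_rel_refl vertex_mat_idem)
  moreover have "(?b, vertex_mat K n (A' + C')) \<in> idem_rel (B K)"
    using assms by (intro block_diag_vertex_mat supported_below_vertex_mat)
  ultimately show ?thesis using mats.idem_rel_sym mats.idem_rel_trans by blast
qed

section \<open>The isomorphism onto the direct limit and cancellation\<close>

abbreviation V_class where "V_class K e \<equiv> idem_rel (B K) `` {e}"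

lemma V_class_eq_iff: "e \<in> Minf_idem (B K) \<Longrightarrow> f \<in> Minf_idem (B K) \<Longrightarrow>
    V_class K e = V_class K f \<longleftrightarrow> (e, f) \<in> idem_rel (B K)"
  by (rule eq_equiv_class_iff[OF mats.equiv_idem_rel])

lemma V_class_mult:
  assumes A: "set_mset A \<subseteq> verts \<Lambda>" and C: "set_mset C \<subseteq> verts \<Lambda>"
  shows "V_class K (vertex_mat K n A) \<otimes>\<^bsub>Vmonoid (B K)\<^esub> V_class K (vertex_mat K n C) =
    V_class K (vertex_mat K n (A + C))"
proof -
  let ?S = "{V_class K (block_diag (B K) k e f) | k e f. e \<in> V_class K (vertex_mat K n A) \<and>
    f \<in> V_class K (vertex_mat K n C) \<and> supported_below (B K) k e}"
  have "P = V_class K (vertex_mat K n (A + C))" if "P \<in> ?S" for P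
  proof -
    from that obtain k e f where P: "P = V_class K (block_diag (B K) k e f)"
      and e: "(vertex_mat K n A, e) \<in> idem_rel (B K)" and f: "(vertex_mat K n C, f) \<in> idem_rel (B K)"
      and k: "supported_below (B K) k e" by blast
    have "(block_diag (B K) k e f, vertex_mat K n (A + C)) \<in> idem_rel (B K)"
      by (rule block_diag_vertex_mat[OF A C mats.idem_rel_sym[OF e] mats.idem_rel_sym[OF f] k])
    then show ?thesis unfolding P by (rule equiv_class_eq[OF mats.equiv_idem_rel])
  qed
  moreover have "V_class K (block_diag (B K) (size A) (vertex_mat K n A) (vertex_mat K n C)) \<in> ?S"
    using mats.idem_rel_refl[OF vertex_mat_idem[OF A, of K n]] mats.idem_rel_refl[OF vertex_mat_idem[OF C, of K n]]
      supported_below_vertex_mat[of K A n]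
    unfolding mem_Collect_eq by (intro exI conjI refl) simp_all
  ultimately have "\<Union>?S = V_class K (vertex_mat K n (A + C))" by (intro Union_eq_if_const)
  then show ?thesis by (simp add: Vmonoid_def)
qed

text \<open>Three elements are treated together because cancellation involves three; finitely many
  eventual statements share a level.\<close>

lemma Vmonoid_common_level:
  assumes "P \<in> carrier (Vmonoid (B K))" "Q \<in> carrier (Vmonoid (B K))" "R \<in> carrier (Vmonoid (B K))"
  obtains n A C D where "set_mset A \<subseteq> verts \<Lambda>" "set_mset C \<subseteq> verts \<Lambda>" "set_mset D \<subseteq> verts \<Lambda>"
    "P = V_class K (vertex_mat K n A)" "Q = V_class K (vertex_mat K n C)" "R = V_class K (vertex_mat K n D)"
proof -
  have *: "\<forall>\<^sub>F n in at_top. \<exists>A. set_mset A \<subseteq> verts \<Lambda> \<and> P = V_class K (vertex_mat K n A)"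
    if P: "P \<in> carrier (Vmonoid (B K))" for P
  proof -
    obtain e where e: "e \<in> Minf_idem (B K)" "P = V_class K e"
      using P by (auto simp: Vmonoid_def elim: quotientE)
    from equiv_vertex_mat[OF e(1)] show ?thesis
      by eventually_elim (use e(2) equiv_class_eq[OF mats.equiv_idem_rel] in blast)
  qed
  have "\<forall>\<^sub>F n in at_top. (\<exists>A. set_mset A \<subseteq> verts \<Lambda> \<and> P = V_class K (vertex_mat K n A)) \<and>
      (\<exists>A. set_mset A \<subseteq> verts \<Lambda> \<and> Q = V_class K (vertex_mat K n A)) \<and>
      (\<exists>A. set_mset A \<subseteq> verts \<Lambda> \<and> R = V_class K (vertex_mat K n A))"
    using *[OF assms(1)] *[OF assms(2)] *[OF assms(3)] by eventually_elim blast
  from eventually_happens'[OF at_top_vec_neq_bot this] show thesis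
    by (elim exE conjE) (rule that)
qed

text \<open>Elements of the direct limit are themselves sets of representatives \<open>(n, A)\<close>, so no choice is
  needed.\<close>

definition limit_map :: "'f::field itself \<Rightarrow> (nat \<Rightarrow> nat \<Rightarrow> (('a \<times> (int ^ 'k)) kp_gen word \<Rightarrow>\<^sub>0 'f) set) set
    \<Rightarrow> ((int ^ 'k) \<times> 'a multiset) set" where
  "limit_map K P = {(n, A). set_mset A \<subseteq> verts \<Lambda> \<and> vertex_mat K n A \<in> P}"

text \<open>By \<open>vertex_mat_rel_iff\<close>, the representatives of a class are exactly the
  pairs identified with \<open>(n, A)\<close> in the limit.\<close>

lemma limit_map_V_class:
  assumes "set_mset A \<subseteq> verts \<Lambda>"
  shows "limit_map K (V_class K (vertex_mat K n A)) = vertex_limit_class \<Lambda> n A"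
  using vertex_mat_rel_iff[OF assms, of _ K n]
  by (auto simp: limit_map_def dirlim_class_def dirlim_rel_def assms)

lemma limit_map_mult:
  assumes P: "P \<in> carrier (Vmonoid (B K))" and Q: "Q \<in> carrier (Vmonoid (B K))"
  shows "limit_map K (P \<otimes>\<^bsub>Vmonoid (B K)\<^esub> Q) = limit_map K P \<otimes>\<^bsub>vertex_limit \<Lambda>\<^esub> limit_map K Q"
proof -
  obtain n A C where A: "set_mset A \<subseteq> verts \<Lambda>" "P = V_class K (vertex_mat K n A)"
    and C: "set_mset C \<subseteq> verts \<Lambda>" "Q = V_class K (vertex_mat K n C)"
    using Vmonoid_common_level[OF P Q Q] by metis
  have AC: "set_mset (A + C) \<subseteq> verts \<Lambda>" using A C by simp
  let ?S = "{vertex_limit_class \<Lambda> p (connecting_map \<Lambda> m p x + connecting_map \<Lambda> m' p y) | m x m' y p.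
    (m, x) \<in> limit_map K P \<and> (m', y) \<in> limit_map K Q \<and> m \<le> p \<and> m' \<le> p}"
  have "X = limit_map K (V_class K (vertex_mat K n (A + C)))" if "X \<in> ?S" for X
  proof -
    from that obtain m x m' y p where X: "X = vertex_limit_class \<Lambda> p (connecting_map \<Lambda> m p x + connecting_map \<Lambda> m' p y)"
      and xy: "(m, x) \<in> limit_map K P" "(m', y) \<in> limit_map K Q" and p: "m \<le> p" "m' \<le> p" by blast
    have x: "set_mset x \<subseteq> verts \<Lambda>" "(vertex_mat K n A, vertex_mat K m x) \<in> idem_rel (B K)"
      and y: "set_mset y \<subseteq> verts \<Lambda>" "(vertex_mat K n C, vertex_mat K m' y) \<in> idem_rel (B K)"
      using xy A C by (auto simp: limit_map_def)
    have sets: "set_mset (connecting_map \<Lambda> m p x) \<subseteq> verts \<Lambda>" "set_mset (connecting_map \<Lambda> m' p y) \<subseteq> verts \<Lambda>"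
      by (rule set_connecting_map[OF x(1)], rule set_connecting_map[OF y(1)])
    have "(vertex_mat K n A, vertex_mat K p (connecting_map \<Lambda> m p x)) \<in> idem_rel (B K)"
      by (rule mats.idem_rel_trans[OF x(2) vertex_mat_connecting_map[OF x(1) p(1)]])
    moreover have "(vertex_mat K n C, vertex_mat K p (connecting_map \<Lambda> m' p y)) \<in> idem_rel (B K)"
      by (rule mats.idem_rel_trans[OF y(2) vertex_mat_connecting_map[OF y(1) p(2)]])
    ultimately have "(vertex_mat K n (A + C), vertex_mat K p (connecting_map \<Lambda> m p x + connecting_map \<Lambda> m' p y)) \<in> idem_rel (B K)"
      by (rule vertex_mat_add[OF A(1) sets(1) C(1) sets(2)])
    then have "V_class K (vertex_mat K n (A + C)) = V_class K (vertex_mat K p (connecting_map \<Lambda> m p x + connecting_map \<Lambda> m' p y))"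
      by (rule equiv_class_eq[OF mats.equiv_idem_rel])
    then show ?thesis unfolding X using sets by (simp add: limit_map_V_class)
  qed
  \<comment> \<open>The union is not empty: the connecting map from n to n already supplies a
    member.\<close>
  moreover have "vertex_limit_class \<Lambda> n (connecting_map \<Lambda> n n A + connecting_map \<Lambda> n n C) \<in> ?S"
  proof -
    have "(n, A) \<in> limit_map K P" "(n, C) \<in> limit_map K Q"
      using A C mats.idem_rel_refl[OF vertex_mat_idem[OF A(1)]] mats.idem_rel_refl[OF vertex_mat_idem[OF C(1)]]
      by (simp_all add: limit_map_def)
    then show ?thesis
      by (intro CollectI exI[of _ n] exI[of _ A] exI[of _ C] conjI refl) simp_all
  qed
  ultimately have "\<Union>?S = limit_map K (V_class K (vertex_mat K n (A + C)))" by (intro Union_eq_if_const)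
  then show ?thesis unfolding A(2) C(2) V_class_mult[OF A(1) C(1)] by (simp add: dirlim_def A(2) C(2))
qed

lemma limit_map_bij: "bij_betw (limit_map K) (carrier (Vmonoid (B K))) (carrier (vertex_limit \<Lambda>))"
proof (rule bij_betw_imageI)
  show "inj_on (limit_map K) (carrier (Vmonoid (B K)))"
  proof (rule inj_onI)
    fix P Q assume PQ: "P \<in> carrier (Vmonoid (B K))" "Q \<in> carrier (Vmonoid (B K))" and eq: "limit_map K P = limit_map K Q"
    obtain n A C where A: "set_mset A \<subseteq> verts \<Lambda>" "P = V_class K (vertex_mat K n A)"
      and C: "set_mset C \<subseteq> verts \<Lambda>" "Q = V_class K (vertex_mat K n C)"
      using Vmonoid_common_level[OF PQ PQ(2)] by metis
    \<comment> \<open>Equal images share the representative \<open>(n, A)\<close>, so the two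
      classes meet and coincide.\<close>
    have "(n, A) \<in> limit_map K P"
      using A mats.idem_rel_refl[OF vertex_mat_idem[OF A(1)]] by (simp add: limit_map_def)
    then have "(vertex_mat K n C, vertex_mat K n A) \<in> idem_rel (B K)"
      unfolding eq C(2) by (simp add: limit_map_def)
    then show "P = Q" unfolding A(2) C(2) by (rule equiv_class_eq[OF mats.equiv_idem_rel, symmetric])
  qed
  show "limit_map K ` carrier (Vmonoid (B K)) = carrier (vertex_limit \<Lambda>)"
  proof (intro equalityI subsetI)
    fix X assume "X \<in> limit_map K ` carrier (Vmonoid (B K))"
    then obtain P where P: "P \<in> carrier (Vmonoid (B K))" "X = limit_map K P" by blast
    obtain n A where "set_mset A \<subseteq> verts \<Lambda>" "P = V_class K (vertex_mat K n A)"
      using Vmonoid_common_level[OF P(1) P(1) P(1)] by metis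
    then show "X \<in> carrier (vertex_limit \<Lambda>)" unfolding P(2) by (auto simp: limit_map_V_class dirlim_def)
  next
    fix X assume "X \<in> carrier (vertex_limit \<Lambda>)"
    then obtain n A where A: "set_mset A \<subseteq> verts \<Lambda>" "X = vertex_limit_class \<Lambda> n A" by (auto simp: dirlim_def)
    have "V_class K (vertex_mat K n A) \<in> carrier (Vmonoid (B K))"
      by (simp add: Vmonoid_def quotientI[OF vertex_mat_idem[OF A(1)]])
    then show "X \<in> limit_map K ` carrier (Vmonoid (B K))"
      using limit_map_V_class[OF A(1)] A(2) by blast
  qed
qed

lemma limit_map_iso: "limit_map K \<in> iso (Vmonoid (B K)) (vertex_limit \<Lambda>)"
  using limit_map_bij[of K] limit_map_mult[of _ K]
  by (auto simp: iso_def hom_def bij_betw_def)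

lemma vertex_mat_empty: "vertex_mat K n {#} = (\<lambda>i j. \<zero>\<^bsub>B K\<^esub>)"
  by (simp add: vertex_mat_def vertex_list_def skew.class_mat_def skew.diag_mat_def skew.kumjian_pask_simps)

lemma limit_map_one: "limit_map K \<one>\<^bsub>Vmonoid (B K)\<^esub> = \<one>\<^bsub>vertex_limit \<Lambda>\<^esub>"
proof -
  \<comment> \<open>The zero matrix is the empty diagonal matrix at every level, so all classes in
    the union that defines the unit of the limit coincide.\<close>
  have one: "\<one>\<^bsub>Vmonoid (B K)\<^esub> = V_class K (vertex_mat K n {#})" for n
    by (simp add: Vmonoid_def vertex_mat_empty)
  have "vertex_limit_class \<Lambda> n {#} = limit_map K \<one>\<^bsub>Vmonoid (B K)\<^esub>" for n
    unfolding one[of n] by (simp add: limit_map_V_class)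
  then show ?thesis by (auto simp: dirlim_def)
qed

lemma limit_map_vertex:
  assumes "v \<in> verts \<Lambda>"
  shows "limit_map K (Vclass (B K) (kp_vertex K (skew_product \<Lambda>) (v, n))) = vertex_limit_class \<Lambda> n {#v#}"
proof -
  have "vertex_list n {#v#} = [(v, n)]"
  proof -
    have "mset (SOME l. mset l = {#v#}) = {#v#}" by (rule someI_ex) (rule ex_mset)
    then show ?thesis by (simp add: vertex_list_def)
  qed
  then have "vertex_mat K n {#v#} = (\<lambda>i j. if i = 0 \<and> j = 0 then kp_vertex K (skew_product \<Lambda>) (v, n) else \<zero>\<^bsub>B K\<^esub>)"
    by (auto simp: vertex_mat_def skew.class_mat_def skew.diag_mat_def skew.kumjian_pask_simps kp_vertex_def fun_eq_iff)
  then have "Vclass (B K) (kp_vertex K (skew_product \<Lambda>) (v, n)) = V_class K (vertex_mat K n {#v#})"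
    by (simp add: Vclass_def)
  then show ?thesis using assms by (simp add: limit_map_V_class)
qed

text \<open>Equality of the two sums becomes, at some level p, an equality of finite multisets. The
  connecting map is additive and multisets cancel, and the equality that remains at level p already
  means equivalence of the idempotents.\<close>

lemma cancellative_Vmonoid: "cancellative (Vmonoid (B K))"
  unfolding cancellative_def
proof (intro ballI impI)
  fix P Q R assume PQR: "P \<in> carrier (Vmonoid (B K))" "Q \<in> carrier (Vmonoid (B K))" "R \<in> carrier (Vmonoid (B K))"
    and eq: "P \<otimes>\<^bsub>Vmonoid (B K)\<^esub> R = Q \<otimes>\<^bsub>Vmonoid (B K)\<^esub> R"
  obtain n A C D where sets: "set_mset A \<subseteq> verts \<Lambda>" "set_mset C \<subseteq> verts \<Lambda>" "set_mset D \<subseteq> verts \<Lambda>"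
    and PQR': "P = V_class K (vertex_mat K n A)" "Q = V_class K (vertex_mat K n C)" "R = V_class K (vertex_mat K n D)"
    using Vmonoid_common_level[OF PQR] by metis
  have AD: "set_mset (A + D) \<subseteq> verts \<Lambda>" and CD: "set_mset (C + D) \<subseteq> verts \<Lambda>" using sets by auto
  have "(vertex_mat K n (A + D), vertex_mat K n (C + D)) \<in> idem_rel (B K)"
    using eq unfolding PQR' V_class_mult[OF sets(1,3)] V_class_mult[OF sets(2,3)]
      V_class_eq_iff[OF vertex_mat_idem[OF AD] vertex_mat_idem[OF CD]] .
  then obtain p where "n \<le> p" "connecting_map \<Lambda> n p (A + D) = connecting_map \<Lambda> n p (C + D)"
    unfolding vertex_mat_rel_iff[OF AD CD] by blast
  then have "n \<le> p" "connecting_map \<Lambda> n p A = connecting_map \<Lambda> n p C" by (simp_all add: connecting_map_add)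
  then have "(vertex_mat K n A, vertex_mat K n C) \<in> idem_rel (B K)"
    using vertex_mat_rel_iff[OF sets(1,2)] by blast
  then show "P = Q" unfolding PQR' by (rule equiv_class_eq[OF mats.equiv_idem_rel])
qed

end

theorem corollary6p6:
  fixes \<Lambda> :: "('a, 'k::finite) kgraph" and K :: "'f::field itself"
  assumes "is_kgraph \<Lambda>" and "row_finite \<Lambda>" and "no_sources \<Lambda>"
  shows "(\<exists>h \<in> iso (Vmonoid (kumjian_pask K (skew_product \<Lambda>))) (vertex_limit \<Lambda>).
      h \<one>\<^bsub>Vmonoid (kumjian_pask K (skew_product \<Lambda>))\<^esub> = \<one>\<^bsub>vertex_limit \<Lambda>\<^esub> \<and>
      (\<forall>v \<in> verts \<Lambda>. \<forall>n.
         h (Vclass (kumjian_pask K (skew_product \<Lambda>)) (kp_vertex K (skew_product \<Lambda>) (v, n)))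
           = vertex_limit_class \<Lambda> n {#v#}))
    \<and> cancellative (Vmonoid (kumjian_pask K (skew_product \<Lambda>)))"
proof -
  interpret row_finite_kgraph \<Lambda>
    using assms(1,2) by (simp add: row_finite_kgraph_def row_finite_kgraph_axioms_def)
  show ?thesis
    using limit_map_iso[of K] limit_map_one[of K] limit_map_vertex[of _ K] cancellative_Vmonoid[of K] by blast
qed

end
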